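(* Let $\Omega$ be a bounded domain in $\mathbb{R}^n$ with $n\ge2$. Suppose that $\mathcal{A}(x,z)$ is a nonnegative semidefinite matrix in $\Omega\times\mathbb{R}$ satisfying $$k\,\xi^{T}A(x)\xi\le \xi^{T}\mathcal{A}(x,z)\xi\le K\,\xi^{T}A(x)\xi\qquad\text{for a.e. }x\in\Omega\text{ and all }z\in\mathbb{R},\ \xi\in\mathbb{R}^n,$$ where $k,K>0$ are constants and $A(x)=B(x)^{\mathrm{tr}}B(x)$ with $B(x)$ a Lipschitz continuous real $n\times n$ matrix-valued function on $\Omega$. Let $u$ be a nonnegative weak subsolution of $\nabla^{\mathrm{tr}}\mathcal{A}(x,u(x))\nabla u=\phi$ in $\Omega$. Then $$\operatorname*{ess\,sup}_{x\in\Omega}u(x)\le\sup_{x\in\partial\Omega}u(x)+C\|\phi\|_{X(\Omega)},$$ where the constant $C$ depends only on $\Omega$ (the data $A$, $k$, $K$, $N$ and the Sobolev constant below being fixed; $C$ does not depend on $u$ or $\phi$), provided that: 1. the function $\phi$ is $A$-admissible for $\Omega$; 2. the $\Phi$-Orlicz Sobolev bump inequality for $\Omega$ holds with $\Phi=\Phi_N$ for some $N>1$, i.e. there is a constant $C_0$ such that $\|w\|_{L^{\Phi}(\Omega)}\le C_0\|\nabla_A w\|_{L^1(\Omega)}$ for all Lipschitz $w$ with compact support in $\Omega$.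
   Context: $\nabla_A=B(x)\nabla$. $W^{1,2}_A(\Omega)$ has norm $\left(\int_\Omega|v|^2+|\nabla_Av|^2\right)^{1/2}$, and $W^{1,1}_A$ has norm $\int|v|+|\nabla_Av|$. $(W^{1,p}_A)_0(\Omega)$ is the closure in $W^{1,p}_A(\Omega)$ of the Lipschitz functions with compact support in $\Omega$. $\phi$ is $A$-admissible for $\Omega$ if $\|\phi\|_{X(\Omega)}:=\sup_{v\in(W^{1,1}_A)_0(\Omega)}\dfrac{\int_\Omega|v\phi|\,dy}{\int_\Omega|\nabla_Av|\,dy}<\infty$. $u\in W^{1,2}_A(\Omega)$ is a weak subsolution if $-\int_\Omega\nabla w^{\mathrm{tr}}\mathcal{A}(x,u(x))\nabla u\ge\int_\Omega\phi w$ for all nonnegative $w\in(W^{1,2}_A)_0(\Omega)$. $\sup_{\partial\Omega}u:=\inf\{\ell\in\mathbb{R}:(u-\ell)^+\in(W^{1,2}_A)_0(\Omega)\}$. $\Phi_N(t)=t(\ln t)^N$ if $t\ge E_N=e^{2N}$ and $\Phi_N(t)=(\ln E_N)^Nt$ if $0\le t\le E_N$; $\|f\|_{L^\Phi(\Omega)}=\inf\{k>0:\int_\Omega\Phi(|f|/k)\,dx\le1\}$. *)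

theory Defs
  imports "HOL-Analysis.Analysis" "HOL-Probability.Essential_Supremum"
begin

(* The classical gradient. It is applied only to (locally) Lipschitz functions, which are
   differentiable almost everywhere (Rademacher); the value 0 elsewhere is immaterial. *)
definition grad :: "(real^'n \<Rightarrow> real) \<Rightarrow> real^'n \<Rightarrow> real^'n" where
  "grad f x = (if f differentiable (at x)
               then (\<chi> i. frechet_derivative f (at x) (axis i 1)) else 0)"

definition locally_lipschitz :: "(real^'n) set \<Rightarrow> (real^'n \<Rightarrow> real) \<Rightarrow> bool" where
  "locally_lipschitz \<Omega> f \<longleftrightarrow> (\<forall>K. compact K \<and> K \<subseteq> \<Omega> \<longrightarrow> (\<exists>L. L-lipschitz_on K f))"

definition lipschitz_compact_support :: "(real^'n) set \<Rightarrow> (real^'n \<Rightarrow> real) \<Rightarrow> bool" where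
  "lipschitz_compact_support \<Omega> f \<longleftrightarrow>
     (\<exists>L. L-lipschitz_on UNIV f) \<and> compact (closure {x. f x \<noteq> 0}) \<and> closure {x. f x \<noteq> 0} \<subseteq> \<Omega>"

definition nonneg_semidefinite :: "real^'n^'n \<Rightarrow> bool" where
  "nonneg_semidefinite M \<longleftrightarrow> transpose M = M \<and> (\<forall>\<xi>. 0 \<le> \<xi> \<bullet> (M *v \<xi>))"

(* The p-th power of the norm of W^{1,p}_A, for a function v whose gradient is the field G;
   the A-gradient is then B G. *)
definition sobolev_energy ::
  "real \<Rightarrow> (real^'n \<Rightarrow> real^'n^'n) \<Rightarrow> (real^'n) set \<Rightarrow> (real^'n \<Rightarrow> real) \<Rightarrow> (real^'n \<Rightarrow> real^'n) \<Rightarrow> ennreal"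
where
  "sobolev_energy p B \<Omega> v G =
     (\<integral>\<^sup>+x. ennreal (\<bar>v x\<bar> powr p + norm (B x *v G x) powr p) \<partial>lebesgue_on \<Omega>)"

(* W^{1,p}_A as the completion, in its norm, of the locally Lipschitz functions of finite norm.
   An element is a function u together with a measurable vector field G that plays the role of
   its gradient. Since B may be degenerate, only the A-gradient B G is determined by u (a.e.,
   because B is Lipschitz), while G itself is determined modulo the kernel of B. For Lipschitz B
   this agrees with the space of all u in L^p whose distributional A-gradient lies in L^p
   (the Meyers-Serrin theorem of Franchi-Serapioni-Serra Cassano and Garofalo-Nhieu). *)
definition sobolev_grad ::
  "real \<Rightarrow> (real^'n \<Rightarrow> real^'n^'n) \<Rightarrow> (real^'n) set \<Rightarrow> (real^'n \<Rightarrow> real) \<Rightarrow> (real^'n \<Rightarrow> real^'n) \<Rightarrow> bool"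
where
  "sobolev_grad p B \<Omega> u G \<longleftrightarrow>
     u \<in> borel_measurable (lebesgue_on \<Omega>) \<and> G \<in> borel_measurable (lebesgue_on \<Omega>) \<and>
     sobolev_energy p B \<Omega> u G < \<infinity> \<and>
     (\<forall>\<epsilon>>0. \<exists>v. locally_lipschitz \<Omega> v \<and>
        sobolev_energy p B \<Omega> (\<lambda>x. u x - v x) (\<lambda>x. G x - grad v x) < \<epsilon>)"

definition sobolev_grad_0 ::
  "real \<Rightarrow> (real^'n \<Rightarrow> real^'n^'n) \<Rightarrow> (real^'n) set \<Rightarrow> (real^'n \<Rightarrow> real) \<Rightarrow> (real^'n \<Rightarrow> real^'n) \<Rightarrow> bool"
where
  "sobolev_grad_0 p B \<Omega> w H \<longleftrightarrow>
     sobolev_grad p B \<Omega> w H \<and>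
     (\<forall>\<epsilon>>0. \<exists>v. lipschitz_compact_support \<Omega> v \<and>
        sobolev_energy p B \<Omega> (\<lambda>x. w x - v x) (\<lambda>x. H x - grad v x) < \<epsilon>)"

definition sobolev :: "real \<Rightarrow> (real^'n \<Rightarrow> real^'n^'n) \<Rightarrow> (real^'n) set \<Rightarrow> (real^'n \<Rightarrow> real) set" where
  "sobolev p B \<Omega> = {u. \<exists>G. sobolev_grad p B \<Omega> u G}"

definition sobolev_0 :: "real \<Rightarrow> (real^'n \<Rightarrow> real^'n^'n) \<Rightarrow> (real^'n) set \<Rightarrow> (real^'n \<Rightarrow> real) set" where
  "sobolev_0 p B \<Omega> = {w. \<exists>H. sobolev_grad_0 p B \<Omega> w H}"

(* In ennreal, 0 / 0 = 0 and a / 0 = \<infinity> for a > 0, so that v = 0 does not contribute. *)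
definition X_norm :: "(real^'n \<Rightarrow> real^'n^'n) \<Rightarrow> (real^'n) set \<Rightarrow> (real^'n \<Rightarrow> real) \<Rightarrow> ennreal" where
  "X_norm B \<Omega> \<phi> =
     (SUP (v, G) \<in> {(v, G). sobolev_grad_0 1 B \<Omega> v G}.
        (\<integral>\<^sup>+x. ennreal \<bar>v x * \<phi> x\<bar> \<partial>lebesgue_on \<Omega>) /
        (\<integral>\<^sup>+x. ennreal (norm (B x *v G x)) \<partial>lebesgue_on \<Omega>))"

definition A_admissible :: "(real^'n \<Rightarrow> real^'n^'n) \<Rightarrow> (real^'n) set \<Rightarrow> (real^'n \<Rightarrow> real) \<Rightarrow> bool" where
  "A_admissible B \<Omega> \<phi> \<longleftrightarrow> \<phi> \<in> borel_measurable (lebesgue_on \<Omega>) \<and> X_norm B \<Omega> \<phi> < \<infinity>"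

(* The integral of (grad w)^tr \<A>(x,u) (grad u) does not depend on the choice of the gradient
   fields H and G: if \<A>(x,z) is symmetric and 0 \<le> \<A>(x,z) \<le> K B^tr B, then the kernel of
   \<A>(x,z) contains the kernel of B. *)
definition weak_subsolution ::
  "(real^'n \<Rightarrow> real^'n^'n) \<Rightarrow> (real^'n \<Rightarrow> real \<Rightarrow> real^'n^'n) \<Rightarrow> (real^'n) set \<Rightarrow>
   (real^'n \<Rightarrow> real) \<Rightarrow> (real^'n \<Rightarrow> real) \<Rightarrow> bool"
where
  "weak_subsolution B \<A> \<Omega> \<phi> u \<longleftrightarrow>
     u \<in> sobolev 2 B \<Omega> \<and>
     (\<forall>G w H. sobolev_grad 2 B \<Omega> u G \<and> sobolev_grad_0 2 B \<Omega> w H \<and>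
              (AE x in lebesgue_on \<Omega>. 0 \<le> w x) \<longrightarrow>
        - (\<integral>x. H x \<bullet> (\<A> x (u x) *v G x) \<partial>lebesgue_on \<Omega>) \<ge> (\<integral>x. \<phi> x * w x \<partial>lebesgue_on \<Omega>))"

definition boundary_sup ::
  "(real^'n \<Rightarrow> real^'n^'n) \<Rightarrow> (real^'n) set \<Rightarrow> (real^'n \<Rightarrow> real) \<Rightarrow> ereal" where
  "boundary_sup B \<Omega> u = Inf (ereal ` {l. (\<lambda>x. max (u x - l) 0) \<in> sobolev_0 2 B \<Omega>})"

definition orlicz_bump :: "real \<Rightarrow> real \<Rightarrow> real" where
  "orlicz_bump N t =
     (if t \<ge> exp (2 * N) then t * ln t powr N else ln (exp (2 * N)) powr N * t)"

definition orlicz_norm :: "(real \<Rightarrow> real) \<Rightarrow> (real^'n) set \<Rightarrow> (real^'n \<Rightarrow> real) \<Rightarrow> ennreal" where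
  "orlicz_norm \<Phi> \<Omega> f =
     Inf (ennreal ` {k. k > 0 \<and> (\<integral>\<^sup>+x. ennreal (\<Phi> (\<bar>f x\<bar> / k)) \<partial>lebesgue_on \<Omega>) \<le> 1})"

definition orlicz_sobolev_bump ::
  "(real \<Rightarrow> real) \<Rightarrow> (real^'n \<Rightarrow> real^'n^'n) \<Rightarrow> (real^'n) set \<Rightarrow> real \<Rightarrow> bool" where
  "orlicz_sobolev_bump \<Phi> B \<Omega> C\<^sub>0 \<longleftrightarrow>
     (\<forall>w. lipschitz_compact_support \<Omega> w \<longrightarrow>
        orlicz_norm \<Phi> \<Omega> w \<le>
          ennreal C\<^sub>0 * (\<integral>\<^sup>+x. ennreal (norm (B x *v grad w x)) \<partial>lebesgue_on \<Omega>))"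

end

theory Submission
  imports Defs
begin

text \<open>
  De Giorgi iteration. Testing the equation with \<open>(u - m)\<^sup>+\<close> bounds the \<open>L\<^sup>1\<close> norm of its A-gradient by a
  multiple of \<open>\<parallel>\<phi>\<parallel>\<close> times the measure of \<open>{u > m}\<close>, and the Orlicz-Sobolev inequality turns this into:
  once \<open>{u > m}\<close> has measure at most \<open>a 2\<^sup>-\<^sup>j\<close>, raising the level by a multiple of \<open>\<parallel>\<phi>\<parallel> j\<^sup>-\<^sup>N\<close>
  halves it. The steps are summable because \<open>N > 1\<close>. Only levels \<open>m\<close> with \<open>{u = m}\<close> null are used, so
  that truncation is continuous in the Sobolev norm; the exceptional levels are countable.

  The definition of the spaces allows unrelated gradient fields for \<open>u\<close> and for \<open>(u - l)\<^sup>+\<close>. That their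
  A-gradients agree is closability of \<open>B \<nabla>\<close>, which for the classical gradient of Lipschitz functions
  rests on Rademacher's theorem.
\<close>

section \<open>Rademacher's theorem\<close>

text \<open>The bump function exceeds the identity only by a power of a logarithm, so a power gain
  in measure, as in the classical De Giorgi scheme, is out of reach; the level steps can only decay
  like a power of the logarithm of the measure. The iteration starts from the measure of the whole
  domain, so no prior smallness of a superlevel set, and hence no property of \<open>u\<close>,
  enters the constant. Above the boundary supremum \<open>(u - m)^+\<close> is itself a test
  function, which removes the need for cut-offs.

  The weak inequality lives at exponent 2, whereas the norm of \<phi> and the bump inequality live
  at exponent 1; boundedness of the domain bridges the two. Two places need room: Young's inequality
  divides by a bound for the norm of \<phi>, which may be 0, and the bump inequality survives the
  passage to limits at strictly larger constants. A parameter \<delta> supplies this room and is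
  sent to 0 at the end.

  Rademacher's theorem is reached through Vitali coverings and porous sets, working with outer
  measure so that the sets involved may be arbitrary.\<close>

text \<open>If the outer measure were positive, an open set nearly attaining it would be improved to
  a cover that is too small. The improvement is asked only over open \<open>U\<close>, because the
  members of a Vitali covering are to be kept inside an open set.\<close>

lemma negligible_if_outer_measure_shrinks:
  fixes S :: "'a::euclidean_space set"
  assumes "bounded S" and "c < 1"
    and shrink: "\<And>U. open U \<Longrightarrow> U \<in> lmeasurable \<Longrightarrow> S \<subseteq> U \<Longrightarrow>
      \<exists>T\<in>lmeasurable. S \<subseteq> T \<and> measure lebesgue T \<le> c * measure lebesgue U"
  shows "negligible S"
proof -
  define I where "I = Inf (measure lebesgue ` {T \<in> lmeasurable. S \<subseteq> T})"
  obtain a b :: 'a where "S \<subseteq> cbox a b"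
    using bounded_subset_cbox_symmetric[OF \<open>bounded S\<close>] by blast
  then have ne: "measure lebesgue ` {T \<in> lmeasurable. S \<subseteq> T} \<noteq> {}"
    by blast
  have bdd: "bdd_below (measure lebesgue ` {T \<in> lmeasurable. S \<subseteq> T})"
    by (rule bdd_belowI[of _ 0]) auto
  have le: "I \<le> measure lebesgue T" if "T \<in> lmeasurable" "S \<subseteq> T" for T
    unfolding I_def by (rule cInf_lower) (use that bdd in auto)
  have ex: "\<exists>T\<in>lmeasurable. S \<subseteq> T \<and> measure lebesgue T < I + e" if "e > 0" for e
    using cInf_lessD[OF ne, of "I + e"] that unfolding I_def by auto
  have "I \<le> 0"
  proof (rule ccontr)
    assume "\<not> I \<le> 0"
    define c' where "c' = max c 0"
    have c': "0 \<le> c'" "c' < 1" "c \<le> c'" using \<open>c < 1\<close> by (auto simp: c'_def)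
    \<comment> \<open>A quarter of the gap: \<open>c' * (I + 2 * e)\<close> is then still below
      \<open>I\<close>.\<close>
    define e where "e = (1 - c') * I / 4"
    have "e > 0" using c' \<open>\<not> I \<le> 0\<close> by (simp add: e_def)
    obtain T where T: "T \<in> lmeasurable" "S \<subseteq> T" "measure lebesgue T < I + e"
      using ex[OF \<open>e > 0\<close>] by blast
    obtain U where U: "open U" "T \<subseteq> U" "U - T \<in> lmeasurable" "emeasure lebesgue (U - T) < ennreal e"
      using sets_lebesgue_outer_open[OF fmeasurableD[OF T(1)] \<open>e > 0\<close>] by blast
    have "measure lebesgue (U - T) < e"
      using U(3,4) \<open>e > 0\<close> by (simp add: emeasure_eq_measure2 ennreal_less_iff)
    moreover have "U \<in> lmeasurable" using fmeasurable_Diff_D[OF U(3) T(1) U(2)] .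
    moreover from this have "measure lebesgue (U - T) = measure lebesgue U - measure lebesgue T"
      using T U by (intro measurable_measure_Diff) (auto dest: fmeasurableD)
    ultimately have U: "open U" "T \<subseteq> U" "U \<in> lmeasurable" "measure lebesgue U < measure lebesgue T + e"
      using U by auto
    obtain T' where "T' \<in> lmeasurable" "S \<subseteq> T'" "measure lebesgue T' \<le> c * measure lebesgue U"
      using shrink[OF U(1,3)] U T by blast
    then have "I \<le> c * measure lebesgue U" using le by force
    also have "\<dots> \<le> c' * measure lebesgue U" using c' by (simp add: mult_right_mono)
    also have "\<dots> \<le> c' * (I + 2 * e)" using c' T U by (intro mult_left_mono) auto
    also have "\<dots> = c' * I + c' * (2 * e)" by (simp add: algebra_simps)
    also have "\<dots> \<le> c' * I + 1 * (2 * e)" using c' \<open>e > 0\<close> by (intro add_left_mono mult_right_mono) auto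
    also have "\<dots> = I - (1 - c') * I / 2" by (simp add: e_def field_simps)
    finally show False using c' \<open>\<not> I \<le> 0\<close> by (simp add: mult_le_0_iff)
  qed
  show ?thesis
    unfolding negligible_outer
  proof (intro allI impI)
    fix e :: real assume "0 < e"
    then obtain T where "T \<in> lmeasurable" "S \<subseteq> T" "measure lebesgue T < I + e" using ex by blast
    then show "\<exists>T. S \<subseteq> T \<and> T \<in> lmeasurable \<and> measure lebesgue T < e"
      using \<open>I \<le> 0\<close> by (intro exI[of _ T]) linarith
  qed
qed

text \<open>Two different measures are allowed because the one-dimensional argument compares a
  Stieltjes measure with Lebesgue measure.\<close>

lemma emeasure_UN_le_scaled:
  fixes r :: ennreal
  assumes "countable C" "disjoint_family_on X C" "disjoint_family_on Y C"
    and "\<And>i. i \<in> C \<Longrightarrow> X i \<in> sets M" "\<And>i. i \<in> C \<Longrightarrow> Y i \<in> sets N"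
    and "\<And>i. i \<in> C \<Longrightarrow> emeasure N (Y i) \<le> r * emeasure M (X i)"
  shows "emeasure N (\<Union>i\<in>C. Y i) \<le> r * emeasure M (\<Union>i\<in>C. X i)"
proof -
  have "emeasure N (\<Union>i\<in>C. Y i) = (\<integral>\<^sup>+i. emeasure N (Y i) \<partial>count_space C)"
    using assms by (intro emeasure_UN_countable) auto
  also have "\<dots> \<le> (\<integral>\<^sup>+i. r * emeasure M (X i) \<partial>count_space C)"
    using assms by (intro nn_integral_mono) auto
  also have "\<dots> = r * (\<integral>\<^sup>+i. emeasure M (X i) \<partial>count_space C)"
    by (intro nn_integral_cmult) auto
  also have "\<dots> = r * emeasure M (\<Union>i\<in>C. X i)"
    using assms by (subst emeasure_UN_countable) auto
  finally show ?thesis .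
qed

text \<open>Each small ball of a disjoint Vitali cover contains a hole that misses \<open>E\<close>
  and fills a fixed fraction of its volume. Deleting the holes keeps the porous points covered, up
  to a null set, and shrinks the cover by a fixed factor.\<close>

lemma negligible_porous_points:
  fixes E :: "'a::euclidean_space set"
  assumes "0 < c"
  shows "negligible {x\<in>E. \<forall>r>0. \<exists>y. 0 < dist x y \<and> dist x y < r \<and> ball y (c * dist x y) \<inter> E = {}}"
    (is "negligible ?P0")
proof -
  define P where "P = ?P0"
  have P: "\<exists>y. 0 < dist x y \<and> dist x y < r \<and> ball y (c * dist x y) \<inter> E = {}" if "x \<in> P" "r > 0" for x r
    using that unfolding P_def by blast
  have PE: "P \<subseteq> E" unfolding P_def by blast
  \<comment> \<open>Capping the ratio at 1 keeps the hole inside the ball about \<open>x\<close> of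
    radius twice the distance to \<open>y\<close>.\<close>
  define d where "d = min c 1"
  have d: "0 < d" "d \<le> 1" "d \<le> c" using assms by (auto simp: d_def)
  \<comment> \<open>The radius of a hole is \<open>d / 2\<close> times that of its covering ball,
    hence the volume fraction removed.\<close>
  define k where "k = 1 - (d / 2) ^ DIM('a)"
  have k: "0 \<le> k" "k < 1"
    using d by (auto simp: k_def intro!: power_le_one)
  have "negligible (P \<inter> cbox a b)" for a b
  proof (rule negligible_if_outer_measure_shrinks[OF _ \<open>k < 1\<close>])
    show "bounded (P \<inter> cbox a b)" by (meson bounded_cbox bounded_Int)
  next
    fix U :: "'a set" assume U: "open U" "U \<in> lmeasurable" "P \<inter> cbox a b \<subseteq> U"
    let ?S = "P \<inter> cbox a b"
    define K where "K = {(x, y). x \<noteq> y \<and> cball x (2 * dist x y) \<subseteq> U \<and> ball y (d * dist x y) \<inter> E = {}}"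
    define X where "X = (\<lambda>p::'a \<times> 'a. cball (fst p) (2 * dist (fst p) (snd p)))"
    define Z where "Z = (\<lambda>p::'a \<times> 'a. ball (snd p) (d * dist (fst p) (snd p)))"
    obtain C where C: "countable C" "C \<subseteq> K"
      "pairwise (\<lambda>i j. disjnt (X i) (X j)) C" "negligible (?S - (\<Union>i\<in>C. X i))"
    proof (rule Vitali_covering_theorem_cballs[of K "\<lambda>p. 2 * dist (fst p) (snd p)" ?S fst])
      show "0 < 2 * dist (fst i) (snd i)" if "i \<in> K" for i
        using that by (auto simp: K_def)
    next
      fix x and e :: real assume x: "x \<in> ?S" and "0 < e"
      have "x \<in> U" using x U(3) by auto
      then obtain r where r: "r > 0" "ball x r \<subseteq> U"
        by (rule openE[OF U(1)])
      obtain y where y: "0 < dist x y" "dist x y < min (e/2) (r/2)" "ball y (c * dist x y) \<inter> E = {}"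
        using P[of x "min (e/2) (r/2)"] x r(1) \<open>0 < e\<close> by auto
      have "ball y (d * dist x y) \<subseteq> ball y (c * dist x y)"
        using d y by (intro subset_ball mult_right_mono) auto
      moreover have "cball x (2 * dist x y) \<subseteq> ball x r" using y by auto
      ultimately have "(x, y) \<in> K" using y r by (auto simp: K_def)
      then show "\<exists>i. i \<in> K \<and> x \<in> cball (fst i) (2 * dist (fst i) (snd i)) \<and> 2 * dist (fst i) (snd i) < e"
        using y by (intro exI[of _ "(x,y)"]) auto
    qed (auto simp: X_def)
    have ZX: "Z i \<subseteq> X i" if "i \<in> K" for i
    proof
      fix z assume z: "z \<in> Z i"
      have "d * dist (fst i) (snd i) \<le> 1 * dist (fst i) (snd i)" using d by (intro mult_right_mono) auto
      then show "z \<in> X i" using z dist_triangle[of "fst i" z "snd i"]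
        by (auto simp: X_def Z_def)
    qed
    have XU: "X i \<subseteq> U" if "i \<in> K" for i using that by (auto simp: X_def K_def)
    have ZE: "Z i \<inter> E = {}" if "i \<in> K" for i using that by (auto simp: Z_def K_def)
    define T where "T = (\<Union>i\<in>C. X i - Z i)"
    have dX: "disjoint_family_on X C"
      using C(3) by (simp add: disjoint_family_on_def pairwise_def disjnt_def)
    then have dXZ: "disjoint_family_on (\<lambda>i. X i - Z i) C"
      by (rule disjoint_family_on_bisimulation) auto
    have XZ: "X i \<in> sets lebesgue" "Z i \<in> sets lebesgue" for i
      by (auto simp: X_def Z_def)
    have "emeasure lebesgue T \<le> ennreal k * emeasure lebesgue (\<Union>i\<in>C. X i)"
      unfolding T_def
    proof (rule emeasure_UN_le_scaled)
      fix i assume "i \<in> C"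
      then have i: "i \<in> K" using C by auto
      let ?w = "measure lebesgue (ball (0::'a) 1)" and ?\<rho> = "dist (fst i) (snd i)"
      have "measure lebesgue (X i) = (2 * ?\<rho>) ^ DIM('a) * ?w"
        using content_ball_conv_unit_ball[of "2 * ?\<rho>" "fst i"] by (simp add: X_def content_cball_conv_ball)
      moreover have "measure lebesgue (Z i) = (d * ?\<rho>) ^ DIM('a) * ?w"
        using content_ball_conv_unit_ball[of "d * ?\<rho>" "snd i"] d by (simp add: Z_def)
      moreover have "(d * ?\<rho>) ^ DIM('a) = (d/2) ^ DIM('a) * (2 * ?\<rho>) ^ DIM('a)"
        by (subst power_mult_distrib[symmetric]) simp
      ultimately have "measure lebesgue (Z i) = (d/2) ^ DIM('a) * measure lebesgue (X i)"
        by (simp only: mult.assoc)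
      then have "measure lebesgue (X i) - measure lebesgue (Z i) = k * measure lebesgue (X i)"
        by (simp only: k_def left_diff_distrib mult_1)
      moreover have "measure lebesgue (X i - Z i) = measure lebesgue (X i) - measure lebesgue (Z i)"
        using ZX[OF i] by (intro measurable_measure_Diff) (auto simp: X_def Z_def)
      ultimately have "measure lebesgue (X i - Z i) = k * measure lebesgue (X i)" by simp
      moreover have "X i \<in> lmeasurable" "X i - Z i \<in> lmeasurable"
        by (auto simp: X_def Z_def intro!: fmeasurable.Diff)
      ultimately show "emeasure lebesgue (X i - Z i) \<le> ennreal k * emeasure lebesgue (X i)"
        using k by (simp add: emeasure_eq_measure2 ennreal_mult)
    qed (use C(1) dX dXZ XZ in auto)
    also have "\<dots> \<le> ennreal k * emeasure lebesgue U"
      using XU C U by (intro mult_left_mono emeasure_mono) auto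
    finally have le: "emeasure lebesgue T \<le> ennreal (k * measure lebesgue U)"
      using U k by (simp add: emeasure_eq_measure2 ennreal_mult)
    have Tm: "T \<in> sets lebesgue"
      unfolding T_def using C(1) XZ by (intro sets.countable_UN') auto
    then have T: "T \<in> lmeasurable"
      using le by (intro fmeasurableI) (auto simp: top.not_eq_extremum intro: le_less_trans)
    let ?N = "?S - (\<Union>i\<in>C. X i)"
    have N: "?N \<in> lmeasurable" "measure lebesgue ?N = 0"
      using C(4) by (auto simp: negligible_imp_measurable negligible_imp_measure0)
    show "\<exists>T\<in>lmeasurable. ?S \<subseteq> T \<and> measure lebesgue T \<le> k * measure lebesgue U"
    proof (intro bexI conjI)
      show "?S \<subseteq> T \<union> ?N" using ZE C PE unfolding T_def by blast
      have "measure lebesgue (T \<union> ?N) \<le> measure lebesgue T + measure lebesgue ?N"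
        using T N by (intro measure_Un_le) auto
      also have "\<dots> \<le> k * measure lebesgue U"
        using le T N k by (simp add: emeasure_eq_measure2)
      finally show "measure lebesgue (T \<union> ?N) \<le> k * measure lebesgue U" .
      show "T \<union> ?N \<in> lmeasurable" using T N by (intro fmeasurable.Un)
    qed
  qed
  then show ?thesis by (subst negligible_on_intervals) (simp add: P_def)
qed

section \<open>Differentiability of Lipschitz functions of one variable\<close>

text \<open>The intervals need only contain the point, not be centred at it. This matters because a
  difference quotient at \<open>x\<close> lives on an interval with \<open>x\<close> as an
  endpoint.\<close>

lemma Vitali_covering_intervals:
  fixes S U :: "real set"
  assumes "open U" "S \<subseteq> U"
    and fine: "\<And>x d. x \<in> S \<Longrightarrow> 0 < d \<Longrightarrow> \<exists>a b. a < b \<and> x \<in> {a..b} \<and> b - a < d \<and> Q a b"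
  obtains C where "countable C" "disjoint_family_on (\<lambda>i. {fst i..snd i}) C"
    "\<forall>i\<in>C. fst i < snd i \<and> {fst i..snd i} \<subseteq> U \<and> Q (fst i) (snd i)"
    "negligible (S - (\<Union>i\<in>C. {fst i..snd i}))"
proof -
  define K where "K = {i. fst i < snd i \<and> {fst i..snd i} \<subseteq> U \<and> Q (fst i) (snd i)}"
  have ball: "cball ((fst i + snd i) / 2) ((snd i - fst i) / 2) = {fst i..snd i}" for i :: "real \<times> real"
    by (simp add: cball_eq_atLeastAtMost field_simps)
  obtain C where "countable C" "C \<subseteq> K"
    "pairwise (\<lambda>i j. disjnt {fst i..snd i} {fst j..snd j}) C"
    "negligible (S - (\<Union>i\<in>C. {fst i..snd i}))"
  proof (rule Vitali_covering_theorem_cballs[of K "\<lambda>i. (snd i - fst i) / 2" S "\<lambda>i. (fst i + snd i) / 2", unfolded ball])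
    show "0 < (snd i - fst i) / 2" if "i \<in> K" for i using that by (auto simp: K_def)
  next
    fix x d :: real assume x: "x \<in> S" "0 < d"
    then obtain r where r: "r > 0" "ball x r \<subseteq> U"
      using assms(1,2) by (meson openE subsetD)
    obtain a b where ab: "a < b" "x \<in> {a..b}" "b - a < min d r" "Q a b"
      using fine[of x "min d r"] x r by auto
    have "{a..b} \<subseteq> ball x r" using ab by (auto simp: dist_real_def)
    then have "(a, b) \<in> K" using ab r by (auto simp: K_def)
    then show "\<exists>i. i \<in> K \<and> x \<in> {fst i..snd i} \<and> (snd i - fst i) / 2 < d"
      using ab x by (intro exI[of _ "(a,b)"]) auto
  qed
  then show thesis
    by (intro that[of C]) (auto simp: K_def pairwise_def disjnt_def disjoint_family_on_def subset_iff)
qed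

text \<open>Two nested Vitali covers. Intervals of slope at most \<open>p\<close> inside
  \<open>U\<close> carry \<open>g\<close>-mass at most \<open>p |U|\<close>; intervals of slope at
  least \<open>q\<close> inside the first ones have length at most their \<open>g\<close>-mass over
  \<open>q\<close>. So the set is covered by measure \<open>p / q * |U|\<close>.\<close>

lemma negligible_derivative_gap:
  fixes g :: "real \<Rightarrow> real"
  assumes "mono g" "continuous_on UNIV g" "0 \<le> p" "p < q"
  shows "negligible {x. (\<forall>d>0. \<exists>a b. a < b \<and> x \<in> {a..b} \<and> b - a < d \<and> g b - g a \<le> p * (b - a)) \<and>
                        (\<forall>d>0. \<exists>a b. a < b \<and> x \<in> {a..b} \<and> b - a < d \<and> q * (b - a) \<le> g b - g a)}"
    (is "negligible ?S0")
proof -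
  define S where "S = ?S0"
  have S1: "\<exists>a b. a < b \<and> x \<in> {a..b} \<and> b - a < d \<and> g b - g a \<le> p * (b - a)" if "x \<in> S" "d > 0" for x d
    using that unfolding S_def by blast
  have S2: "\<exists>a b. a < b \<and> x \<in> {a..b} \<and> b - a < d \<and> q * (b - a) \<le> g b - g a" if "x \<in> S" "d > 0" for x d
    using that unfolding S_def by blast
  let ?\<mu> = "interval_measure g"
  have gI: "emeasure ?\<mu> {a..b} = ennreal (g b - g a)" if "a \<le> b" for a b
    using emeasure_interval_measure_Icc[of a b g] that assms(1,2) by (simp add: monoD)
  have lI: "emeasure lborel {a..b} = ennreal (b - a)" if "a \<le> b" for a b :: real
    using that by simp
  have q: "0 < q" using assms by simp
  have "negligible (S \<inter> cbox l u)" for l u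
  proof (rule negligible_if_outer_measure_shrinks[of _ "p / q"])
    show "bounded (S \<inter> cbox l u)" by (meson bounded_cbox bounded_Int)
    show "p / q < 1" using assms by simp
  next
    fix U assume U: "open U" "U \<in> lmeasurable" "S \<inter> cbox l u \<subseteq> U"
    let ?T = "S \<inter> cbox l u"
    obtain C where C: "countable C" "disjoint_family_on (\<lambda>i. {fst i..snd i}) C"
      "\<forall>i\<in>C. fst i < snd i \<and> {fst i..snd i} \<subseteq> U \<and> g (snd i) - g (fst i) \<le> p * (snd i - fst i)"
      "negligible (?T - (\<Union>i\<in>C. {fst i..snd i}))"
      by (rule Vitali_covering_intervals[OF U(1,3) S1[OF IntD1]])
    \<comment> \<open>The second cover needs an open container. Passing to interiors loses only the
      countably many endpoints.\<close>
    define V where "V = (\<Union>i\<in>C. {fst i<..<snd i})"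
    have "open V" unfolding V_def by auto
    obtain D where D: "countable D" "disjoint_family_on (\<lambda>i. {fst i..snd i}) D"
      "\<forall>i\<in>D. fst i < snd i \<and> {fst i..snd i} \<subseteq> V \<and> q * (snd i - fst i) \<le> g (snd i) - g (fst i)"
      "negligible (?T \<inter> V - (\<Union>i\<in>D. {fst i..snd i}))"
      by (rule Vitali_covering_intervals[OF \<open>open V\<close> Int_lower2[of ?T V] S2[OF IntD1[OF IntD1]]])
    define W where "W = (\<Union>i\<in>D. {fst i..snd i})"
    have C_sets: "(\<Union>i\<in>C. {fst i..snd i}) \<in> sets borel" and W_sets: "W \<in> sets borel"
      unfolding W_def using C(1) D(1) by (auto intro!: sets.countable_UN')
    have "emeasure lborel W \<le> ennreal (1 / q) * emeasure ?\<mu> W"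
      unfolding W_def
    proof (rule emeasure_UN_le_scaled)
      fix i assume "i \<in> D"
      from D(3)[rule_format, OF this] have "snd i - fst i \<le> 1 / q * (g (snd i) - g (fst i))" "fst i \<le> snd i"
        using q by (auto simp: field_simps)
      then show "emeasure lborel {fst i..snd i} \<le> ennreal (1 / q) * emeasure ?\<mu> {fst i..snd i}"
        using q by (simp add: gI ennreal_mult'[symmetric] ennreal_leI)
    qed (use D in auto)
    also have "emeasure ?\<mu> W \<le> emeasure ?\<mu> (\<Union>i\<in>C. {fst i..snd i})"
    proof (rule emeasure_mono)
      have "V \<subseteq> (\<Union>i\<in>C. {fst i..snd i})" unfolding V_def by force
      then show "W \<subseteq> (\<Union>i\<in>C. {fst i..snd i})" using D(3) unfolding W_def by blast
    qed (use C_sets in simp)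
    also have "\<dots> \<le> ennreal p * emeasure lborel (\<Union>i\<in>C. {fst i..snd i})"
    proof (rule emeasure_UN_le_scaled)
      fix i assume "i \<in> C"
      from C(3)[rule_format, OF this] show "emeasure ?\<mu> {fst i..snd i} \<le> ennreal p * emeasure lborel {fst i..snd i}"
        using assms by (simp add: gI ennreal_mult'[symmetric] ennreal_leI)
    qed (use C in auto)
    also have "emeasure lborel (\<Union>i\<in>C. {fst i..snd i}) \<le> emeasure lborel U"
      using C(3) U(1) by (intro emeasure_mono) auto
    finally have le0: "emeasure lborel W \<le> ennreal (1/q) * (ennreal p * emeasure lborel U)"
      by (simp add: mult_left_mono)
    have "emeasure lborel U = ennreal (measure lebesgue U)"
      using U(1,2) emeasure_eq_measure2[of U lebesgue] by simp
    then have le: "emeasure lebesgue W \<le> ennreal (p / q * measure lebesgue U)"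
      using le0 W_sets assms q by (simp add: ennreal_mult'[symmetric] mult.assoc)
    have W: "W \<in> lmeasurable"
      using le W_sets by (intro fmeasurableI) (auto intro: le_less_trans)
    have N: "negligible (?T - W)"
    proof (rule negligible_subset)
      show "negligible ((?T - (\<Union>i\<in>C. {fst i..snd i})) \<union> (fst ` C \<union> snd ` C) \<union> (?T \<inter> V - W))"
        using C(1,4) D(4) unfolding W_def negligible_iff_null_sets
        by (intro null_sets.Un null_sets_completionI[OF countable_imp_null_set_lborel[of "fst ` C \<union> snd ` C"]]) auto
      show "?T - W \<subseteq> (?T - (\<Union>i\<in>C. {fst i..snd i})) \<union> (fst ` C \<union> snd ` C) \<union> (?T \<inter> V - W)"
        unfolding V_def by (force simp: less_le)
    qed
    then have N: "?T - W \<in> lmeasurable" "measure lebesgue (?T - W) = 0"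
      by (auto simp: negligible_imp_measurable negligible_imp_measure0)
    show "\<exists>T\<in>lmeasurable. ?T \<subseteq> T \<and> measure lebesgue T \<le> p / q * measure lebesgue U"
    proof (intro bexI conjI)
      have "measure lebesgue (W \<union> (?T - W)) \<le> measure lebesgue W + measure lebesgue (?T - W)"
        using W N by (intro measure_Un_le) auto
      also have "\<dots> \<le> p / q * measure lebesgue U"
        using le W N assms q by (simp add: emeasure_eq_measure2)
      finally show "measure lebesgue (W \<union> (?T - W)) \<le> p / q * measure lebesgue U" .
      show "W \<union> (?T - W) \<in> lmeasurable" using W N by (intro fmeasurable.Un)
    qed auto
  qed
  then show ?thesis by (subst negligible_on_intervals) (simp add: S_def)
qed

text \<open>Adding \<open>L * x\<close> makes the function monotone with difference quotients in
  \<open>[0, 2 L]\<close>. If these had distinct lower and upper limits at a point, two rationals in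
  between would put it in one of countably many null gap sets.\<close>

lemma negligible_not_differentiable_real:
  fixes f :: "real \<Rightarrow> real"
  assumes "L-lipschitz_on UNIV f"
  shows "negligible {x. \<not> f differentiable (at x)}"
proof -
  define g where "g x = f x + L * x" for x
  have L: "0 \<le> L" using assms by (rule lipschitz_on_nonneg)
  have f: "\<bar>f x - f y\<bar> \<le> L * \<bar>x - y\<bar>" for x y
    using lipschitz_onD[OF assms, of x y] by (simp add: dist_real_def)
  have "mono g"
  proof (rule monoI)
    fix x y :: real assume "x \<le> y"
    then show "g x \<le> g y" using f[of x y] unfolding g_def by (auto simp: algebra_simps abs_if split: if_splits)
  qed
  have "continuous_on UNIV f" using assms by (rule lipschitz_on_continuous_on)
  then have "continuous_on UNIV g" unfolding g_def by (intro continuous_intros)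
  define Z where "Z = (\<lambda>(p, q). {x. (\<forall>d>0. \<exists>a b. a < b \<and> x \<in> {a..b} \<and> b - a < d \<and> g b - g a \<le> p * (b - a)) \<and>
                        (\<forall>d>0. \<exists>a b. a < b \<and> x \<in> {a..b} \<and> b - a < d \<and> q * (b - a) \<le> g b - g a)})"
  define I where "I = {(p, q). p \<in> \<rat> \<and> q \<in> \<rat> \<and> (0::real) \<le> p \<and> p < q}"
  have "countable I"
    by (rule countable_subset[of _ "\<rat> \<times> \<rat>"]) (auto simp: I_def countable_rat)
  have neg: "negligible (\<Union>i\<in>I. Z i)"
  proof (rule negligible_countable_Union)
    show "countable (Z ` I)" using \<open>countable I\<close> by simp
    show "negligible X" if "X \<in> Z ` I" for X
      using that negligible_derivative_gap[OF \<open>mono g\<close> \<open>continuous_on UNIV g\<close>]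
      by (auto simp: Z_def I_def)
  qed
  show ?thesis
  proof (rule negligible_subset[OF neg], rule subsetI, rule ccontr)
    fix x assume x: "x \<in> {x. \<not> f differentiable (at x)}" "x \<notin> (\<Union>i\<in>I. Z i)"
    define Q where "Q h = (g (x + h) - g x) / h" for h
    have int: "\<exists>a b. a < b \<and> x \<in> {a..b} \<and> b - a < d \<and> g b - g a = Q h * (b - a)"
      if "h \<noteq> 0" "\<bar>h\<bar> < d" for h d
    proof (cases "h > 0")
      case True
      then show ?thesis using that unfolding Q_def by (intro exI[of _ x] exI[of _ "x + h"]) auto
    next
      case False
      then show ?thesis using that unfolding Q_def
        by (intro exI[of _ "x + h"] exI[of _ x]) (auto simp: field_simps)
    qed
    have Q0: "0 \<le> Q h" if "h \<noteq> 0" for h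
      using monoD[OF \<open>mono g\<close>, of x "x + h"] monoD[OF \<open>mono g\<close>, of "x + h" x] that
      unfolding Q_def by (cases "h > 0") (auto simp: divide_simps)
    have Q1: "Q h \<le> 2 * L" if "h \<noteq> 0" for h
    proof -
      have "\<bar>(f (x + h) - f x) / h\<bar> \<le> L" using f[of "x+h" x] that by (simp add: divide_simps)
      moreover have "Q h = (f (x + h) - f x) / h + L" using that by (simp add: Q_def g_def field_simps)
      ultimately show ?thesis by linarith
    qed
    let ?F = "at (0::real)"
    have le: "Limsup ?F (\<lambda>h. ereal (Q h)) \<le> Liminf ?F (\<lambda>h. ereal (Q h))"
    proof (rule ccontr)
      assume "\<not> ?thesis"
      then have less: "Liminf ?F (\<lambda>h. ereal (Q h)) < Limsup ?F (\<lambda>h. ereal (Q h))" by simp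
      \<comment> \<open>Three intermediate values leave room for rationals \<open>p < q\<close>
        strictly inside the gap, separated by \<open>r2\<close>.\<close>
      then obtain r1 where r1: "Liminf ?F (\<lambda>h. ereal (Q h)) < ereal r1" "ereal r1 < Limsup ?F (\<lambda>h. ereal (Q h))"
        using ereal_dense2 by blast
      then obtain r2 where r2: "ereal r1 < ereal r2" "ereal r2 < Limsup ?F (\<lambda>h. ereal (Q h))"
        using ereal_dense2 by blast
      then obtain r3 where r3: "ereal r2 < ereal r3" "ereal r3 < Limsup ?F (\<lambda>h. ereal (Q h))"
        using ereal_dense2 by blast
      obtain p where p: "p \<in> \<rat>" "r1 < p" "p < r2" using Rats_dense_in_real[of r1 r2] r2 by auto
      obtain q where q: "q \<in> \<rat>" "r2 < q" "q < r3" using Rats_dense_in_real[of r2 r3] r3 by auto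
      have fr1: "frequently (\<lambda>h. Q h < p) ?F"
      proof (rule ccontr)
        assume "\<not> ?thesis"
        then have "eventually (\<lambda>h. ereal p \<le> ereal (Q h)) ?F" by (simp add: frequently_def not_less)
        then have "ereal p \<le> Liminf ?F (\<lambda>h. ereal (Q h))" by (rule Liminf_bounded)
        then show False using r1 p by (metis ereal_less_eq(3) less_ereal.simps(1) less_le_not_le less_le_trans order_less_imp_le)
      qed
      have fr2: "frequently (\<lambda>h. q < Q h) ?F"
      proof (rule ccontr)
        assume "\<not> ?thesis"
        then have "eventually (\<lambda>h. ereal (Q h) \<le> ereal q) ?F" by (simp add: frequently_def not_less)
        then have "Limsup ?F (\<lambda>h. ereal (Q h)) \<le> ereal q" by (rule Limsup_bounded)
        then show False using r3 q by (metis ereal_less_eq(3) less_le_not_le less_le_trans order_less_imp_le)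
      qed
      have ex1: "\<exists>h. h \<noteq> 0 \<and> \<bar>h\<bar> < d \<and> Q h < p" if "d > 0" for d
        using fr1 that by (auto simp: frequently_at dist_real_def)
      have ex2: "\<exists>h. h \<noteq> 0 \<and> \<bar>h\<bar> < d \<and> q < Q h" if "d > 0" for d
        using fr2 that by (auto simp: frequently_at dist_real_def)
      have "0 \<le> p" using ex1[of 1] Q0 by force
      have "x \<in> Z (p, q)"
        unfolding Z_def prod.case mem_Collect_eq
      proof (intro conjI allI impI)
        fix d :: real assume "d > 0"
        obtain h where h: "h \<noteq> 0" "\<bar>h\<bar> < d" "Q h < p" using ex1[OF \<open>d > 0\<close>] by blast
        show "\<exists>a b. a < b \<and> x \<in> {a..b} \<and> b - a < d \<and> g b - g a \<le> p * (b - a)"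
        proof -
          obtain a b where ab: "a < b" "x \<in> {a..b}" "b - a < d" "g b - g a = Q h * (b - a)"
            using int[OF h(1,2)] by blast
          moreover have "Q h * (b - a) \<le> p * (b - a)" using ab h by (intro mult_right_mono) auto
          ultimately show ?thesis by metis
        qed
        obtain h where h: "h \<noteq> 0" "\<bar>h\<bar> < d" "q < Q h" using ex2[OF \<open>d > 0\<close>] by blast
        show "\<exists>a b. a < b \<and> x \<in> {a..b} \<and> b - a < d \<and> q * (b - a) \<le> g b - g a"
        proof -
          obtain a b where ab: "a < b" "x \<in> {a..b}" "b - a < d" "g b - g a = Q h * (b - a)"
            using int[OF h(1,2)] by blast
          moreover have "q * (b - a) \<le> Q h * (b - a)" using ab h by (intro mult_right_mono) auto
          ultimately show ?thesis by metis
        qed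
      qed
      moreover have "(p, q) \<in> I" using p q \<open>0 \<le> p\<close> by (auto simp: I_def)
      ultimately show False using x(2) by blast
    qed
    have nt: "\<not> trivial_limit ?F" by simp
    define l where "l = Liminf ?F (\<lambda>h. ereal (Q h))"
    have "Limsup ?F (\<lambda>h. ereal (Q h)) = l" 
      unfolding l_def by (rule antisym[OF le Liminf_le_Limsup[OF nt]])
    then have tend: "((\<lambda>h. ereal (Q h)) \<longlongrightarrow> l) ?F"
      unfolding tendsto_iff_Liminf_eq_Limsup[OF nt] by (simp add: l_def)
    have "0 \<le> l" unfolding l_def
      by (rule Liminf_bounded) (use Q0 in \<open>auto simp: eventually_at_filter\<close>)
    moreover have "l \<le> ereal (2 * L)"
      by (rule tendsto_upperbound[OF tend]) (use Q1 in \<open>auto simp: eventually_at_filter\<close>)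
    ultimately obtain D where "l = ereal D" by (cases l) auto
    then have "(Q \<longlongrightarrow> D) ?F" using tend by simp
    then have "(g has_field_derivative D) (at x)"
      unfolding DERIV_def Q_def .
    then have "((\<lambda>x. g x - L * x) has_field_derivative (D - L)) (at x)"
      by (auto intro!: derivative_eq_intros)
    then have "f differentiable (at x)"
      unfolding g_def real_differentiable_def by auto
    then show False using x by simp
  qed
qed

section \<open>From directional derivatives to total differentiability\<close>

text \<open>Translation invariance replaces a choice of coordinates: the measure of \<open>N\<close>
  is averaged over the shifts \<open>t *\<^sub>R b\<close> with \<open>t\<close> in
  \<open>[0, 1]\<close>, and exchanging the integrals leaves an inner integral along a line, which
  is 0.\<close>

lemma null_set_if_null_along_lines:
  fixes N :: "'a::euclidean_space set"
  assumes N: "N \<in> sets borel" and lines: "\<And>x. negligible {t::real. x + t *\<^sub>R b \<in> N}"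
  shows "negligible N"
proof -
  note [measurable] = N
  have t: "(\<integral>\<^sup>+x. indicator N (x + t *\<^sub>R b) \<partial>lborel) = emeasure lborel N" for t
  proof -
    have "emeasure lborel N = (\<integral>\<^sup>+x. indicator N x \<partial>distr lborel borel ((+) (t *\<^sub>R b)))"
      unfolding lborel_distr_plus using N by simp
    also have "\<dots> = (\<integral>\<^sup>+x. indicator N (t *\<^sub>R b + x) \<partial>lborel)"
      by (intro nn_integral_distr) auto
    finally show ?thesis by (simp add: add.commute)
  qed
  have x: "(\<integral>\<^sup>+t. indicator {0..1} t * indicator N (x + t *\<^sub>R b) \<partial>lborel) = 0" for x
  proof -
    have "{t. x + t *\<^sub>R b \<in> N} \<in> sets borel" by measurable
    then have "{t. x + t *\<^sub>R b \<in> N} \<in> null_sets lborel"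
      using lines[of x] by (auto simp: negligible_iff_null_sets null_sets_def)
    then have "AE t in lborel. x + t *\<^sub>R b \<notin> N"
      by (rule AE_I') auto
    then have "(\<integral>\<^sup>+t. indicator {0..1} t * indicator N (x + t *\<^sub>R b) \<partial>lborel) = (\<integral>\<^sup>+(t::real). 0 \<partial>lborel)"
      by (intro nn_integral_cong_AE) (auto simp: indicator_def)
    then show ?thesis by simp
  qed
  have "emeasure lborel N = (\<integral>\<^sup>+(t::real). indicator {0..1} t * emeasure lborel N \<partial>lborel)"
    by (subst nn_integral_multc) auto
  also have "\<dots> = (\<integral>\<^sup>+t. (\<integral>\<^sup>+x. indicator {0..1} t * indicator N (x + t *\<^sub>R b) \<partial>lborel) \<partial>lborel)"
    by (subst nn_integral_cmult) (auto simp: t)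
  also have "\<dots> = (\<integral>\<^sup>+x. (\<integral>\<^sup>+t. indicator {0..1} t * indicator N (x + t *\<^sub>R b) \<partial>lborel) \<partial>lborel)"
    by (rule lborel_pair.Fubini') measurable
  also have "\<dots> = 0" by (simp add: x)
  finally show ?thesis using N
    by (auto simp: negligible_iff_null_sets null_sets_def)
qed

text \<open>By Cauchy's criterion the limit exists exactly on the intersection over \<open>n\<close>
  of the unions over \<open>m\<close> of \<open>F n m\<close>. Each quotient is continuous in
  \<open>x\<close>, so \<open>F n m\<close> is closed as an intersection of closed sets, although
  uncountably many pairs \<open>s\<close>, \<open>t\<close> occur.\<close>

lemma directional_derivative_borel:
  fixes f :: "'a::euclidean_space \<Rightarrow> real"
  assumes "continuous_on UNIV f"
  shows "{x. \<not> (\<exists>D. (\<lambda>t. (f (x + t *\<^sub>R b) - f x) / t) \<midarrow>0\<rightarrow> D)} \<in> sets borel"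
proof -
  define Q where "Q x t = (f (x + t *\<^sub>R b) - f x) / t" for x t
  define F where "F n m = {x. \<forall>s t. 0 < \<bar>s\<bar> \<and> \<bar>s\<bar> < 1 / Suc m \<and> 0 < \<bar>t\<bar> \<and> \<bar>t\<bar> < 1 / Suc m
      \<longrightarrow> \<bar>Q x s - Q x t\<bar> \<le> 1 / Suc n}" for n m :: nat
  have "closed (F n m)" for n m
  proof -
    have c: "continuous_on UNIV (\<lambda>x. Q x t)" for t
      unfolding Q_def divide_inverse
      by (intro continuous_intros continuous_on_compose2[OF assms] assms) auto
    have "F n m = (\<Inter>(s,t)\<in>{(s,t). 0 < \<bar>s\<bar> \<and> \<bar>s\<bar> < 1 / Suc m \<and> 0 < \<bar>t\<bar> \<and> \<bar>t\<bar> < 1 / Suc m}.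
        {x. \<bar>Q x s - Q x t\<bar> \<le> 1 / Suc n})"
      unfolding F_def by auto
    moreover have "closed {x. \<bar>Q x s - Q x t\<bar> \<le> 1 / Suc n}" for s t
      by (intro closed_Collect_le continuous_intros c)
    ultimately show ?thesis by (auto intro!: closed_INT)
  qed
  then have "(\<Inter>n. \<Union>m. F n m) \<in> sets borel"
    by (intro sets.countable_INT'' sets.countable_UN'') auto
  moreover have "(\<exists>D. Q x \<midarrow>0\<rightarrow> D) \<longleftrightarrow> x \<in> (\<Inter>n. \<Union>m. F n m)" for x
  proof
    assume "\<exists>D. Q x \<midarrow>0\<rightarrow> D"
    then obtain D where D: "Q x \<midarrow>0\<rightarrow> D" by blast
    show "x \<in> (\<Inter>n. \<Union>m. F n m)"
    proof (rule INT_I)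
      fix n
      obtain d where d: "d > 0" "\<And>t. t \<noteq> 0 \<Longrightarrow> \<bar>t\<bar> < d \<Longrightarrow> \<bar>Q x t - D\<bar> < 1 / (2 * Suc n)"
        using LIM_D[OF D, of "1 / (2 * Suc n)"] by auto
      obtain m where "1 / Suc m < d" using \<open>d > 0\<close> by (metis nat_approx_posE)
      have "x \<in> F n m"
        unfolding F_def mem_Collect_eq
      proof (intro allI impI)
        fix s t :: real assume st: "0 < \<bar>s\<bar> \<and> \<bar>s\<bar> < 1 / Suc m \<and> 0 < \<bar>t\<bar> \<and> \<bar>t\<bar> < 1 / Suc m"
        then have "\<bar>Q x s - D\<bar> < 1 / (2 * Suc n)" "\<bar>Q x t - D\<bar> < 1 / (2 * Suc n)"
          using d \<open>1 / Suc m < d\<close> by auto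
        then have "\<bar>Q x s - Q x t\<bar> \<le> 1 / (2 * Suc n) + 1 / (2 * Suc n)" by linarith
        then show "\<bar>Q x s - Q x t\<bar> \<le> 1 / Suc n" by (simp add: field_simps)
      qed
      then show "x \<in> (\<Union>m. F n m)" by blast
    qed
  next
    assume x: "x \<in> (\<Inter>n. \<Union>m. F n m)"
    show "\<exists>D. Q x \<midarrow>0\<rightarrow> D"
    proof -
      have "cauchy_filter (filtermap (Q x) (at 0))"
        unfolding cauchy_filter_metric_filtermap
      proof (intro allI impI)
        fix e :: real assume "e > 0"
        then obtain n where n: "1 / Suc n < e" by (metis nat_approx_posE)
        obtain m where m: "x \<in> F n m" using x by blast
        have "eventually (\<lambda>t. 0 < \<bar>t\<bar> \<and> \<bar>t\<bar> < 1 / Suc m) (at (0::real))"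
          unfolding eventually_at by (intro exI[of _ "1 / Suc m"]) (auto simp: dist_real_def)
        then show "\<exists>P. eventually P (at 0) \<and> (\<forall>s t. P s \<and> P t \<longrightarrow> dist (Q x s) (Q x t) < e)"
          using m n unfolding F_def dist_real_def
          by (intro exI[of _ "\<lambda>t. 0 < \<bar>t\<bar> \<and> \<bar>t\<bar> < 1 / Suc m"]) (auto intro: le_less_trans)
      qed
      then show ?thesis
        using cauchy_filter_complete_converges[of "filtermap (Q x) (at 0)" UNIV]
        by (auto simp: filterlim_def complete_UNIV filtermap_bot_iff trivial_limit_def[symmetric])
    qed
  qed
  ultimately have "{x. \<not> (\<exists>D. Q x \<midarrow>0\<rightarrow> D)} \<in> sets borel"
    by (simp only: Collect_neg_eq Collect_mem_eq borel_comp)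
  then show ?thesis unfolding Q_def .
qed

lemma negligible_no_directional_derivative:
  fixes f :: "'a::euclidean_space \<Rightarrow> real"
  assumes "L-lipschitz_on UNIV f"
  shows "negligible {x. \<not> (\<exists>D. (\<lambda>t. (f (x + t *\<^sub>R b) - f x) / t) \<midarrow>0\<rightarrow> D)}"
proof (rule null_set_if_null_along_lines[where b = b])
  show "{x. \<not> (\<exists>D. (\<lambda>t. (f (x + t *\<^sub>R b) - f x) / t) \<midarrow>0\<rightarrow> D)} \<in> sets borel"
    using assms by (intro directional_derivative_borel lipschitz_on_continuous_on)
next
  fix x
  have "(L * norm b)-lipschitz_on UNIV (\<lambda>t. f (x + t *\<^sub>R b))"
  proof (rule lipschitz_onI)
    fix s t :: real
    have "dist (f (x + s *\<^sub>R b)) (f (x + t *\<^sub>R b)) \<le> L * dist (x + s *\<^sub>R b) (x + t *\<^sub>R b)"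
      using assms by (rule lipschitz_onD) auto
    also have "dist (x + s *\<^sub>R b) (x + t *\<^sub>R b) = norm b * dist s t"
      by (simp add: dist_norm flip: scaleR_diff_left)
    finally show "dist (f (x + s *\<^sub>R b)) (f (x + t *\<^sub>R b)) \<le> L * norm b * dist s t"
      by (simp add: mult.assoc)
  qed (use lipschitz_on_nonneg[OF assms] in simp)
  then have "negligible {t. \<not> (\<lambda>t. f (x + t *\<^sub>R b)) differentiable (at t)}"
    by (rule negligible_not_differentiable_real)
  then show "negligible {t. x + t *\<^sub>R b \<in> {x. \<not> (\<exists>D. (\<lambda>t. (f (x + t *\<^sub>R b) - f x) / t) \<midarrow>0\<rightarrow> D)}}"
  proof (rule negligible_subset)
    show "{t. x + t *\<^sub>R b \<in> {x. \<not> (\<exists>D. (\<lambda>t. (f (x + t *\<^sub>R b) - f x) / t) \<midarrow>0\<rightarrow> D)}}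
      \<subseteq> {t. \<not> (\<lambda>t. f (x + t *\<^sub>R b)) differentiable (at t)}"
    proof (clarify, elim notE)
      fix t assume "(\<lambda>t. f (x + t *\<^sub>R b)) differentiable (at t)"
      then obtain D where "((\<lambda>t. f (x + t *\<^sub>R b)) has_field_derivative D) (at t)"
        by (auto simp: real_differentiable_def)
      then show "\<exists>D. (\<lambda>s. (f (x + t *\<^sub>R b + s *\<^sub>R b) - f (x + t *\<^sub>R b)) / s) \<midarrow>0\<rightarrow> D"
        by (auto simp: DERIV_def scaleR_add_left add.assoc)
    qed
  qed
qed

text \<open>On \<open>E q n m\<close> the function has slope nearly \<open>q\<close> in every
  coordinate direction, uniformly at scales below \<open>1 / Suc m\<close>. At a point that is not
  porous for this set, every nearby point has a point of the set very close to it. A displacement is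
  then followed coordinate by coordinate, each step being taken from a nearby point of the set, and
  the detour costs little because \<open>f\<close> is Lipschitz. Countably many \<open>q\<close>,
  \<open>n\<close>, \<open>m\<close> suffice, so the discarded porous points are null.\<close>

theorem Rademacher:
  fixes f :: "'a::euclidean_space \<Rightarrow> real"
  assumes lip: "L-lipschitz_on UNIV f"
  shows "negligible {x. \<not> f differentiable (at x)}"
proof -
  have L: "0 \<le> L" using lip by (rule lipschitz_on_nonneg)
  have f: "\<bar>f x - f y\<bar> \<le> L * norm (x - y)" for x y
    using lipschitz_onD[OF lip, of x y] by (simp add: dist_norm)
  define E where "E q n m = {x. \<forall>b\<in>Basis. \<forall>t. \<bar>t\<bar> < 1 / Suc m \<longrightarrow>
      \<bar>f (x + t *\<^sub>R b) - f x - t * (q \<bullet> b)\<bar> \<le> 1 / Suc n * \<bar>t\<bar>}" for q :: 'a and n m :: nat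
  define P where "P q n m = {x\<in>E q n m. \<forall>r>0. \<exists>y. 0 < dist x y \<and> dist x y < r
      \<and> ball y (1 / Suc n * dist x y) \<inter> E q n m = {}}" for q and n m :: nat
  obtain Q :: "'a set" where Q: "countable Q" "\<And>x e. e > 0 \<Longrightarrow> \<exists>q\<in>Q. norm (q - x) < e"
  proof -
    obtain Q :: "'a set" where Q: "countable Q" "\<And>X. open X \<Longrightarrow> X \<noteq> {} \<Longrightarrow> \<exists>d\<in>Q. d \<in> X"
      using countable_dense_setE by blast
    have "\<exists>q\<in>Q. norm (q - x) < e" if "e > 0" for x e
      using Q(2)[OF open_ball, of x e] that by (auto simp: dist_norm norm_minus_commute)
    then show thesis by (rule that[OF Q(1)])
  qed
  define N where "N = (\<Union>b\<in>Basis. {x. \<not> (\<exists>D. (\<lambda>t. (f (x + t *\<^sub>R b) - f x) / t) \<midarrow>0\<rightarrow> D)})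
      \<union> (\<Union>q\<in>Q. \<Union>n. \<Union>m. P q n m)"
  have "negligible (P q n m)" for q n m
    unfolding P_def by (rule negligible_porous_points) simp
  then have "negligible N"
    using negligible_no_directional_derivative[OF lip] Q(1) unfolding N_def negligible_iff_null_sets
    by (intro null_sets.Un null_sets_UN' null_sets_UN) (auto intro: countable_finite)
  then show ?thesis
  proof (rule negligible_subset; intro subsetI; rule_tac ccontr)
    fix x assume "x \<in> {x. \<not> f differentiable (at x)}" "x \<notin> N"
    then have nd: "\<not> f differentiable (at x)" by simp
    have "\<forall>b\<in>Basis. \<exists>D. (\<lambda>t. (f (x + t *\<^sub>R b) - f x) / t) \<midarrow>0\<rightarrow> D"
      using \<open>x \<notin> N\<close> unfolding N_def by blast
    then obtain D' where D': "\<And>b. b \<in> Basis \<Longrightarrow> (\<lambda>t. (f (x + t *\<^sub>R b) - f x) / t) \<midarrow>0\<rightarrow> D' b"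
      by metis
    define D where "D = (\<Sum>b\<in>Basis. D' b *\<^sub>R b)"
    have D: "(\<lambda>t. (f (x + t *\<^sub>R b) - f x) / t) \<midarrow>0\<rightarrow> D \<bullet> b" if "b \<in> Basis" for b
      using D'[OF that] that by (simp add: D_def)
    have "(f has_derivative (\<lambda>h. D \<bullet> h)) (at x)"
      unfolding has_derivative_at_alt
    proof (intro conjI allI impI)
      show "bounded_linear ((\<bullet>) D)" by (rule bounded_linear_inner_right)
      fix e :: real assume "e > 0"
      \<comment> \<open>Each coordinate step costs one slope error and two Lipschitz detours; the
        final 1 pays for replacing \<open>q\<close> by \<open>D\<close>.\<close>
      define M where "M = DIM('a) * (1 + 2 * L) + 1"
      have "M > 0" using L by (simp add: M_def add_nonneg_pos)
      obtain n where n: "1 / Suc n < e / M" using \<open>e > 0\<close> \<open>M > 0\<close> by (metis divide_pos_pos nat_approx_posE)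
      define \<eta> where "\<eta> = 1 / Suc n"
      have \<eta>: "\<eta> > 0" "M * \<eta> \<le> e" using n \<open>M > 0\<close> by (auto simp: \<eta>_def field_simps)
      \<comment> \<open>Half of \<eta> goes to approximating \<open>D\<close> by \<open>q\<close>,
        the other half to the convergence of the coordinate quotients.\<close>
      obtain q where q: "q \<in> Q" "norm (q - D) < \<eta> / 2" using Q(2)[of "\<eta> / 2" D] \<eta> by auto
      have "\<forall>\<^sub>F t in at 0. \<forall>b\<in>Basis. \<bar>(f (x + t *\<^sub>R b) - f x) / t - D \<bullet> b\<bar> < \<eta> / 2"
      proof (rule eventually_ball_finite[OF finite_Basis], rule ballI)
        fix b :: 'a assume "b \<in> Basis"
        from tendstoD[OF D[OF this], of "\<eta> / 2"] \<eta>
        show "\<forall>\<^sub>F t in at 0. \<bar>(f (x + t *\<^sub>R b) - f x) / t - D \<bullet> b\<bar> < \<eta> / 2"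
          by (simp add: dist_real_def)
      qed
      then obtain \<delta> where \<delta>: "\<delta> > 0"
        "\<And>t b. t \<noteq> 0 \<Longrightarrow> \<bar>t\<bar> < \<delta> \<Longrightarrow> b \<in> Basis \<Longrightarrow> \<bar>(f (x + t *\<^sub>R b) - f x) / t - D \<bullet> b\<bar> < \<eta> / 2"
        by (auto simp: eventually_at dist_real_def)
      obtain m where m: "1 / Suc m < \<delta>" using \<delta>(1) by (metis nat_approx_posE)
      have xE: "x \<in> E q n m"
        unfolding E_def mem_Collect_eq
      proof (intro ballI allI impI)
        fix b :: 'a and t :: real assume b: "b \<in> Basis" and t: "\<bar>t\<bar> < 1 / Suc m"
        show "\<bar>f (x + t *\<^sub>R b) - f x - t * (q \<bullet> b)\<bar> \<le> 1 / Suc n * \<bar>t\<bar>"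
        proof (cases "t = 0")
          case False
          have "\<bar>(q - D) \<bullet> b\<bar> \<le> norm (q - D)" using b by (rule Basis_le_norm)
          then have "\<bar>D \<bullet> b - q \<bullet> b\<bar> \<le> \<eta> / 2" using q by (simp add: inner_diff_left abs_minus_commute)
          then have "\<bar>(f (x + t *\<^sub>R b) - f x) / t - q \<bullet> b\<bar> \<le> \<eta>"
            using \<delta>(2)[of t b] False t m b by linarith
          then have "\<bar>t\<bar> * \<bar>(f (x + t *\<^sub>R b) - f x) / t - q \<bullet> b\<bar> \<le> \<bar>t\<bar> * \<eta>"
            by (intro mult_left_mono) auto
          also have "\<bar>t\<bar> * \<bar>(f (x + t *\<^sub>R b) - f x) / t - q \<bullet> b\<bar> = \<bar>f (x + t *\<^sub>R b) - f x - t * (q \<bullet> b)\<bar>"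
            using False by (simp add: abs_mult[symmetric] right_diff_distrib diff_divide_distrib)
          finally show ?thesis by (simp add: \<eta>_def)
        qed simp
      qed
      have "x \<notin> P q n m" using \<open>x \<notin> N\<close> q(1) unfolding N_def by blast
      then obtain r where r: "r > 0" "\<And>y. 0 < dist x y \<Longrightarrow> dist x y < r \<Longrightarrow> ball y (\<eta> * dist x y) \<inter> E q n m \<noteq> {}"
        using xE unfolding P_def \<eta>_def by blast
      have near: "\<exists>y'\<in>E q n m. norm (y' - y) \<le> \<eta> * norm (y - x)" if "norm (y - x) < r" for y
      proof (cases "y = x")
        case True
        then show ?thesis using xE by auto
      next
        case False
        then have "ball y (\<eta> * dist x y) \<inter> E q n m \<noteq> {}"
          using that by (intro r(2)) (auto simp: dist_norm norm_minus_commute)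
        then show ?thesis by (force simp: dist_norm norm_minus_commute)
      qed
      show "\<exists>d>0. \<forall>y. norm (y - x) < d \<longrightarrow> norm (f y - f x - D \<bullet> (y - x)) \<le> e * norm (y - x)"
      proof (intro exI[of _ "min r (1 / Suc m)"] conjI allI impI)
        fix z assume z: "norm (z - x) < min r (1 / Suc m)"
        define h where "h = z - x"
        define s where "s S = (\<Sum>b\<in>S. (h \<bullet> b) *\<^sub>R b)" for S
        \<comment> \<open>The partial sums \<open>s S\<close> never exceed \<open>h\<close> in norm,
          so every intermediate point lies in the range where \<open>near\<close> applies.\<close>
        have chain: "\<bar>f (x + s S) - f x - q \<bullet> s S\<bar> \<le> card S * ((1 + 2 * L) * (\<eta> * norm h))"
          if "S \<subseteq> Basis" for S
          using finite_subset[OF that finite_Basis] that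
        proof (induction S)
          case empty
          show ?case by (simp add: s_def)
        next
          case (insert b S)
          have b: "b \<in> Basis" "S \<subseteq> Basis" using insert by auto
          have ss: "s (insert b S) = s S + (h \<bullet> b) *\<^sub>R b" using insert by (simp add: s_def)
          have "norm (s S) \<le> norm h"
          proof (rule norm_le_componentwise)
            fix c :: 'a assume "c \<in> Basis"
            then have "s S \<bullet> c = (\<Sum>b\<in>S. if b = c then h \<bullet> c else 0)"
              unfolding s_def inner_sum_left using b(2)
              by (intro sum.cong) (auto simp: inner_Basis)
            then show "\<bar>s S \<bullet> c\<bar> \<le> \<bar>h \<bullet> c\<bar>" using insert.hyps(1) by simp
          qed
          then have "norm (s S) < r" "\<eta> * norm (s S) \<le> \<eta> * norm h"
            using z \<eta> by (auto simp: h_def)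
          then obtain y' where y': "y' \<in> E q n m" "norm (y' - (x + s S)) \<le> \<eta> * norm h"
            using near[of "x + s S"] by force
          have hb: "\<bar>h \<bullet> b\<bar> \<le> norm h" using b(1) by (rule Basis_le_norm)
          then have "\<bar>h \<bullet> b\<bar> < 1 / Suc m" using z by (simp add: h_def)
          then have "\<bar>f (y' + (h \<bullet> b) *\<^sub>R b) - f y' - (h \<bullet> b) * (q \<bullet> b)\<bar> \<le> \<eta> * \<bar>h \<bullet> b\<bar>"
            using y'(1) b(1) unfolding E_def \<eta>_def by blast
          also have "\<dots> \<le> \<eta> * norm h" using hb \<eta> by (intro mult_left_mono) auto
          finally have 1: "\<bar>f (y' + (h \<bullet> b) *\<^sub>R b) - f y' - (h \<bullet> b) * (q \<bullet> b)\<bar> \<le> \<eta> * norm h" .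
          have "\<bar>f y' - f (x + s S)\<bar> \<le> L * norm (y' - (x + s S))" by (rule f)
          also have "\<dots> \<le> L * (\<eta> * norm h)" using y' L by (intro mult_left_mono) auto
          finally have 2: "\<bar>f y' - f (x + s S)\<bar> \<le> L * (\<eta> * norm h)" .
          have "\<bar>f (y' + (h \<bullet> b) *\<^sub>R b) - f (x + s (insert b S))\<bar> \<le> L * norm (y' + (h \<bullet> b) *\<^sub>R b - (x + s (insert b S)))"
            by (rule f)
          also have "y' + (h \<bullet> b) *\<^sub>R b - (x + s (insert b S)) = y' - (x + s S)"
            by (simp add: ss algebra_simps)
          also have "L * norm (y' - (x + s S)) \<le> L * (\<eta> * norm h)" using y' L by (intro mult_left_mono) auto
          finally have 3: "\<bar>f (y' + (h \<bullet> b) *\<^sub>R b) - f (x + s (insert b S))\<bar> \<le> L * (\<eta> * norm h)" .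
          have "q \<bullet> s (insert b S) = q \<bullet> s S + (h \<bullet> b) * (q \<bullet> b)" by (simp add: ss inner_add_right)
          then have "\<bar>f (x + s (insert b S)) - f x - q \<bullet> s (insert b S)\<bar>
              \<le> card S * ((1 + 2 * L) * (\<eta> * norm h)) + (\<eta> * norm h + 2 * (L * (\<eta> * norm h)))"
            using 1 2 3 insert.IH[OF b(2)] by linarith
          also have "\<dots> = card (insert b S) * ((1 + 2 * L) * (\<eta> * norm h))"
            using insert by (simp add: algebra_simps)
          finally show ?case .
        qed
        have "s Basis = h" by (simp add: s_def euclidean_representation)
        then have 1: "\<bar>f z - f x - q \<bullet> h\<bar> \<le> DIM('a) * ((1 + 2 * L) * (\<eta> * norm h))"
          using chain[OF subset_refl] by (simp add: h_def)
        have "\<bar>(q - D) \<bullet> h\<bar> \<le> norm (q - D) * norm h" by (rule Cauchy_Schwarz_ineq2)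
        also have "\<dots> \<le> \<eta> * norm h" using q \<eta> by (intro mult_right_mono) auto
        finally have "\<bar>q \<bullet> h - D \<bullet> h\<bar> \<le> \<eta> * norm h" by (simp add: inner_diff_left)
        then have "\<bar>f z - f x - D \<bullet> h\<bar> \<le> DIM('a) * ((1 + 2 * L) * (\<eta> * norm h)) + \<eta> * norm h"
          using 1 by linarith
        also have "\<dots> = M * \<eta> * norm h" by (simp add: M_def algebra_simps)
        also have "\<dots> \<le> e * norm h" using \<eta> by (intro mult_right_mono) auto
        finally show "norm (f z - f x - D \<bullet> (z - x)) \<le> e * norm (z - x)" by (simp add: h_def)
      qed (use r in auto)
    qed
    then show False using nd by (auto simp: differentiable_def)
  qed
qed

section \<open>Gradients of Lipschitz functions\<close>

lemma locally_lipschitz_cball: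
  assumes "locally_lipschitz \<Omega> f" "open \<Omega>" "x \<in> \<Omega>"
  obtains e L where "e > 0" "cball x e \<subseteq> \<Omega>" "L-lipschitz_on (cball x e) f"
proof -
  obtain e where "e > 0" "cball x e \<subseteq> \<Omega>"
    using assms(2,3) open_contains_cball by metis
  moreover from this obtain L where "L-lipschitz_on (cball x e) f"
    using assms(1) unfolding locally_lipschitz_def by (meson compact_cball)
  ultimately show thesis by (rule that)
qed

lemma locally_lipschitz_continuous_on:
  assumes "locally_lipschitz \<Omega> f" "open \<Omega>"
  shows "continuous_on \<Omega> f"
proof (rule continuous_at_imp_continuous_on, rule ballI)
  fix x assume "x \<in> \<Omega>"
  then obtain e L where e: "e > 0" "L-lipschitz_on (cball x e) f"
    using locally_lipschitz_cball[OF assms] by metis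
  have "continuous_on (ball x e) f"
    using lipschitz_on_continuous_on[OF e(2)] by (rule continuous_on_subset) auto
  then show "isCont f x" using e(1) by (simp add: continuous_on_eq_continuous_at)
qed

text \<open>Negligibility is a local property, and on a small ball the composition with the
  projection onto its closure is a globally Lipschitz function that agrees with \<open>f\<close>
  there.\<close>

lemma locally_lipschitz_AE_differentiable:
  assumes "locally_lipschitz \<Omega> f" "open \<Omega>"
  shows "AE x in lebesgue_on \<Omega>. f differentiable (at x)"
proof -
  let ?N = "{x \<in> \<Omega>. \<not> f differentiable (at x)}"
  have "\<exists>U. openin (top_of_set ?N) U \<and> x \<in> U \<and> negligible U" if "x \<in> ?N" for x
  proof -
    have "x \<in> \<Omega>" using that by simp
    then obtain e L where e: "e > 0" "cball x e \<subseteq> \<Omega>" "L-lipschitz_on (cball x e) f"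
      by (rule locally_lipschitz_cball[OF assms])
    define g where "g y = f (closest_point (cball x e) y)" for y
    have "L-lipschitz_on UNIV g"
    proof (rule lipschitz_onI)
      fix y z
      let ?p = "closest_point (cball x e)"
      have "?p y \<in> cball x e" "?p z \<in> cball x e"
        using e(1) by (auto intro!: closest_point_in_set simp del: mem_cball)
      then have "dist (g y) (g z) \<le> L * dist (?p y) (?p z)"
        unfolding g_def by (rule lipschitz_onD[OF e(3)])
      also have "dist (?p y) (?p z) \<le> dist y z"
        using e(1) by (intro closest_point_lipschitz) auto
      finally show "dist (g y) (g z) \<le> L * dist y z"
        using lipschitz_on_nonneg[OF e(3)] by (simp add: mult_left_mono)
    qed (rule lipschitz_on_nonneg[OF e(3)])
    then have "negligible {y. \<not> g differentiable (at y)}" by (rule Rademacher)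
    moreover have "?N \<inter> ball x e \<subseteq> {y. \<not> g differentiable (at y)}"
    proof clarify
      fix y assume y: "y \<in> ball x e" "g differentiable (at y)" "\<not> f differentiable (at y)"
      have "f differentiable (at y)"
      proof -
        obtain D where "(g has_derivative D) (at y)" using y(2) by (auto simp: differentiable_def)
        then have "(f has_derivative D) (at y)"
          by (rule has_derivative_transform_within_open[OF _ open_ball y(1)])
            (simp add: g_def closest_point_self)
        then show ?thesis by (auto simp: differentiable_def)
      qed
      then show False using y by simp
    qed
    ultimately have "negligible (?N \<inter> ball x e)" by (rule negligible_subset)
    moreover have "openin (top_of_set ?N) (?N \<inter> ball x e)" by (simp add: openin_open_Int)
    moreover have "x \<in> ?N \<inter> ball x e" using that e by simp
    ultimately show ?thesis by (intro exI[of _ "?N \<inter> ball x e"] conjI)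
  qed
  then have "negligible ?N" by (subst locally_negligible_alt) (rule ballI)
  then have "?N \<in> null_sets lebesgue" by (simp add: negligible_iff_null_sets)
  then have "AE x in lebesgue. x \<in> \<Omega> \<longrightarrow> f differentiable (at x)"
    by (rule AE_I') auto
  then show ?thesis using assms(2) by (subst AE_restrict_space_iff) auto
qed

lemma has_derivative_grad:
  assumes "f differentiable (at x)"
  shows "(f has_derivative (\<lambda>h. grad f x \<bullet> h)) (at x)"
proof -
  let ?D = "frechet_derivative f (at x)"
  have D: "(f has_derivative ?D) (at x)" using assms frechet_derivative_works by blast
  then interpret bounded_linear ?D by (rule has_derivative_bounded_linear)
  have "?D h = grad f x \<bullet> h" for h
  proof -
    have "?D h = ?D (\<Sum>i\<in>UNIV. h $ i *\<^sub>R axis i 1)"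
      by (simp add: basis_expansion flip: scalar_mult_eq_scaleR)
    also have "\<dots> = (\<Sum>i\<in>UNIV. h $ i * ?D (axis i 1))" by (simp add: sum scaleR)
    also have "\<dots> = grad f x \<bullet> h" using assms by (simp add: grad_def inner_vec_def mult.commute)
    finally show ?thesis .
  qed
  then show ?thesis using D by (metis ext)
qed

lemma grad_unique:
  assumes "(f has_derivative (\<lambda>h. D \<bullet> h)) (at x)"
  shows "grad f x = D"
proof -
  have "f differentiable (at x)" using assms by (auto simp: differentiable_def)
  from has_derivative_unique[OF has_derivative_grad[OF this] assms]
  have "\<And>h. grad f x \<bullet> h = D \<bullet> h" by metis
  then show ?thesis by (metis vector_eq_rdot)
qed

lemma grad_diff:
  assumes "f differentiable (at x)" "g differentiable (at x)"
  shows "grad (\<lambda>y. f y - g y) x = grad f x - grad g x"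
  using has_derivative_diff[OF assms[THEN has_derivative_grad]]
  by (intro grad_unique) (simp add: inner_diff_left)

text \<open>Derivatives must be transferred in both directions: where \<open>f\<close> is not
  differentiable, \<open>g\<close> must fail to be so too, in order that both gradients take the
  default value 0.\<close>

lemma grad_transform_eventually:
  assumes "open U" "x \<in> U" "\<And>y. y \<in> U \<Longrightarrow> g y = f y - c"
  shows "grad g x = grad f x"
proof -
  have fg: "(g has_derivative D) (at x)" if "(f has_derivative D) (at x)" for D
  proof -
    have "((\<lambda>y. f y - c) has_derivative D) (at x)"
      using that by (auto intro!: derivative_eq_intros)
    then show ?thesis
      by (rule has_derivative_transform_within_open[OF _ assms(1,2)]) (simp add: assms(3))
  qed
  have gf: "(f has_derivative D) (at x)" if "(g has_derivative D) (at x)" for D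
  proof -
    have "((\<lambda>y. g y + c) has_derivative D) (at x)"
      using that by (auto intro!: derivative_eq_intros)
    then show ?thesis
      by (rule has_derivative_transform_within_open[OF _ assms(1,2)]) (simp add: assms(3))
  qed
  show ?thesis
  proof (cases "f differentiable (at x)")
    case True
    then show ?thesis by (intro grad_unique fg has_derivative_grad)
  next
    case False
    then have "\<not> g differentiable (at x)" using gf by (auto simp: differentiable_def)
    then show ?thesis using False by (simp add: grad_def)
  qed
qed

text \<open>The identity holds at every point: where \<open>f = c\<close>, either the truncation is not
  differentiable, so that \<^const>\<open>grad\<close> is 0 by convention, or it has a minimum.\<close>

lemma grad_truncate:
  assumes "isCont f x"
  shows "grad (\<lambda>y. max (f y - c) 0) x = (if f x > c then grad f x else 0)"
proof (rule linorder_cases[of "f x" c])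
  assume "f x > c"
  have "\<forall>\<^sub>F y in nhds x. c < f y"
    using assms \<open>f x > c\<close> by (metis continuous_at_imp_continuous_at_within isCont_def order_tendstoD(1) tendsto_at_iff_tendsto_nhds)
  then obtain U where "open U" "x \<in> U" "\<And>y. y \<in> U \<Longrightarrow> c < f y"
    unfolding eventually_nhds by blast
  then have "grad (\<lambda>y. max (f y - c) 0) x = grad f x"
    by (intro grad_transform_eventually[of U]) (auto simp: less_imp_le)
  then show ?thesis using \<open>f x > c\<close> by simp
next
  assume "f x < c"
  have "\<forall>\<^sub>F y in nhds x. f y < c"
    using assms \<open>f x < c\<close> by (metis continuous_at_imp_continuous_at_within isCont_def order_tendstoD(2) tendsto_at_iff_tendsto_nhds)
  then obtain U where "open U" "x \<in> U" "\<And>y. y \<in> U \<Longrightarrow> f y < c"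
    unfolding eventually_nhds by blast
  then have "grad (\<lambda>y. max (f y - c) 0) x = grad (\<lambda>y. 0) x"
    by (intro grad_transform_eventually[of U _ _ _ 0]) (auto simp: max_def less_imp_le dest: less_imp_le)
  moreover have "grad (\<lambda>y. 0) x = 0" by (rule grad_unique) simp
  ultimately show ?thesis using \<open>f x < c\<close> by simp
next
  assume fx: "f x = c"
  let ?g = "\<lambda>y. max (f y - c) 0"
  have "grad ?g x = 0"
  proof (cases "?g differentiable (at x)")
    case True
    have "(\<lambda>h. grad ?g x \<bullet> h) = (\<lambda>h. 0)"
      by (rule differential_zero_maxmin[OF UNIV_I open_UNIV has_derivative_grad[OF True]]) (simp add: fx)
    then have "grad ?g x \<bullet> grad ?g x = 0" by metis
    then show ?thesis by simp
  qed (simp add: grad_def)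
  then show ?thesis by (simp add: fx)
qed

lemma locally_lipschitz_diff:
  assumes "locally_lipschitz \<Omega> f" "locally_lipschitz \<Omega> g"
  shows "locally_lipschitz \<Omega> (\<lambda>x. f x - g x)"
  unfolding locally_lipschitz_def
proof (intro allI impI)
  fix K assume K: "compact K \<and> K \<subseteq> \<Omega>"
  then obtain L M where "L-lipschitz_on K f" "M-lipschitz_on K g"
    using assms unfolding locally_lipschitz_def by metis
  then show "\<exists>L. L-lipschitz_on K (\<lambda>x. f x - g x)" using lipschitz_on_diff[of L K f M g] by blast
qed

lemma lipschitz_on_truncate:
  fixes f :: "'a::metric_space \<Rightarrow> real"
  assumes "L-lipschitz_on S f"
  shows "L-lipschitz_on S (\<lambda>x. max (f x - c) 0)"
proof (rule lipschitz_onI)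
  fix x y assume "x \<in> S" "y \<in> S"
  then have "\<bar>f x - f y\<bar> \<le> L * dist x y" using lipschitz_onD[OF assms] by (simp add: dist_real_def)
  then show "dist (max (f x - c) 0) (max (f y - c) 0) \<le> L * dist x y"
    unfolding dist_real_def by linarith
qed (rule lipschitz_on_nonneg[OF assms])

lemma locally_lipschitz_truncate:
  assumes "locally_lipschitz \<Omega> f"
  shows "locally_lipschitz \<Omega> (\<lambda>x. max (f x - c) 0)"
  unfolding locally_lipschitz_def
proof (intro allI impI)
  fix K assume "compact K \<and> K \<subseteq> \<Omega>"
  then obtain L where "L-lipschitz_on K f" using assms unfolding locally_lipschitz_def by metis
  then have "L-lipschitz_on K (\<lambda>x. max (f x - c) 0)" by (rule lipschitz_on_truncate)
  then show "\<exists>L. L-lipschitz_on K (\<lambda>x. max (f x - c) 0)" ..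
qed

lemma lipschitz_compact_support_imp_locally_lipschitz:
  assumes "lipschitz_compact_support \<Omega> f"
  shows "locally_lipschitz \<Omega> f"
  unfolding locally_lipschitz_def
proof (intro allI impI)
  fix K
  obtain L where "L-lipschitz_on UNIV f" using assms unfolding lipschitz_compact_support_def by blast
  then have "L-lipschitz_on K f" by (rule lipschitz_on_subset) simp
  then show "\<exists>L. L-lipschitz_on K f" ..
qed

text \<open>A level \<open>c \<ge> 0\<close> sends zeros of \<open>f\<close> to zeros, so the
  support cannot grow; a negative level would destroy its compactness.\<close>

lemma lipschitz_compact_support_truncate:
  assumes "lipschitz_compact_support \<Omega> f" "0 \<le> c"
  shows "lipschitz_compact_support \<Omega> (\<lambda>x. max (f x - c) 0)"
proof -
  have sub: "closure {x. max (f x - c) 0 \<noteq> 0} \<subseteq> closure {x. f x \<noteq> 0}"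
    using assms(2) by (intro closure_mono) auto
  then have "compact (closure {x. max (f x - c) 0 \<noteq> 0})"
    using assms(1) compact_Int_closed[OF _ closed_closure, of "closure {x. f x \<noteq> 0}" "{x. max (f x - c) 0 \<noteq> 0}"]
    unfolding lipschitz_compact_support_def by (simp only: inf.absorb2)
  moreover obtain L where "L-lipschitz_on UNIV f"
    using assms(1) unfolding lipschitz_compact_support_def by blast
  then have "L-lipschitz_on UNIV (\<lambda>x. max (f x - c) 0)" by (rule lipschitz_on_truncate)
  moreover have "closure {x. max (f x - c) 0 \<noteq> 0} \<subseteq> \<Omega>"
    using sub assms(1) unfolding lipschitz_compact_support_def by (meson order_trans)
  ultimately show ?thesis
    unfolding lipschitz_compact_support_def by (intro conjI exI)
qed

lemma locally_lipschitz_measurable: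
  assumes "locally_lipschitz \<Omega> f" "open \<Omega>"
  shows "f \<in> borel_measurable (lebesgue_on \<Omega>)"
  using locally_lipschitz_continuous_on[OF assms] assms(2)
  by (intro continuous_imp_measurable_on_sets_lebesgue) auto

lemma tendsto_difference_quotient_grad:
  assumes "f differentiable (at x)" "h \<longlonglongrightarrow> 0" "\<And>k. h k \<noteq> 0"
  shows "(\<lambda>k. (f (x + h k *\<^sub>R v) - f x) / h k) \<longlonglongrightarrow> grad f x \<bullet> v"
proof -
  have f: "(f has_derivative (\<lambda>h. grad f x \<bullet> h)) (at (x + 0 *\<^sub>R v))"
    using has_derivative_grad[OF assms(1)] by simp
  have "((\<lambda>t. x + t *\<^sub>R v) has_derivative (\<lambda>t. t *\<^sub>R v)) (at 0)"
    by (auto intro!: derivative_eq_intros)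
  from has_derivative_compose[OF this f]
  have "((\<lambda>t. f (x + t *\<^sub>R v)) has_field_derivative (grad f x \<bullet> v)) (at 0)"
    by (simp add: has_field_derivative_def mult.commute[of _ "grad f x \<bullet> v"])
  then have "(\<lambda>t. (f (x + t *\<^sub>R v) - f x) / t) \<midarrow>0\<rightarrow> grad f x \<bullet> v"
    by (simp add: DERIV_def)
  then show ?thesis
    by (rule filterlim_compose[OF _ filterlim_atI[OF assms(2)]])
      (use assms(3) in simp)
qed

lemma borel_measurable_lebesgue_on_AE:
  fixes f g :: "'a::euclidean_space \<Rightarrow> 'b::euclidean_space"
  assumes "f \<in> borel_measurable (lebesgue_on S)" "AE x in lebesgue_on S. f x = g x" "S \<in> sets lebesgue"
  shows "g \<in> borel_measurable (lebesgue_on S)"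
proof -
  have "(\<lambda>x. indicator S x *\<^sub>R f x) \<in> borel_measurable lebesgue"
    using assms by (simp add: borel_measurable_restrict_space_iff)
  moreover have "AE x in lebesgue. indicator S x *\<^sub>R f x = indicator S x *\<^sub>R g x"
    using assms by (simp add: AE_restrict_space_iff indicator_def) (auto elim: eventually_mono)
  ultimately have "(\<lambda>x. indicator S x *\<^sub>R g x) \<in> borel_measurable lebesgue"
    by (rule borel_measurable_AE)
  then show ?thesis using assms by (simp add: borel_measurable_restrict_space_iff)
qed

text \<open>The components agree almost everywhere with limits, along one fixed sequence, of
  difference quotients of the zero extension, and those limits are Borel. What \<open>lim\<close>
  returns at points without convergence affects only a null set.\<close>

lemma grad_measurable:
  fixes f :: "real^'n \<Rightarrow> real"
  assumes "locally_lipschitz \<Omega> f" "open \<Omega>"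
  shows "grad f \<in> borel_measurable (lebesgue_on \<Omega>)"
proof -
  define F where "F x = indicator \<Omega> x *\<^sub>R f x" for x
  have [measurable]: "F \<in> borel_measurable borel"
    unfolding F_def using locally_lipschitz_continuous_on[OF assms] assms(2)
    by (intro borel_measurable_continuous_on_indicator) auto
  define h where "h k = 1 / real (Suc k)" for k
  have h: "h \<longlonglongrightarrow> 0" "\<And>k. h k \<noteq> 0" unfolding h_def using LIMSEQ_inverse_real_of_nat by (auto simp: inverse_eq_divide)
  define g where "g x = (\<chi> i. lim (\<lambda>k. (F (x + h k *\<^sub>R axis i 1) - F x) / h k))" for x :: "real^'n"
  have "(\<lambda>x. g x $ i) \<in> borel_measurable borel" for i
    unfolding g_def vec_lambda_beta by (intro borel_measurable_lim_metric) measurable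
  then have "g \<in> borel_measurable borel"
    by (subst borel_measurable_euclidean_space) (auto simp: Basis_vec_def inner_axis)
  then have "g \<in> borel_measurable (lebesgue_on \<Omega>)"
    by (intro measurable_restrict_space1 measurable_completion) simp
  moreover have "AE x in lebesgue_on \<Omega>. g x = grad f x"
    using locally_lipschitz_AE_differentiable[OF assms] AE_space
  proof eventually_elim
    case (elim x)
    then have "x \<in> \<Omega>" by simp
    obtain e where e: "e > 0" "ball x e \<subseteq> \<Omega>" using \<open>x \<in> \<Omega>\<close> assms(2) openE by metis
    have "g x $ i = grad f x $ i" for i
    proof -
      have "\<forall>\<^sub>F k in sequentially. (f (x + h k *\<^sub>R axis i 1) - f x) / h k = (F (x + h k *\<^sub>R axis i 1) - F x) / h k"
        using order_tendstoD(2)[OF tendsto_norm_zero[OF h(1)] e(1)]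
      proof eventually_elim
        case (elim k)
        then have "x + h k *\<^sub>R axis i 1 \<in> ball x e" by (simp add: dist_norm norm_axis_1)
        then show ?case using e \<open>x \<in> \<Omega>\<close> by (auto simp: F_def)
      qed
      then have "(\<lambda>k. (F (x + h k *\<^sub>R axis i 1) - F x) / h k) \<longlonglongrightarrow> grad f x \<bullet> axis i 1"
        using tendsto_difference_quotient_grad[OF elim(1) h] tendsto_cong by fast
      then show ?thesis by (simp add: g_def limI inner_axis)
    qed
    then show ?case by (simp add: vec_eq_iff)
  qed
  ultimately show ?thesis
    by (rule borel_measurable_lebesgue_on_AE) (use assms(2) in auto)
qed

section \<open>Integration by parts and test functions\<close>

lemma lipschitz_compact_support_bounded:
  fixes g :: "'a::euclidean_space \<Rightarrow> real"
  assumes "L-lipschitz_on UNIV g" "compact K" "\<And>x. x \<notin> K \<Longrightarrow> g x = 0"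
  obtains T where "0 \<le> T" "\<forall>x. \<bar>g x\<bar> \<le> T"
proof -
  have "continuous_on K g" using lipschitz_on_continuous_on[OF assms(1)] continuous_on_subset by blast
  then have "bounded (g ` K)" using assms(2) by (intro compact_imp_bounded compact_continuous_image)
  then obtain T where "\<And>x. x \<in> K \<Longrightarrow> \<bar>g x\<bar> \<le> T" by (auto simp: bounded_iff)
  then have "\<bar>g x\<bar> \<le> max T 0" for x using assms(3)[of x] by (cases "x \<in> K") force+
  then show thesis by (intro that[of "max T 0"]) auto
qed

text \<open>Summation by parts for difference quotients moves the derivative onto \<open>g\<close> without a
  product rule; the Lipschitz constant of \<open>g\<close> then bounds the result.\<close>

lemma integral_mult_grad_bound:
  fixes g v :: "real^'n \<Rightarrow> real"
  assumes \<Omega>: "open \<Omega>" and v: "locally_lipschitz \<Omega> v" "integrable (lebesgue_on \<Omega>) v"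
    and g: "L-lipschitz_on UNIV g" and K: "compact K" "K \<subseteq> \<Omega>" "\<And>x. x \<notin> K \<Longrightarrow> g x = 0"
  shows "integrable (lebesgue_on \<Omega>) (\<lambda>x. g x * grad v x $ i)"
    and "\<bar>\<integral>x. g x * grad v x $ i \<partial>lebesgue_on \<Omega>\<bar> \<le> L * (\<integral>x. \<bar>v x\<bar> \<partial>lebesgue_on \<Omega>)"
proof -
  have \<Omega>s[simp]: "\<Omega> \<in> sets lebesgue" "\<Omega> \<in> sets borel" using \<Omega> by auto
  have L: "0 \<le> L" using g by (rule lipschitz_on_nonneg)
  obtain T where T: "0 \<le> T" "\<forall>x. \<bar>g x\<bar> \<le> T"
    by (rule lipschitz_compact_support_bounded[OF g K(1,3)])
  \<comment> \<open>An empty \<open>K\<close> has no meaningful distance function; hence the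
    conditional form here and the case distinctions in \<open>K'\<close> and
    \<open>d'\<close>.\<close>
  have "\<exists>d. K \<noteq> {} \<longrightarrow> d > 0 \<and> {x. infdist x K \<le> d} \<subseteq> \<Omega>"
    using compact_in_open_separated[OF _ K(1) \<Omega> K(2)] by metis
  then obtain d where d: "K \<noteq> {} \<Longrightarrow> d > 0" "K \<noteq> {} \<Longrightarrow> {x. infdist x K \<le> d} \<subseteq> \<Omega>" by blast
  \<comment> \<open>Points of \<open>K\<close> shifted by at most \<open>d\<close> stay in this
    compact neighbourhood, where the zero extension is \<open>v\<close> itself and a single
    Lipschitz constant controls it.\<close>
  define K' where "K' = (if K = {} then {} else {x. infdist x K \<le> d})"
  have K': "compact K'" "K' \<subseteq> \<Omega>" using d K(1) by (auto simp: K'_def intro!: compact_infdist_le)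
  obtain Lv where Lv: "Lv-lipschitz_on K' v" using v(1) K' unfolding locally_lipschitz_def by blast
  have Lv0: "0 \<le> Lv" using Lv by (rule lipschitz_on_nonneg)
  define d' where "d' = (if K = {} then 1 else d)"
  have "d' > 0" using d by (simp add: d'_def)
  define e :: "real^'n" where "e = axis i 1"
  have ne: "norm e = 1" by (simp add: e_def norm_axis_1)
  define h where "h k = d' / real (Suc k)" for k
  have h0: "h k > 0" "h k \<le> d'" for k using \<open>d' > 0\<close> by (auto simp: h_def field_simps)
  have h: "h \<longlonglongrightarrow> 0" unfolding h_def by (rule LIMSEQ_Suc[OF lim_const_over_n])
  have xK: "x \<in> K'" "x + h k *\<^sub>R e \<in> K'" if "x \<in> K" for x k
  proof -
    have "K \<noteq> {}" using that by auto
    have "infdist (x + h k *\<^sub>R e) K \<le> dist (x + h k *\<^sub>R e) x" using that by (rule infdist_le)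
    also have "\<dots> \<le> d" using h0[of k] ne \<open>K \<noteq> {}\<close> by (simp add: dist_norm d'_def)
    finally show "x + h k *\<^sub>R e \<in> K'" using \<open>K \<noteq> {}\<close> by (simp add: K'_def)
    show "x \<in> K'" using that \<open>K \<noteq> {}\<close> d by (simp add: K'_def)
  qed
  define F where "F x = indicator \<Omega> x *\<^sub>R v x" for x
  have F_m[measurable]: "F \<in> borel_measurable borel"
    unfolding F_def using locally_lipschitz_continuous_on[OF v(1) \<Omega>]
    by (intro borel_measurable_continuous_on_indicator) auto
  have F_i: "integrable lborel F"
  proof -
    have "integrable lebesgue F"
      using v(2) unfolding F_def[abs_def] by (subst (asm) integrable_restrict_space) auto
    then show ?thesis by (subst (asm) integrable_completion) auto
  qed
  have g_m[measurable]: "g \<in> borel_measurable borel"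
    using lipschitz_on_continuous_on[OF g] by (rule borel_measurable_continuous_onI)
  have gF: "integrable lborel (\<lambda>x. g (x - c) * F x)" for c
    by (rule Bochner_Integration.integrable_bound[of _ "\<lambda>x. T * F x"])
      (use F_i T in \<open>auto simp: abs_mult intro!: mult_mono AE_I2\<close>)
  have shift: "integrable lborel (\<lambda>x. g x * F (x + c))"
    "(\<integral>x. g x * F (x + c) \<partial>lborel) = (\<integral>x. g (x - c) * F x \<partial>lborel)" for c
  proof -
    let ?f = "\<lambda>x. g (x - c) * F x"
    have "integrable (distr lborel borel ((+) c)) ?f" "integral\<^sup>L (distr lborel borel ((+) c)) ?f = integral\<^sup>L lborel ?f"
      using gF by (simp_all add: lborel_distr_plus)
    then show "integrable lborel (\<lambda>x. g x * F (x + c))"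
      "(\<integral>x. g x * F (x + c) \<partial>lborel) = (\<integral>x. g (x - c) * F x \<partial>lborel)"
      by (simp_all add: integrable_distr_eq integral_distr add.commute)
  qed
  define q where "q k x = g x * ((F (x + h k *\<^sub>R e) - F x) / h k)" for k x
  have q_bound: "\<bar>\<integral>x. q k x \<partial>lborel\<bar> \<le> L * (\<integral>x. \<bar>F x\<bar> \<partial>lborel)" for k
  proof -
    let ?c = "h k *\<^sub>R e"
    have "(\<integral>x. q k x \<partial>lborel) = (\<integral>x. (g x * F (x + ?c) - g x * F x) / h k \<partial>lborel)"
      by (simp add: q_def right_diff_distrib)
    also have "\<dots> = ((\<integral>x. g x * F (x + ?c) \<partial>lborel) - (\<integral>x. g x * F x \<partial>lborel)) / h k"
      using shift(1)[of ?c] shift(1)[of 0] by simp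
    also have "\<dots> = (\<integral>x. (g (x - ?c) * F x - g x * F x) / h k \<partial>lborel)"
      using gF[of ?c] gF[of 0] by (simp add: shift(2))
    finally have eq: "(\<integral>x. q k x \<partial>lborel) = (\<integral>x. (g (x - ?c) * F x - g x * F x) / h k \<partial>lborel)" .
    have "\<bar>\<integral>x. q k x \<partial>lborel\<bar> \<le> (\<integral>x. \<bar>(g (x - ?c) * F x - g x * F x) / h k\<bar> \<partial>lborel)"
      unfolding eq by (rule integral_abs_bound)
    also have "\<dots> \<le> (\<integral>x. L * \<bar>F x\<bar> \<partial>lborel)"
    proof (rule integral_mono)
      fix x
      have "\<bar>g (x - ?c) - g x\<bar> \<le> L * norm ?c"
        using lipschitz_onD[OF g, of "x - ?c" x] by (simp add: dist_norm)
      then have "\<bar>g (x - ?c) - g x\<bar> / h k \<le> L" using h0[of k] ne by (simp add: field_simps)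
      then have "\<bar>g (x - ?c) - g x\<bar> / h k * \<bar>F x\<bar> \<le> L * \<bar>F x\<bar>" by (intro mult_right_mono) auto
      moreover have "\<bar>(g (x - ?c) * F x - g x * F x) / h k\<bar> = \<bar>g (x - ?c) - g x\<bar> / h k * \<bar>F x\<bar>"
        using h0[of k] by (simp add: abs_mult flip: left_diff_distrib)
      ultimately show "\<bar>(g (x - ?c) * F x - g x * F x) / h k\<bar> \<le> L * \<bar>F x\<bar>" by simp
    qed (use gF[of ?c] gF[of 0] F_i in auto)
    finally show ?thesis by simp
  qed
  have q_m[measurable]: "q k \<in> borel_measurable borel" for k
    unfolding q_def by measurable
  define G where "G x = indicator \<Omega> x *\<^sub>R (g x * grad v x $ i)" for x
  have "(\<lambda>x. grad v x \<bullet> axis i 1) \<in> borel_measurable (lebesgue_on \<Omega>)"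
    using grad_measurable[OF v(1) \<Omega>] by measurable
  then have [measurable]: "(\<lambda>x. grad v x $ i) \<in> borel_measurable (lebesgue_on \<Omega>)" by (simp add: inner_axis)
  have "g \<in> borel_measurable (lebesgue_on \<Omega>)" by (intro measurable_restrict_space1 measurable_completion) simp
  then have "(\<lambda>x. g x * grad v x $ i) \<in> borel_measurable (lebesgue_on \<Omega>)" by measurable
  then have G_m: "G \<in> borel_measurable lebesgue"
    by (simp add: borel_measurable_restrict_space_iff G_def[abs_def])
  have "AE x in lebesgue. x \<in> \<Omega> \<longrightarrow> v differentiable (at x)"
    using locally_lipschitz_AE_differentiable[OF v(1) \<Omega>] by (simp add: AE_restrict_space_iff)
  then have lim: "AE x in lebesgue. (\<lambda>k. q k x) \<longlonglongrightarrow> G x"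
  proof eventually_elim
    case (elim x)
    show ?case
    proof (cases "x \<in> K")
      case False
      then show ?thesis using K(3) by (simp add: q_def G_def)
    next
      case True
      then have x: "x \<in> \<Omega>" "v differentiable (at x)" using elim K by auto
      have "F (x + h k *\<^sub>R e) = v (x + h k *\<^sub>R e)" for k
        using xK(2)[OF True, of k] K'(2) by (auto simp: F_def)
      then have "q k x = g x * ((v (x + h k *\<^sub>R e) - v x) / h k)" for k
        using x(1) by (simp add: q_def F_def)
      moreover have "(\<lambda>k. g x * ((v (x + h k *\<^sub>R e) - v x) / h k)) \<longlonglongrightarrow> g x * (grad v x \<bullet> e)"
        using h0 by (intro tendsto_mult_left tendsto_difference_quotient_grad x h) (simp add: less_imp_neq[symmetric])
      ultimately show ?thesis using x by (simp add: G_def e_def inner_axis)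
    qed
  qed
  \<comment> \<open>The factor \<open>g\<close> confines the quotients to \<open>K\<close>, so the
    merely local Lipschitz constant of \<open>v\<close> yields an integrable majorant uniform in
    \<open>k\<close>.\<close>
  have bound: "norm (q k x) \<le> T * Lv * indicator K' x" for k x
  proof (cases "x \<in> K")
    case True
    have "\<bar>v (x + h k *\<^sub>R e) - v x\<bar> \<le> Lv * norm (h k *\<^sub>R e)"
      using lipschitz_onD[OF Lv xK(2)[OF True] xK(1)[OF True], of k] by (simp add: dist_norm)
    then have "\<bar>(v (x + h k *\<^sub>R e) - v x) / h k\<bar> \<le> Lv" using h0[of k] ne by (simp add: field_simps)
    moreover have "F (x + h k *\<^sub>R e) = v (x + h k *\<^sub>R e)" "F x = v x"
      using xK(2)[OF True, of k] xK(1)[OF True] K'(2) by (auto simp: F_def)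
    ultimately have "\<bar>g x\<bar> * \<bar>(F (x + h k *\<^sub>R e) - F x) / h k\<bar> \<le> T * Lv"
      using T by (intro mult_mono) auto
    then show ?thesis using xK(1)[OF True] by (simp add: q_def abs_mult)
  next
    case False
    then show ?thesis using K(3) T Lv0 by (simp add: q_def)
  qed
  have w: "integrable lebesgue (\<lambda>x. T * Lv * indicator K' x :: real)"
    using lmeasurable_compact[OF K'(1)] by (auto simp: fmeasurable_def)
  have q_l: "q k \<in> borel_measurable lebesgue" for k by (intro measurable_completion) simp
  have conv: "(\<lambda>k. integral\<^sup>L lebesgue (q k)) \<longlonglongrightarrow> integral\<^sup>L lebesgue G" and Gi: "integrable lebesgue G"
    using integral_dominated_convergence[OF G_m q_l w lim] integrable_dominated_convergence[OF G_m q_l w lim] bound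
    by auto
  show "integrable (lebesgue_on \<Omega>) (\<lambda>x. g x * grad v x $ i)"
    using Gi by (simp add: integrable_restrict_space G_def[abs_def])
  have "\<bar>integral\<^sup>L lebesgue G\<bar> \<le> L * (\<integral>x. \<bar>F x\<bar> \<partial>lborel)"
    by (rule tendsto_upperbound[OF tendsto_rabs[OF conv]]) (use q_bound in \<open>auto simp: integral_completion\<close>)
  moreover have "(\<integral>x. \<bar>F x\<bar> \<partial>lborel) = (\<integral>x. \<bar>v x\<bar> \<partial>lebesgue_on \<Omega>)"
  proof -
    have "(\<integral>x. \<bar>F x\<bar> \<partial>lborel) = (\<integral>x. \<bar>F x\<bar> \<partial>lebesgue)"
      by (rule integral_completion[symmetric]) simp
    then show ?thesis by (simp add: integral_restrict_space F_def abs_mult)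
  qed
  ultimately show "\<bar>\<integral>x. g x * grad v x $ i \<partial>lebesgue_on \<Omega>\<bar> \<le> L * (\<integral>x. \<bar>v x\<bar> \<partial>lebesgue_on \<Omega>)"
    by (simp add: integral_restrict_space G_def[abs_def])
qed

text \<open>The indicator of a compact set is the limit of Lipschitz tents built from the distance
  to it, with \<open>\<bar>V x\<bar>\<close> as majorant.\<close>

lemma integral_compact_zero_if_test_integrals_zero:
  fixes V :: "real^'n \<Rightarrow> real"
  assumes "open \<Omega>" and V: "integrable (lebesgue_on \<Omega>) V"
    and test: "\<And>\<theta>. lipschitz_compact_support \<Omega> \<theta> \<Longrightarrow> (\<integral>x. \<theta> x * V x \<partial>lebesgue_on \<Omega>) = 0"
    and K: "compact K" "K \<subseteq> \<Omega>"
  shows "(\<integral>x. indicator K x * V x \<partial>lebesgue_on \<Omega>) = 0"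
proof (cases "K = {}")
  case False
  obtain d where d: "d > 0" "{x. infdist x K \<le> d} \<subseteq> \<Omega>"
    using compact_in_open_separated[OF False K(1) assms(1) K(2)] by blast
  obtain n0 where n0: "1 / Suc n0 < d" using \<open>d > 0\<close> by (metis nat_approx_posE)
  \<comment> \<open>The offset \<open>n0\<close> makes even the widest tent fit in the
    \<open>d\<close>-neighbourhood, hence in \<Omega>.\<close>
  define \<theta> where "\<theta> n x = max 0 (1 - Suc (n0 + n) * infdist x K)" for n x
  have \<theta>_lip: "(real (Suc (n0 + n)))-lipschitz_on UNIV (\<theta> n)" for n
  proof (rule lipschitz_onI)
    fix x y
    have "\<bar>real (Suc (n0 + n)) * (infdist x K - infdist y K)\<bar> \<le> Suc (n0 + n) * dist x y"
      unfolding abs_mult by (intro mult_mono infdist_triangle_abs; simp)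
    then show "dist (\<theta> n x) (\<theta> n y) \<le> Suc (n0 + n) * dist x y"
      unfolding \<theta>_def dist_real_def right_diff_distrib by linarith
  qed simp
  have supp: "closure {x. \<theta> n x \<noteq> 0} \<subseteq> {x. infdist x K \<le> d}" for n
  proof (rule closure_minimal)
    show "{x. \<theta> n x \<noteq> 0} \<subseteq> {x. infdist x K \<le> d}"
    proof clarify
      fix x assume "\<theta> n x \<noteq> 0"
      then have "Suc (n0 + n) * infdist x K < 1" unfolding \<theta>_def by linarith
      moreover have "Suc n0 * infdist x K \<le> Suc (n0 + n) * infdist x K"
        by (intro mult_right_mono) (auto simp: infdist_nonneg)
      ultimately have "Suc n0 * infdist x K < 1" by linarith
      then have "infdist x K < 1 / Suc n0" by (simp add: field_simps)
      then show "infdist x K \<le> d" using n0 by linarith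
    qed
    show "closed {x. infdist x K \<le> d}"
      using compact_infdist_le[OF False K(1) d(1)] by (rule compact_imp_closed)
  qed
  have "lipschitz_compact_support \<Omega> (\<theta> n)" for n
    unfolding lipschitz_compact_support_def
  proof (intro conjI)
    show "\<exists>L. L-lipschitz_on UNIV (\<theta> n)" using \<theta>_lip by blast
    show "compact (closure {x. \<theta> n x \<noteq> 0})"
      using compact_Int_closed[OF compact_infdist_le[OF False K(1) d(1)] closed_closure] supp[of n]
      by (metis inf.absorb2)
    show "closure {x. \<theta> n x \<noteq> 0} \<subseteq> \<Omega>" using supp d(2) by blast
  qed
  then have 0: "(\<integral>x. \<theta> n x * V x \<partial>lebesgue_on \<Omega>) = 0" for n by (rule test)
  have \<theta>_m: "\<theta> n \<in> borel_measurable (lebesgue_on \<Omega>)" for n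
    using lipschitz_on_continuous_on[OF \<theta>_lip]
    by (intro measurable_restrict_space1 measurable_completion) (simp add: borel_measurable_continuous_onI)
  have [measurable]: "V \<in> borel_measurable (lebesgue_on \<Omega>)" using V by simp
  have K_m: "(indicator K :: _ \<Rightarrow> real) \<in> borel_measurable (lebesgue_on \<Omega>)"
    using K(1) by (intro measurable_restrict_space1 measurable_completion borel_measurable_indicator) (auto simp: compact_imp_closed)
  have lim: "(\<lambda>n. \<theta> n x) \<longlonglongrightarrow> indicator K x" for x
  proof (cases "x \<in> K")
    case True
    then show ?thesis by (simp add: \<theta>_def)
  next
    case False
    then have i: "infdist x K > 0"
      using \<open>K \<noteq> {}\<close> K(1) by (intro infdist_pos_not_in_closed compact_imp_closed)
    then obtain N :: nat where N: "1 / infdist x K < N" using reals_Archimedean2 by blast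
    have "\<theta> n x = 0" if "n \<ge> N" for n
    proof -
      have "1 < N * infdist x K" using N i by (simp add: field_simps)
      also have "\<dots> \<le> Suc (n0 + n) * infdist x K" using that i by (intro mult_right_mono) auto
      finally show ?thesis by (simp add: \<theta>_def)
    qed
    then have "\<forall>\<^sub>F n in sequentially. \<theta> n x = 0" by (auto simp: eventually_sequentially)
    then show ?thesis using False by (simp add: tendsto_eventually)
  qed
  have "(\<lambda>n. \<integral>x. \<theta> n x * V x \<partial>lebesgue_on \<Omega>) \<longlonglongrightarrow> (\<integral>x. indicator K x * V x \<partial>lebesgue_on \<Omega>)"
  proof (rule integral_dominated_convergence[where w = "\<lambda>x. \<bar>V x\<bar>"])
    show "AE x in lebesgue_on \<Omega>. (\<lambda>n. \<theta> n x * V x) \<longlonglongrightarrow> indicator K x * V x"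
      by (intro AE_I2 tendsto_mult_right lim)
    show "AE x in lebesgue_on \<Omega>. norm (\<theta> n x * V x) \<le> \<bar>V x\<bar>" for n
    proof (rule AE_I2)
      fix x
      have "\<bar>\<theta> n x\<bar> \<le> 1" unfolding \<theta>_def using infdist_nonneg[of x K] by auto
      then show "norm (\<theta> n x * V x) \<le> \<bar>V x\<bar>" by (simp add: abs_mult mult_left_le_one_le)
    qed
  qed (use V \<theta>_m K_m in auto)
  then show ?thesis by (simp add: 0 LIMSEQ_const_iff)
qed simp

text \<open>By inner regularity the set where \<open>V > 0\<close> is exhausted by closed sets,
  compact since \<Omega> is bounded. The integral of \<open>V\<close> over such a set is 0 while the
  integrand is positive there, so the set is null.\<close>

lemma AE_le_zero_if_test_integrals_zero:
  fixes V :: "real^'n \<Rightarrow> real"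
  assumes "open \<Omega>" "bounded \<Omega>" and V: "integrable (lebesgue_on \<Omega>) V"
    and test: "\<And>\<theta>. lipschitz_compact_support \<Omega> \<theta> \<Longrightarrow> (\<integral>x. \<theta> x * V x \<partial>lebesgue_on \<Omega>) = 0"
  shows "AE x in lebesgue_on \<Omega>. V x \<le> 0"
proof -
  have \<Omega>: "\<Omega> \<in> sets lebesgue" using assms(1) by auto
  let ?S = "{x \<in> \<Omega>. V x > 0}"
  have Vm[measurable]: "V \<in> borel_measurable (lebesgue_on \<Omega>)" using V by simp
  have "{x \<in> space (lebesgue_on \<Omega>). V x > 0} \<in> sets (lebesgue_on \<Omega>)" by measurable
  then have S: "?S \<in> sets lebesgue" using \<Omega> by (simp add: sets_restrict_space_iff)
  have le: "emeasure lebesgue ?S \<le> ennreal e" if e: "e > 0" for e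
  proof -
    obtain T where T: "closed T" "T \<subseteq> ?S" "?S - T \<in> lmeasurable" "emeasure lebesgue (?S - T) < ennreal e"
      by (rule sets_lebesgue_inner_closed[OF S e])
    have "bounded T" using T(2) by (intro bounded_subset[OF assms(2)]) auto
    then have "compact T" using T(1) by (simp add: compact_eq_bounded_closed)
    have T_m: "T \<in> sets (lebesgue_on \<Omega>)"
      using \<Omega> T(1,2) by (auto simp: sets_restrict_space_iff)
    have i: "integrable (lebesgue_on \<Omega>) (\<lambda>x. indicator T x * V x)"
      using integrable_mult_indicator[OF T_m V] by simp
    have "(\<integral>x. indicator T x * V x \<partial>lebesgue_on \<Omega>) = 0"
      using T(2) \<open>compact T\<close> by (intro integral_compact_zero_if_test_integrals_zero assms) auto
    then have "AE x in lebesgue_on \<Omega>. indicator T x * V x = 0"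
    proof (subst (asm) integral_nonneg_eq_0_iff_AE[OF i])
      show "AE x in lebesgue_on \<Omega>. 0 \<le> indicator T x * V x"
        using T(2) by (intro AE_I2) (auto simp: indicator_def less_imp_le subset_iff)
    qed
    then have "AE x in lebesgue. x \<notin> T"
      using \<Omega> T(2) by (auto simp: AE_restrict_space_iff indicator_def elim!: eventually_mono)
    then have "emeasure lebesgue T = 0"
      using T(1) by (subst (asm) AE_iff_measurable[OF _ refl]) auto
    have "emeasure lebesgue ?S \<le> emeasure lebesgue (T \<union> (?S - T))"
      using S T(1) by (intro emeasure_mono) auto
    also have "\<dots> \<le> emeasure lebesgue T + emeasure lebesgue (?S - T)"
      using S T(1) by (intro emeasure_subadditive) auto
    finally show ?thesis using T(4) \<open>emeasure lebesgue T = 0\<close> by simp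
  qed
  have "emeasure lebesgue ?S \<le> 0" by (rule ennreal_le_epsilon) (use le in \<open>simp only: add_0\<close>)
  then have "?S \<in> null_sets lebesgue" using S by (simp only: null_sets_def mem_Collect_eq le_zero_eq)
  then have "AE x in lebesgue. x \<in> \<Omega> \<longrightarrow> V x \<le> 0" by (rule AE_I') auto
  then show ?thesis using \<Omega> by (simp add: AE_restrict_space_iff)
qed

lemma AE_zero_if_test_integrals_zero:
  fixes V :: "real^'n \<Rightarrow> real"
  assumes "open \<Omega>" "bounded \<Omega>" and V: "integrable (lebesgue_on \<Omega>) V"
    and test: "\<And>\<theta>. lipschitz_compact_support \<Omega> \<theta> \<Longrightarrow> (\<integral>x. \<theta> x * V x \<partial>lebesgue_on \<Omega>) = 0"
  shows "AE x in lebesgue_on \<Omega>. V x = 0"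
proof -
  have "AE x in lebesgue_on \<Omega>. V x \<le> 0"
    using assms by (rule AE_le_zero_if_test_integrals_zero)
  moreover have "AE x in lebesgue_on \<Omega>. - V x \<le> 0"
    using assms by (intro AE_le_zero_if_test_integrals_zero) auto
  ultimately show ?thesis by eventually_elim simp
qed

section \<open>Degenerate Sobolev spaces\<close>

locale degenerate_domain =
  fixes \<Omega> :: "(real^'n) set" and B :: "real^'n \<Rightarrow> real^'n^'n"
  assumes open_dom: "open \<Omega>" and bounded_dom: "bounded \<Omega>"
    and lipschitz_B: "\<exists>L. L-lipschitz_on \<Omega> B"
begin

abbreviation M where "M \<equiv> lebesgue_on \<Omega>"

lemma dom_sets [simp]: "\<Omega> \<in> sets lebesgue"
  using open_dom by auto

lemma dom_lmeasurable: "\<Omega> \<in> lmeasurable"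
  using bounded_dom dom_sets by (rule bounded_set_imp_lmeasurable)

sublocale finite_measure M
  using dom_lmeasurable by (rule finite_measure_lebesgue_on)

lemma B_component_lipschitz:
  obtains L where "\<forall>k j. L-lipschitz_on \<Omega> (\<lambda>x. B x $ k $ j)"
proof -
  obtain L where L: "L-lipschitz_on \<Omega> B" using lipschitz_B by blast
  have "L-lipschitz_on \<Omega> (\<lambda>x. B x $ k $ j)" for k j
  proof (rule lipschitz_onI)
    fix x y assume "x \<in> \<Omega>" "y \<in> \<Omega>"
    then have "norm (B x - B y) \<le> L * dist x y"
      using lipschitz_onD[OF L] by (simp add: dist_norm)
    moreover have "\<bar>(B x - B y) $ k $ j\<bar> \<le> norm (B x - B y)"
      by (rule order_trans[OF component_le_norm_cart Finite_Cartesian_Product.norm_nth_le])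
    ultimately show "dist (B x $ k $ j) (B y $ k $ j) \<le> L * dist x y"
      by (simp add: dist_real_def)
  qed (rule lipschitz_on_nonneg[OF L])
  then show thesis using that by blast
qed

lemma vector_measurable_iff:
  fixes G :: "'a \<Rightarrow> real^'m"
  shows "G \<in> borel_measurable N \<longleftrightarrow> (\<forall>i. (\<lambda>x. G x $ i) \<in> borel_measurable N)"
  by (subst borel_measurable_euclidean_space) (auto simp: Basis_vec_def inner_axis)

lemma B_measurable [measurable]:
  assumes "G \<in> borel_measurable M"
  shows "(\<lambda>x. B x *v G x) \<in> borel_measurable M"
proof -
  obtain L where L: "\<forall>k j. L-lipschitz_on \<Omega> (\<lambda>x. B x $ k $ j)"
    by (rule B_component_lipschitz)
  have [measurable]: "(\<lambda>x. B x $ k $ j) \<in> borel_measurable M" for k j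
    using lipschitz_on_continuous_on[OF L[rule_format]] by (intro continuous_imp_measurable_on_sets_lebesgue) auto
  have [measurable]: "(\<lambda>x. G x $ j) \<in> borel_measurable M" for j
    using assms vector_measurable_iff by blast
  show ?thesis
    by (subst vector_measurable_iff) (simp add: matrix_vector_mult_def)
qed

lemma energy_1:
  assumes [measurable]: "v \<in> borel_measurable M" "G \<in> borel_measurable M"
  shows "sobolev_energy 1 B \<Omega> v G = (\<integral>\<^sup>+x. \<bar>v x\<bar> \<partial>M) + (\<integral>\<^sup>+x. norm (B x *v G x) \<partial>M)"
proof -
  have "sobolev_energy 1 B \<Omega> v G = (\<integral>\<^sup>+x. ennreal \<bar>v x\<bar> + ennreal (norm (B x *v G x)) \<partial>M)"
    unfolding sobolev_energy_def by simp
  also have "\<dots> = (\<integral>\<^sup>+x. \<bar>v x\<bar> \<partial>M) + (\<integral>\<^sup>+x. norm (B x *v G x) \<partial>M)"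
    by (intro nn_integral_add) measurable
  finally show ?thesis .
qed

lemma energy_2:
  "sobolev_energy 2 B \<Omega> v G = (\<integral>\<^sup>+x. ennreal ((v x)\<^sup>2 + (norm (B x *v G x))\<^sup>2) \<partial>M)"
  unfolding sobolev_energy_def by (simp add: powr_numeral)

text \<open>Pointwise \<open>a \<le> \<eta> + a^2 / \<eta>\<close>. The free parameter is needed
  because the two energies are not homogeneous of the same degree: smallness at exponent 1 follows
  by fixing \<eta> first and then making the energy at exponent 2 small against it.\<close>

lemma energy_1_le_2:
  assumes [measurable]: "v \<in> borel_measurable M" "G \<in> borel_measurable M" and "\<eta> > 0"
  shows "sobolev_energy 1 B \<Omega> v G
    \<le> ennreal (2 * \<eta>) * ennreal (measure lebesgue \<Omega>) + ennreal (1 / \<eta>) * sobolev_energy 2 B \<Omega> v G"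
proof -
  have young: "a \<le> \<eta> + a\<^sup>2 / \<eta>" if "0 \<le> a" for a :: real
  proof (cases "a \<le> \<eta>")
    case False
    then have "a * \<eta> \<le> a * a" using that by (intro mult_left_mono) auto
    then have "a \<le> a\<^sup>2 / \<eta>" using \<open>\<eta> > 0\<close> by (simp add: field_simps power2_eq_square)
    then show ?thesis using \<open>\<eta> > 0\<close> by simp
  qed (use \<open>\<eta> > 0\<close> in \<open>auto intro: add_increasing2\<close>)
  have "sobolev_energy 1 B \<Omega> v G
      \<le> (\<integral>\<^sup>+x. ennreal (2 * \<eta>) + ennreal (1 / \<eta>) * ennreal ((v x)\<^sup>2 + (norm (B x *v G x))\<^sup>2) \<partial>M)"
    unfolding sobolev_energy_def
  proof (rule nn_integral_mono)
    fix x
    have "\<bar>v x\<bar> + norm (B x *v G x) \<le> 2 * \<eta> + 1 / \<eta> * ((v x)\<^sup>2 + (norm (B x *v G x))\<^sup>2)"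
      using young[of "\<bar>v x\<bar>"] young[of "norm (B x *v G x)"] by (simp add: add_divide_distrib)
    moreover have "ennreal (2 * \<eta>) + ennreal (1 / \<eta>) * ennreal ((v x)\<^sup>2 + (norm (B x *v G x))\<^sup>2)
        = ennreal (2 * \<eta> + 1 / \<eta> * ((v x)\<^sup>2 + (norm (B x *v G x))\<^sup>2))"
      using \<open>\<eta> > 0\<close> by (simp add: ennreal_mult'[symmetric] ennreal_plus[symmetric] del: ennreal_plus)
    ultimately show "ennreal (\<bar>v x\<bar> powr 1 + norm (B x *v G x) powr 1)
        \<le> ennreal (2 * \<eta>) + ennreal (1 / \<eta>) * ennreal ((v x)\<^sup>2 + (norm (B x *v G x))\<^sup>2)"
      by (simp add: ennreal_leI del: ennreal_plus)
  qed
  also have "\<dots> = (\<integral>\<^sup>+x. ennreal (2 * \<eta>) \<partial>M) + (\<integral>\<^sup>+x. ennreal (1 / \<eta>) * ennreal ((v x)\<^sup>2 + (norm (B x *v G x))\<^sup>2) \<partial>M)"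
    by (intro nn_integral_add) measurable
  also have "\<dots> = ennreal (2 * \<eta>) * emeasure M (space M) + ennreal (1 / \<eta>) * sobolev_energy 2 B \<Omega> v G"
    by (subst nn_integral_cmult) (auto simp: energy_2)
  also have "emeasure M (space M) = ennreal (measure lebesgue \<Omega>)"
    using dom_lmeasurable by (simp add: emeasure_restrict_space emeasure_eq_measure2)
  finally show ?thesis .
qed

text \<open>The predicate \<open>P\<close> lets one argument serve both the full space and the space
  with zero boundary values.\<close>

lemma approximable_2_imp_1:
  assumes P: "\<And>v. P v \<Longrightarrow> locally_lipschitz \<Omega> v"
    and u: "u \<in> borel_measurable M" and G: "G \<in> borel_measurable M"
    and approx: "\<forall>\<epsilon>>0. \<exists>v. P v \<and> sobolev_energy 2 B \<Omega> (\<lambda>x. u x - v x) (\<lambda>x. G x - grad v x) < \<epsilon>"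
  shows "\<forall>\<epsilon>>0. \<exists>v. P v \<and> sobolev_energy 1 B \<Omega> (\<lambda>x. u x - v x) (\<lambda>x. G x - grad v x) < \<epsilon>"
proof (intro allI impI)
  fix \<epsilon> :: ennreal assume "\<epsilon> > 0"
  obtain e where e: "e > 0" "ennreal e \<le> \<epsilon>"
    using \<open>\<epsilon> > 0\<close> by (cases \<epsilon>) (auto intro: that[of 1])
  define m where "m = measure lebesgue \<Omega>"
  have "0 \<le> m" by (simp add: m_def)
  \<comment> \<open>This makes the measure term smaller than \<open>e / 2\<close>; the other half is
    spent on the energy at exponent 2.\<close>
  define \<eta> where "\<eta> = e / (4 * (m + 1))"
  have "\<eta> > 0" using e \<open>0 \<le> m\<close> by (simp add: \<eta>_def)
  obtain v where v: "P v" "sobolev_energy 2 B \<Omega> (\<lambda>x. u x - v x) (\<lambda>x. G x - grad v x) < ennreal (\<eta> * (e / 2))"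
    using approx e \<open>\<eta> > 0\<close> by (metis ennreal_less_zero_iff half_gt_zero mult_pos_pos)
  have m': "v \<in> borel_measurable M" "grad v \<in> borel_measurable M"
    using locally_lipschitz_measurable grad_measurable P[OF v(1)] open_dom by auto
  have "sobolev_energy 1 B \<Omega> (\<lambda>x. u x - v x) (\<lambda>x. G x - grad v x)
      \<le> ennreal (2 * \<eta>) * ennreal m + ennreal (1 / \<eta>) * sobolev_energy 2 B \<Omega> (\<lambda>x. u x - v x) (\<lambda>x. G x - grad v x)"
    unfolding m_def by (intro energy_1_le_2 borel_measurable_diff u G m' \<open>\<eta> > 0\<close>)
  also have "\<dots> \<le> ennreal (2 * \<eta>) * ennreal m + ennreal (1 / \<eta>) * ennreal (\<eta> * (e / 2))"
    using v(2) by (intro add_left_mono mult_left_mono) auto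
  also have "\<dots> = ennreal (2 * \<eta> * m + e / 2)"
    using \<open>\<eta> > 0\<close> e \<open>0 \<le> m\<close> by (simp add: ennreal_mult'[symmetric] ennreal_plus[symmetric] del: ennreal_plus)
  also have "\<dots> < ennreal e"
  proof -
    have "2 * \<eta> * m = e / 2 * (m / (m + 1))" using \<open>0 \<le> m\<close> by (simp add: \<eta>_def field_simps)
    also have "\<dots> < e / 2 * 1" using \<open>0 \<le> m\<close> e by (intro mult_strict_left_mono) auto
    finally show ?thesis using e \<open>0 \<le> m\<close> \<open>\<eta> > 0\<close> by (intro ennreal_lessI) auto
  qed
  finally show "\<exists>v. P v \<and> sobolev_energy 1 B \<Omega> (\<lambda>x. u x - v x) (\<lambda>x. G x - grad v x) < \<epsilon>"
    using v(1) e(2) by (intro exI[of _ v]) auto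
qed

lemma sobolev_grad_2_imp_1:
  assumes "sobolev_grad 2 B \<Omega> u G"
  shows "sobolev_grad 1 B \<Omega> u G"
proof -
  have m: "u \<in> borel_measurable M" "G \<in> borel_measurable M" "sobolev_energy 2 B \<Omega> u G < \<infinity>"
    and approx: "\<forall>\<epsilon>>0. \<exists>v. locally_lipschitz \<Omega> v \<and> sobolev_energy 2 B \<Omega> (\<lambda>x. u x - v x) (\<lambda>x. G x - grad v x) < \<epsilon>"
    using assms unfolding sobolev_grad_def by auto
  have "sobolev_energy 1 B \<Omega> u G \<le> ennreal (2 * 1) * ennreal (measure lebesgue \<Omega>) + ennreal (1 / 1) * sobolev_energy 2 B \<Omega> u G"
    by (intro energy_1_le_2 m) simp
  also have "\<dots> < \<infinity>" using m(3) by (simp add: ennreal_mult_less_top)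
  finally show ?thesis
    using m approximable_2_imp_1[OF _ m(1,2) approx] unfolding sobolev_grad_def by auto
qed

lemma sobolev_grad_0_2_imp_1:
  assumes "sobolev_grad_0 2 B \<Omega> u G"
  shows "sobolev_grad_0 1 B \<Omega> u G"
  using assms sobolev_grad_2_imp_1[of u G]
    approximable_2_imp_1[of "lipschitz_compact_support \<Omega>" u G] lipschitz_compact_support_imp_locally_lipschitz
  unfolding sobolev_grad_0_def by (auto simp: sobolev_grad_def)

lemma energy_1_less_imp_integrable:
  assumes [measurable]: "v \<in> borel_measurable M" "G \<in> borel_measurable M"
    and less: "sobolev_energy 1 B \<Omega> v G < ennreal e"
  shows "integrable M v" "integrable M (\<lambda>x. B x *v G x)"
    "(\<integral>x. \<bar>v x\<bar> \<partial>M) \<le> e" "(\<integral>x. norm (B x *v G x) \<partial>M) \<le> e"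
proof -
  have le: "(\<integral>\<^sup>+x. \<bar>v x\<bar> \<partial>M) < ennreal e" "(\<integral>\<^sup>+x. norm (B x *v G x) \<partial>M) < ennreal e"
    using less unfolding energy_1[OF assms(1,2)]
    by (auto intro: le_less_trans[OF add_increasing2[OF zero_le order_refl]] le_less_trans[OF add_increasing[OF zero_le order_refl]])
  then show i: "integrable M v" "integrable M (\<lambda>x. B x *v G x)"
    by (auto intro!: integrableI_bounded less_trans[OF le(1) ennreal_less_top] less_trans[OF le(2) ennreal_less_top]
        simp: real_norm_def)
  have "e > 0" using less by (metis ennreal_eq_0_iff leI not_less_zero)
  then show "(\<integral>x. \<bar>v x\<bar> \<partial>M) \<le> e" "(\<integral>x. norm (B x *v G x) \<partial>M) \<le> e"
    using le i by (auto simp: nn_integral_eq_integral ennreal_less_iff)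
qed

end

section \<open>Closability of the A-gradient\<close>

text \<open>Across the boundary of \<open>S\<close> no geometry enters: if \<open>y\<close> lies
  outside, then \<open>\<theta> y = 0\<close>, so \<theta> at \<open>x\<close> is at most
  \<open>L * dist x y\<close>, and \<open>b\<close> is bounded because \<open>S\<close> is. This
  turns entries of \<open>B\<close>, Lipschitz only on \<Omega>, into global test
  coefficients.\<close>

lemma lipschitz_on_mult_extend:
  fixes \<theta> b :: "'a::heine_borel \<Rightarrow> real"
  assumes \<theta>: "L-lipschitz_on UNIV \<theta>" "\<forall>x. \<bar>\<theta> x\<bar> \<le> T" "\<And>x. x \<notin> S \<Longrightarrow> \<theta> x = 0"
    and b: "L'-lipschitz_on S b" "bounded S"
  shows "\<exists>C. C-lipschitz_on UNIV (\<lambda>x. if x \<in> S then \<theta> x * b x else 0)"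
proof -
  have "bounded (b ` S)"
    by (rule bounded_uniformly_continuous_image[OF lipschitz_on_uniformly_continuous[OF b(1)] b(2)])
  then obtain Q where Q: "\<And>x. x \<in> S \<Longrightarrow> \<bar>b x\<bar> \<le> Q" by (auto simp: bounded_iff)
  define Q' where "Q' = max Q 0"
  have Q': "0 \<le> Q'" "\<And>x. x \<in> S \<Longrightarrow> \<bar>b x\<bar> \<le> Q'" using Q by (auto simp: Q'_def le_max_iff_disj)
  have L: "0 \<le> L" "0 \<le> L'" using \<theta>(1) b(1) by (auto dest: lipschitz_on_nonneg)
  have T: "0 \<le> T" using \<theta>(2) by (meson abs_ge_zero order_trans)
  define g where "g x = (if x \<in> S then \<theta> x * b x else 0)" for x
  have \<theta>d: "\<bar>\<theta> x - \<theta> y\<bar> \<le> L * dist x y" for x y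
    using lipschitz_onD[OF \<theta>(1), of x y] by (simp add: dist_real_def)
  have out: "\<bar>g x - g y\<bar> \<le> (T * L' + Q' * L) * dist x y" if "y \<notin> S" for x y
  proof (cases "x \<in> S")
    case True
    have "\<bar>\<theta> x\<bar> \<le> L * dist x y" using \<theta>d[of x y] \<theta>(3)[OF that] by simp
    then have "\<bar>\<theta> x\<bar> * \<bar>b x\<bar> \<le> (L * dist x y) * Q'" using Q' True L by (intro mult_mono) auto
    also have "\<dots> \<le> (T * L' + Q' * L) * dist x y" using T L by (simp add: algebra_simps)
    finally show ?thesis using True that by (simp add: g_def abs_mult)
  qed (use that T L Q' in \<open>simp add: g_def\<close>)
  have "(T * L' + Q' * L)-lipschitz_on UNIV g"
  proof (rule lipschitz_onI)
    fix x y
    show "dist (g x) (g y) \<le> (T * L' + Q' * L) * dist x y"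
    proof (cases "x \<in> S \<and> y \<in> S")
      case True
      have "g x - g y = \<theta> x * (b x - b y) + (\<theta> x - \<theta> y) * b y" using True by (simp add: g_def algebra_simps)
      then have "\<bar>g x - g y\<bar> \<le> \<bar>\<theta> x\<bar> * \<bar>b x - b y\<bar> + \<bar>\<theta> x - \<theta> y\<bar> * \<bar>b y\<bar>"
        by (metis abs_mult abs_triangle_ineq)
      also have "\<dots> \<le> T * (L' * dist x y) + (L * dist x y) * Q'"
        using \<theta>(2) \<theta>d Q' True T L lipschitz_onD[OF b(1), of x y]
        by (intro add_mono mult_mono) (auto simp: dist_real_def)
      finally show ?thesis by (simp add: dist_real_def algebra_simps)
    next
      case False
      then show ?thesis using out[of y x] out[of x y] by (auto simp: dist_real_def dist_commute abs_minus_commute)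
    qed
  qed (use T L Q' in simp)
  then show ?thesis unfolding g_def[abs_def] by blast
qed

context degenerate_domain
begin

text \<open>Two Lipschitz approximants of the same function are close in L^1. After multiplication
  by a test function and an entry of \<open>B\<close>, the derivative of their difference integrates
  by parts against a Lipschitz coefficient, so its integral is small as well. This is where the
  Lipschitz continuity of \<open>B\<close> is decisive.\<close>

theorem A_gradient_unique:
  assumes 1: "sobolev_grad 1 B \<Omega> f G1" and 2: "sobolev_grad 1 B \<Omega> f G2"
  shows "AE x in M. B x *v G1 x = B x *v G2 x"
proof -
  have f_m: "f \<in> borel_measurable M" and G_m: "G1 \<in> borel_measurable M" "G2 \<in> borel_measurable M"
    and fin: "sobolev_energy 1 B \<Omega> f G1 < \<infinity>" "sobolev_energy 1 B \<Omega> f G2 < \<infinity>"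
    using 1 2 unfolding sobolev_grad_def by auto
  have BG_i: "integrable M (\<lambda>x. B x *v G1 x)" "integrable M (\<lambda>x. B x *v G2 x)"
  proof -
    obtain e1 where "sobolev_energy 1 B \<Omega> f G1 < ennreal e1"
      using fin(1) by (metis ennreal_cases ennreal_lessI infinity_ennreal_def less_irrefl linordered_field_no_ub order_le_less_trans)
    then show "integrable M (\<lambda>x. B x *v G1 x)" using energy_1_less_imp_integrable[OF f_m G_m(1)] by blast
    obtain e2 where "sobolev_energy 1 B \<Omega> f G2 < ennreal e2"
      using fin(2) by (metis ennreal_cases ennreal_lessI infinity_ennreal_def less_irrefl linordered_field_no_ub order_le_less_trans)
    then show "integrable M (\<lambda>x. B x *v G2 x)" using energy_1_less_imp_integrable[OF f_m G_m(2)] by blast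
  qed
  have comp_i: "integrable M (\<lambda>x. F x $ k)" if "integrable M F" for F :: "real^'n \<Rightarrow> real^'n" and k
    using integrable_inner_left[OF that, of "axis k 1"] by (simp add: inner_axis)
  obtain LB where LB: "\<forall>k j. LB-lipschitz_on \<Omega> (\<lambda>x. B x $ k $ j)" by (rule B_component_lipschitz)
  have "AE x in M. (B x *v G1 x) $ k - (B x *v G2 x) $ k = 0" for k
  proof (rule AE_zero_if_test_integrals_zero[OF open_dom bounded_dom])
    show "integrable M (\<lambda>x. (B x *v G1 x) $ k - (B x *v G2 x) $ k)"
      using BG_i comp_i by (intro Bochner_Integration.integrable_diff) auto
  next
    fix \<theta> assume \<theta>: "lipschitz_compact_support \<Omega> \<theta>"
    define K where "K = closure {x. \<theta> x \<noteq> 0}"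
    obtain L where L: "L-lipschitz_on UNIV \<theta>" using \<theta> unfolding lipschitz_compact_support_def by blast
    have K: "compact K" "K \<subseteq> \<Omega>" "\<And>x. x \<notin> K \<Longrightarrow> \<theta> x = 0"
      using \<theta> closure_subset[of "{x. \<theta> x \<noteq> 0}"] unfolding lipschitz_compact_support_def K_def by auto
    obtain T where T: "0 \<le> T" "\<forall>x. \<bar>\<theta> x\<bar> \<le> T" by (rule lipschitz_compact_support_bounded[OF L K(1,3)])
    have \<theta>_m: "\<theta> \<in> borel_measurable M"
      using locally_lipschitz_measurable[OF lipschitz_compact_support_imp_locally_lipschitz[OF \<theta>] open_dom] .
    \<comment> \<open>The coefficient of the \<open>j\<close>-th partial derivative when component
      \<open>k\<close> of the A-gradient is tested with \<theta>.\<close>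
    define g where "g j x = (if x \<in> \<Omega> then \<theta> x * B x $ k $ j else 0)" for j x
    have "\<exists>C. C-lipschitz_on UNIV (g j)" for j
      unfolding g_def[abs_def]
      using lipschitz_on_mult_extend[OF L T(2) _ LB[rule_format, of k j] bounded_dom] K by blast
    then obtain C where C: "\<And>j. (C j)-lipschitz_on UNIV (g j)" by metis
    define S where "S = (\<Sum>j\<in>UNIV. C j)"
    have C0: "0 \<le> C j" for j using C by (rule lipschitz_on_nonneg)
    then have "0 \<le> S" by (auto simp: S_def intro: sum_nonneg)
    have g0: "g j x = 0" if "x \<notin> K" for j x using K(3)[OF that] by (simp add: g_def)
    have \<theta>_bound: "integrable M (\<lambda>x. \<theta> x * F x $ k)" "\<bar>\<integral>x. \<theta> x * F x $ k \<partial>M\<bar> \<le> T * (\<integral>x. norm (F x) \<partial>M)"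
      if F: "integrable M F" for F :: "real^'n \<Rightarrow> real^'n"
    proof -
      have le: "\<bar>\<theta> x * F x $ k\<bar> \<le> T * norm (F x)" for x
        unfolding abs_mult using T component_le_norm_cart by (intro mult_mono) auto
      show i: "integrable M (\<lambda>x. \<theta> x * F x $ k)"
        by (rule Bochner_Integration.integrable_bound[of _ "\<lambda>x. T * norm (F x)"])
          (use F \<theta>_m comp_i[OF F] le T in auto)
      have "\<bar>\<integral>x. \<theta> x * F x $ k \<partial>M\<bar> \<le> (\<integral>x. \<bar>\<theta> x * F x $ k\<bar> \<partial>M)" by (rule integral_abs_bound)
      also have "\<dots> \<le> (\<integral>x. T * norm (F x) \<partial>M)" using i F le by (intro integral_mono) auto
      finally show "\<bar>\<integral>x. \<theta> x * F x $ k \<partial>M\<bar> \<le> T * (\<integral>x. norm (F x) \<partial>M)" by simp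
    qed
    have bound: "\<bar>\<integral>x. \<theta> x * ((B x *v G1 x) $ k - (B x *v G2 x) $ k) \<partial>M\<bar> \<le> (2 * T + 2 * S) * e"
      if e: "e > 0" for e :: real
    proof -
      have e': "0 < ennreal e" using e by simp
      obtain v1 where v1: "locally_lipschitz \<Omega> v1"
        "sobolev_energy 1 B \<Omega> (\<lambda>x. f x - v1 x) (\<lambda>x. G1 x - grad v1 x) < ennreal e"
        using 1 e' unfolding sobolev_grad_def by blast
      obtain v2 where v2: "locally_lipschitz \<Omega> v2"
        "sobolev_energy 1 B \<Omega> (\<lambda>x. f x - v2 x) (\<lambda>x. G2 x - grad v2 x) < ennreal e"
        using 2 e' unfolding sobolev_grad_def by blast
      have v_m: "v1 \<in> borel_measurable M" "grad v1 \<in> borel_measurable M"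
        "v2 \<in> borel_measurable M" "grad v2 \<in> borel_measurable M"
        using v1 v2 open_dom locally_lipschitz_measurable grad_measurable by auto
      have i1: "integrable M (\<lambda>x. f x - v1 x)" "integrable M (\<lambda>x. B x *v (G1 x - grad v1 x))"
        "(\<integral>x. \<bar>f x - v1 x\<bar> \<partial>M) \<le> e" "(\<integral>x. norm (B x *v (G1 x - grad v1 x)) \<partial>M) \<le> e"
        by (rule energy_1_less_imp_integrable[OF _ _ v1(2)]; intro borel_measurable_diff f_m G_m v_m)+
      have i2: "integrable M (\<lambda>x. f x - v2 x)" "integrable M (\<lambda>x. B x *v (G2 x - grad v2 x))"
        "(\<integral>x. \<bar>f x - v2 x\<bar> \<partial>M) \<le> e" "(\<integral>x. norm (B x *v (G2 x - grad v2 x)) \<partial>M) \<le> e"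
        by (rule energy_1_less_imp_integrable[OF _ _ v2(2)]; intro borel_measurable_diff f_m G_m v_m)+
      define d where "d x = v1 x - v2 x" for x
      have d: "locally_lipschitz \<Omega> d" unfolding d_def using v1 v2 by (intro locally_lipschitz_diff)
      have d_eq: "d x = (f x - v2 x) - (f x - v1 x)" for x by (simp add: d_def)
      have d_i: "integrable M d" unfolding d_eq[abs_def] by (rule Bochner_Integration.integrable_diff[OF i2(1) i1(1)])
      have "(\<integral>x. \<bar>d x\<bar> \<partial>M) \<le> (\<integral>x. \<bar>f x - v2 x\<bar> + \<bar>f x - v1 x\<bar> \<partial>M)"
      proof (rule integral_mono)
        show "\<bar>d x\<bar> \<le> \<bar>f x - v2 x\<bar> + \<bar>f x - v1 x\<bar>" for x by (simp add: d_def)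
      qed (use i1(1) i2(1) d_i in auto)
      also have "\<dots> = (\<integral>x. \<bar>f x - v2 x\<bar> \<partial>M) + (\<integral>x. \<bar>f x - v1 x\<bar> \<partial>M)"
        using i1(1) i2(1) by (intro Bochner_Integration.integral_add) auto
      finally have d_le: "(\<integral>x. \<bar>d x\<bar> \<partial>M) \<le> 2 * e" using i1(3) i2(3) by linarith
      note ibp = integral_mult_grad_bound[OF open_dom d d_i C K(1,2) g0]
      have a3_i: "integrable M (\<lambda>x. \<Sum>j\<in>UNIV. g j x * grad d x $ j)"
        using ibp(1) by (intro Bochner_Integration.integrable_sum)
      have "\<bar>\<integral>x. (\<Sum>j\<in>UNIV. g j x * grad d x $ j) \<partial>M\<bar> \<le> (\<Sum>j\<in>UNIV. \<bar>\<integral>x. g j x * grad d x $ j \<partial>M\<bar>)"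
        using ibp(1) by (subst Bochner_Integration.integral_sum) (auto intro: sum_abs)
      also have "\<dots> \<le> (\<Sum>j\<in>UNIV. C j * (2 * e))"
        using ibp(2) d_le C0 by (intro sum_mono) (meson mult_left_mono order_trans)
      finally have a3: "\<bar>\<integral>x. (\<Sum>j\<in>UNIV. g j x * grad d x $ j) \<partial>M\<bar> \<le> S * (2 * e)"
        by (simp add: S_def sum_distrib_right)
      have ae: "AE x in M. \<theta> x * ((B x *v G1 x) $ k - (B x *v G2 x) $ k) =
          \<theta> x * (B x *v (G1 x - grad v1 x)) $ k - \<theta> x * (B x *v (G2 x - grad v2 x)) $ k
            + (\<Sum>j\<in>UNIV. g j x * grad d x $ j)"
        using locally_lipschitz_AE_differentiable[OF v1(1) open_dom]
          locally_lipschitz_AE_differentiable[OF v2(1) open_dom] AE_space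
      proof eventually_elim
        case (elim x)
        then have "grad d x = grad v1 x - grad v2 x" unfolding d_def by (intro grad_diff)
        then have "(B x *v grad d x) $ k = (B x *v grad v1 x) $ k - (B x *v grad v2 x) $ k"
          by (simp add: matrix_vector_mult_diff_distrib)
        moreover have "(\<Sum>j\<in>UNIV. g j x * grad d x $ j) = \<theta> x * (B x *v grad d x) $ k"
          using elim by (simp add: g_def matrix_vector_mult_def sum_distrib_left mult.assoc)
        ultimately show ?case by (simp add: matrix_vector_mult_diff_distrib right_diff_distrib)
      qed
      have "(\<integral>x. \<theta> x * ((B x *v G1 x) $ k - (B x *v G2 x) $ k) \<partial>M) =
          (\<integral>x. \<theta> x * (B x *v (G1 x - grad v1 x)) $ k - \<theta> x * (B x *v (G2 x - grad v2 x)) $ k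
            + (\<Sum>j\<in>UNIV. g j x * grad d x $ j) \<partial>M)"
        using ae \<theta>_bound(1)[OF BG_i(1)] \<theta>_bound(1)[OF BG_i(2)] \<theta>_bound(1)[OF i1(2)] \<theta>_bound(1)[OF i2(2)] a3_i
        by (intro integral_cong_AE) (auto simp: right_diff_distrib intro!: borel_measurable_diff borel_measurable_add)
      also have "\<dots> = (\<integral>x. \<theta> x * (B x *v (G1 x - grad v1 x)) $ k \<partial>M)
          - (\<integral>x. \<theta> x * (B x *v (G2 x - grad v2 x)) $ k \<partial>M) + (\<integral>x. (\<Sum>j\<in>UNIV. g j x * grad d x $ j) \<partial>M)"
        using \<theta>_bound(1)[OF i1(2)] \<theta>_bound(1)[OF i2(2)] a3_i by simp
      finally have "\<bar>\<integral>x. \<theta> x * ((B x *v G1 x) $ k - (B x *v G2 x) $ k) \<partial>M\<bar>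
          \<le> T * (\<integral>x. norm (B x *v (G1 x - grad v1 x)) \<partial>M) + T * (\<integral>x. norm (B x *v (G2 x - grad v2 x)) \<partial>M) + S * (2 * e)"
        using \<theta>_bound(2)[OF i1(2)] \<theta>_bound(2)[OF i2(2)] a3 by linarith
      also have "\<dots> \<le> T * e + T * e + S * (2 * e)"
        using mult_left_mono[OF i1(4) T(1)] mult_left_mono[OF i2(4) T(1)] by linarith
      finally show ?thesis by (simp add: algebra_simps)
    qed
    show "(\<integral>x. \<theta> x * ((B x *v G1 x) $ k - (B x *v G2 x) $ k) \<partial>M) = 0"
    proof (rule ccontr)
      assume ne: "(\<integral>x. \<theta> x * ((B x *v G1 x) $ k - (B x *v G2 x) $ k) \<partial>M) \<noteq> 0" (is "?I \<noteq> 0")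
      \<comment> \<open>With this \<open>e\<close> the bound is at most half of
        \<open>\<bar>?I\<bar>\<close>; the summand 1 keeps the denominator positive.\<close>
      define e where "e = \<bar>?I\<bar> / (2 * (2 * T + 2 * S + 1))"
      have "e > 0" using ne T \<open>0 \<le> S\<close> by (simp add: e_def)
      have "\<bar>?I\<bar> \<le> (2 * T + 2 * S) * e" using bound[OF \<open>e > 0\<close>] .
      also have "\<dots> \<le> (2 * T + 2 * S + 1) * e" using \<open>e > 0\<close> by (intro mult_right_mono) auto
      also have "\<dots> = \<bar>?I\<bar> / 2" using T \<open>0 \<le> S\<close> by (simp add: e_def field_simps)
      finally show False using ne by simp
    qed
  qed
  then have "AE x in M. \<forall>k. (B x *v G1 x) $ k - (B x *v G2 x) $ k = 0"
    by (subst AE_all_countable) simp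
  then show ?thesis by eventually_elim (simp add: vec_eq_iff)
qed

section \<open>Truncation in the degenerate Sobolev spaces\<close>

text \<open>These levels are the atoms of the distribution of \<open>u\<close>, which is a finite
  measure.\<close>

lemma countable_charged_levels:
  fixes u :: "real^'n \<Rightarrow> real"
  assumes [measurable]: "u \<in> borel_measurable M"
  shows "countable {c. \<not> (AE x in M. u x \<noteq> c)}"
proof -
  interpret N: finite_measure "distr M borel u" by (rule finite_measure_distr) measurable
  have "(AE x in M. u x \<noteq> c) \<longleftrightarrow> measure (distr M borel u) {c} = 0" for c
  proof -
    have "measure (distr M borel u) {c} = measure M (u -` {c} \<inter> space M)"
      by (rule measure_distr) measurable
    moreover have "u -` {c} \<inter> space M = {x \<in> space M. \<not> u x \<noteq> c}" by auto
    moreover have "(AE x in M. u x \<noteq> c) \<longleftrightarrow> emeasure M {x \<in> space M. \<not> u x \<noteq> c} = 0"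
      by (rule AE_iff_measurable[OF _ refl]) measurable
    ultimately show ?thesis by (simp add: emeasure_eq_measure)
  qed
  then show ?thesis using N.countable_support by simp
qed

text \<open>Norm convergence alone does not show on which side of a level the approximants lie; the
  subsequence converging almost everywhere does. It is also what Fatou's lemma needs in the bump
  inequality.\<close>

lemma approximating_sequence:
  assumes P: "\<And>v. P v \<Longrightarrow> locally_lipschitz \<Omega> v" and "p > 0"
    and m: "u \<in> borel_measurable M" "G \<in> borel_measurable M"
    and approx: "\<forall>\<epsilon>>0. \<exists>v. P v \<and> sobolev_energy p B \<Omega> (\<lambda>x. u x - v x) (\<lambda>x. G x - grad v x) < \<epsilon>"
  obtains v where "\<forall>i. P (v i)"
    "(\<lambda>i. sobolev_energy p B \<Omega> (\<lambda>x. u x - v i x) (\<lambda>x. G x - grad (v i) x)) \<longlonglongrightarrow> 0"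
    "AE x in M. (\<lambda>i. v i x) \<longlonglongrightarrow> u x"
proof -
  have "\<forall>i. \<exists>v. P v \<and> sobolev_energy p B \<Omega> (\<lambda>x. u x - v x) (\<lambda>x. G x - grad v x) < ennreal (1 / Suc i)"
    using approx by simp
  then obtain v where v: "\<And>i. P (v i)"
    "\<And>i. sobolev_energy p B \<Omega> (\<lambda>x. u x - v i x) (\<lambda>x. G x - grad (v i) x) < ennreal (1 / Suc i)"
    by metis
  define f where "f i x = \<bar>u x - v i x\<bar> powr p + norm (B x *v (G x - grad (v i) x)) powr p" for i x
  have f0: "0 \<le> f i x" for i x by (simp add: f_def)
  have e: "sobolev_energy p B \<Omega> (\<lambda>x. u x - v i x) (\<lambda>x. G x - grad (v i) x) = (\<integral>\<^sup>+x. f i x \<partial>M)" for i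
    by (simp add: sobolev_energy_def f_def)
  have f_m: "f i \<in> borel_measurable M" for i
  proof -
    have [measurable]: "v i \<in> borel_measurable M" "grad (v i) \<in> borel_measurable M"
      using locally_lipschitz_measurable[OF P[OF v(1)] open_dom] grad_measurable[OF P[OF v(1)] open_dom]
      by blast+
    have [measurable]: "(\<lambda>x. B x *v (G x - grad (v i) x)) \<in> borel_measurable M"
      using m by (intro B_measurable borel_measurable_diff) auto
    show ?thesis unfolding f_def[abs_def] using m by measurable
  qed
  have f_i: "integrable M (f i)" for i
    using v(2)[of i] f_m f0 unfolding e
    by (intro integrableI_bounded) (auto intro: less_trans)
  have f_le: "(\<integral>x. norm (f i x) \<partial>M) \<le> 1 / Suc i" for i
    using v(2)[of i] f0 nn_integral_eq_integral[OF f_i[of i]] unfolding e by (simp add: ennreal_less_iff)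
  have "(\<lambda>i. \<integral>x. norm (f i x) \<partial>M) \<longlonglongrightarrow> 0"
    by (rule tendsto_sandwich[OF _ _ tendsto_const LIMSEQ_inverse_real_of_nat])
      (use f_le in \<open>auto simp: inverse_eq_divide\<close>)
  then obtain r :: "nat \<Rightarrow> nat" where r: "strict_mono r" "AE x in M. (\<lambda>i. f (r i) x) \<longlonglongrightarrow> 0"
    using tendsto_L1_AE_subseq[of M f] f_i by blast
  show thesis
  proof (rule that[of "\<lambda>i. v (r i)"])
    show "\<forall>i. P (v (r i))" using v(1) by blast
    have "(\<lambda>i. ennreal (1 / Suc i)) \<longlonglongrightarrow> 0"
      using tendsto_ennrealI[OF LIMSEQ_inverse_real_of_nat] by (simp add: inverse_eq_divide)
    then have "(\<lambda>i. \<integral>\<^sup>+x. f i x \<partial>M) \<longlonglongrightarrow> 0"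
      by (rule tendsto_sandwich[OF _ _ tendsto_const, rotated 2])
        (use v(2) in \<open>auto simp: e less_imp_le\<close>)
    from LIMSEQ_subseq_LIMSEQ[OF this r(1)]
    show "(\<lambda>i. sobolev_energy p B \<Omega> (\<lambda>x. u x - v (r i) x) (\<lambda>x. G x - grad (v (r i)) x)) \<longlonglongrightarrow> 0"
      by (simp add: e comp_def)
    show "AE x in M. (\<lambda>i. v (r i) x) \<longlonglongrightarrow> u x"
      using r(2)
    proof eventually_elim
      case (elim x)
      have root: "(\<bar>a\<bar> powr p) powr (1 / p) = \<bar>a\<bar>" for a :: real
        using \<open>p > 0\<close> by (simp add: powr_powr)
      have "(\<lambda>i. \<bar>u x - v (r i) x\<bar> powr p) \<longlonglongrightarrow> 0"
        by (rule tendsto_sandwich[OF _ _ tendsto_const elim]) (auto simp: f_def)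
      then have "(\<lambda>i. (\<bar>u x - v (r i) x\<bar> powr p) powr (1 / p)) \<longlonglongrightarrow> 0"
        using \<open>p > 0\<close> by (rule_tac tendsto_zero_powrI[OF _ tendsto_const]) auto
      then have "(\<lambda>i. \<bar>u x - v (r i) x\<bar>) \<longlonglongrightarrow> 0"
        using root by simp
      then have "(\<lambda>i. u x - v (r i) x) \<longlonglongrightarrow> 0" by (simp add: tendsto_rabs_zero_iff)
      then have "(\<lambda>i. u x - (u x - v (r i) x)) \<longlonglongrightarrow> u x - 0" by (intro tendsto_diff tendsto_const)
      then show ?case by simp
    qed
  qed
qed

text \<open>Truncated approximants have the right gradient except where \<open>u\<close> and
  \<open>v i\<close> lie on different sides of \<open>c\<close>. There the error involves the
  A-gradient of \<open>u\<close> itself, and dominated convergence removes it: since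
  \<open>u \<noteq> c\<close> almost everywhere, the two sides eventually agree.\<close>

lemma approximable_truncate:
  assumes P: "\<And>v. P v \<Longrightarrow> locally_lipschitz \<Omega> v" and P_trunc: "\<And>v. P v \<Longrightarrow> P (\<lambda>x. max (v x - c) 0)"
    and m: "u \<in> borel_measurable M" "G \<in> borel_measurable M"
    and fin: "sobolev_energy 2 B \<Omega> u G < \<infinity>"
    and level: "AE x in M. u x \<noteq> c"
    and approx: "\<forall>\<epsilon>>0. \<exists>v. P v \<and> sobolev_energy 2 B \<Omega> (\<lambda>x. u x - v x) (\<lambda>x. G x - grad v x) < \<epsilon>"
  shows "\<forall>\<epsilon>>0. \<exists>v. P v \<and> sobolev_energy 2 B \<Omega> (\<lambda>x. max (u x - c) 0 - v x)
           (\<lambda>x. (if u x > c then G x else 0) - grad v x) < \<epsilon>"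
proof -
  obtain v where v: "\<forall>i. P (v i)"
    "(\<lambda>i. sobolev_energy 2 B \<Omega> (\<lambda>x. u x - v i x) (\<lambda>x. G x - grad (v i) x)) \<longlonglongrightarrow> 0"
    "AE x in M. (\<lambda>i. v i x) \<longlonglongrightarrow> u x"
    by (rule approximating_sequence[OF P _ m approx]) auto
  have v_m [measurable]: "v i \<in> borel_measurable M" "grad (v i) \<in> borel_measurable M" for i
    using locally_lipschitz_measurable[OF P[OF v(1)[rule_format]] open_dom]
      grad_measurable[OF P[OF v(1)[rule_format]] open_dom] by blast+
  note m [measurable]
  have BG [measurable]: "(\<lambda>x. B x *v G x) \<in> borel_measurable M" by (rule B_measurable) fact
  have BD: "(\<lambda>x. B x *v (G x - grad (v i) x)) \<in> borel_measurable M" for i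
    using m v_m by (intro B_measurable borel_measurable_diff)
  define b where "b x = (norm (B x *v G x))\<^sup>2" for x
  \<comment> \<open>The price of a mismatch of sides, dominated by the integrable function
    \<open>b\<close>.\<close>
  define s where "s i x = (if (u x > c) \<noteq> (v i x > c) then b x else 0)" for i x
  have b_fin: "(\<integral>\<^sup>+x. b x \<partial>M) < \<infinity>"
    using fin unfolding energy_2 b_def
    by (rule le_less_trans[rotated]) (intro nn_integral_mono ennreal_leI; simp)
  have s_m [measurable]: "s i \<in> borel_measurable M" for i unfolding s_def b_def by measurable
  have s_lim: "(\<lambda>i. \<integral>\<^sup>+x. s i x \<partial>M) \<longlonglongrightarrow> (\<integral>\<^sup>+x. 0 \<partial>M)"
  proof (rule nn_integral_dominated_convergence[where w = b])
    show "(\<lambda>x. ennreal (s i x)) \<in> borel_measurable M" for i by measurable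
    show "AE x in M. ennreal (s i x) \<le> ennreal (b x)" for i
      by (intro AE_I2 ennreal_leI) (simp add: s_def b_def)
    show "AE x in M. (\<lambda>i. ennreal (s i x)) \<longlonglongrightarrow> 0"
      using v(3) level
    proof eventually_elim
      case (elim x)
      have "\<forall>\<^sub>F i in sequentially. s i x = 0"
      proof (cases "u x > c")
        case True
        show ?thesis using order_tendstoD(1)[OF elim(1) True] by eventually_elim (simp add: s_def True)
      next
        case False
        then have less: "u x < c" using elim by simp
        show ?thesis using order_tendstoD(2)[OF elim(1) less] by eventually_elim (use False in \<open>simp add: s_def\<close>)
      qed
      then have "\<forall>\<^sub>F i in sequentially. ennreal (s i x) = 0" by eventually_elim simp
      then show ?case by (rule tendsto_eventually)
    qed
    show "(\<lambda>x. ennreal (b x)) \<in> borel_measurable M" unfolding b_def by measurable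
  qed (use b_fin in auto)
  have two: "2 * ennreal a + 2 * ennreal d = ennreal (2 * a + 2 * d)" if "0 \<le> a" "0 \<le> d" for a d
    using that by (simp add: ennreal_plus[symmetric] ennreal_numeral[symmetric] ennreal_mult'[symmetric] del: ennreal_plus ennreal_numeral)
  let ?e = "\<lambda>i. sobolev_energy 2 B \<Omega> (\<lambda>x. u x - v i x) (\<lambda>x. G x - grad (v i) x)"
  have le: "sobolev_energy 2 B \<Omega> (\<lambda>x. max (u x - c) 0 - max (v i x - c) 0)
      (\<lambda>x. (if u x > c then G x else 0) - grad (\<lambda>x. max (v i x - c) 0) x)
      \<le> 2 * ?e i + 2 * (\<integral>\<^sup>+x. s i x \<partial>M)" for i
  proof -
    let ?f = "\<lambda>x. (u x - v i x)\<^sup>2 + (norm (B x *v (G x - grad (v i) x)))\<^sup>2"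
    have "sobolev_energy 2 B \<Omega> (\<lambda>x. max (u x - c) 0 - max (v i x - c) 0)
      (\<lambda>x. (if u x > c then G x else 0) - grad (\<lambda>x. max (v i x - c) 0) x)
      \<le> (\<integral>\<^sup>+x. 2 * ennreal (?f x) + 2 * ennreal (s i x) \<partial>M)"
      unfolding energy_2
    proof (rule nn_integral_mono)
      fix x assume "x \<in> space M"
      then have "x \<in> \<Omega>" by simp
      then have "isCont (v i) x"
        using locally_lipschitz_continuous_on[OF P open_dom] v(1) open_dom continuous_on_eq_continuous_at by blast
      then have g: "grad (\<lambda>x. max (v i x - c) 0) x = (if v i x > c then grad (v i) x else 0)"
        by (rule grad_truncate)
      have 1: "(max (u x - c) 0 - max (v i x - c) 0)\<^sup>2 \<le> (u x - v i x)\<^sup>2"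
        by (rule iffD1[OF abs_le_square_iff]) linarith
      let ?d = "B x *v (G x - grad (v i) x)"
      have 2: "(norm (B x *v ((if u x > c then G x else 0) - (if v i x > c then grad (v i) x else 0))))\<^sup>2
          \<le> 2 * (norm ?d)\<^sup>2 + 2 * s i x"
      proof -
        have sq: "(norm (a + c))\<^sup>2 \<le> 2 * (norm a)\<^sup>2 + 2 * (norm c)\<^sup>2" for a c :: "real^'n"
        proof -
          have "(norm (a + c))\<^sup>2 \<le> (norm a + norm c)\<^sup>2" by (intro power_mono norm_triangle_ineq) auto
          also have "\<dots> \<le> 2 * (norm a)\<^sup>2 + 2 * (norm c)\<^sup>2"
            using sum_squares_bound[of "norm a" "norm c"] by (simp add: power2_sum)
          finally show ?thesis .
        qed
        \<comment> \<open>When only \<open>v i\<close> exceeds \<open>c\<close>, its gradient is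
          left over and is bounded through the gradient of \<open>u\<close>, so that this mismatch
          too is paid for by \<open>s i\<close>.\<close>
        have d: "B x *v (- grad (v i) x) = ?d + - (B x *v G x)"
          using matrix_vector_mult_diff_distrib[of "B x" 0 "grad (v i) x"]
          by (simp add: matrix_vector_mult_diff_distrib)
        show ?thesis
          using sq[of ?d "- (B x *v G x)"] d
          by (cases "u x > c"; cases "v i x > c") (auto simp: s_def b_def)
      qed
      have "(max (u x - c) 0 - max (v i x - c) 0)\<^sup>2
          + (norm (B x *v ((if u x > c then G x else 0) - grad (\<lambda>x. max (v i x - c) 0) x)))\<^sup>2
          \<le> 2 * ?f x + 2 * s i x"
        unfolding g by (rule order_trans[OF add_mono[OF 1 2]]) (simp add: distrib_left)
      moreover have "2 * ennreal (?f x) + 2 * ennreal (s i x) = ennreal (2 * ?f x + 2 * s i x)"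
        by (rule two) (auto simp: s_def b_def)
      ultimately show "ennreal ((max (u x - c) 0 - max (v i x - c) 0)\<^sup>2
          + (norm (B x *v ((if u x > c then G x else 0) - grad (\<lambda>x. max (v i x - c) 0) x)))\<^sup>2)
          \<le> 2 * ennreal (?f x) + 2 * ennreal (s i x)"
        by (simp only: ennreal_leI)
    qed
    also have "\<dots> = (\<integral>\<^sup>+x. 2 * ennreal (?f x) \<partial>M) + (\<integral>\<^sup>+x. 2 * ennreal (s i x) \<partial>M)"
      using BD[of i] by (intro nn_integral_add) auto
    also have "\<dots> = 2 * ?e i + 2 * (\<integral>\<^sup>+x. s i x \<partial>M)"
      using BD[of i] by (subst (1 2) nn_integral_cmult) (auto simp: energy_2)
    finally show ?thesis .
  qed
  have "(\<lambda>i. 2 * ?e i + 2 * (\<integral>\<^sup>+x. s i x \<partial>M)) \<longlonglongrightarrow> 2 * 0 + 2 * 0"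
    using v(2) s_lim by (intro tendsto_add ennreal_tendsto_cmult) auto
  then have lim: "(\<lambda>i. 2 * ?e i + 2 * (\<integral>\<^sup>+x. s i x \<partial>M)) \<longlonglongrightarrow> 0" by simp
  show ?thesis
  proof (intro allI impI)
    fix \<epsilon> :: ennreal assume "\<epsilon> > 0"
    from order_tendstoD(2)[OF lim this] obtain i where "2 * ?e i + 2 * (\<integral>\<^sup>+x. s i x \<partial>M) < \<epsilon>"
      by (auto simp: eventually_sequentially)
    then show "\<exists>v. P v \<and> sobolev_energy 2 B \<Omega> (\<lambda>x. max (u x - c) 0 - v x)
           (\<lambda>x. (if u x > c then G x else 0) - grad v x) < \<epsilon>"
      using le[of i] P_trunc v(1) by (intro exI[of _ "\<lambda>x. max (v i x - c) 0"]) auto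
  qed
qed

lemma sobolev_grad_truncate:
  assumes "sobolev_grad 2 B \<Omega> u G" and "AE x in M. u x \<noteq> c"
  shows "sobolev_grad 2 B \<Omega> (\<lambda>x. max (u x - c) 0) (\<lambda>x. if u x > c then G x else 0)"
proof -
  have m [measurable]: "u \<in> borel_measurable M" "G \<in> borel_measurable M"
    and fin: "sobolev_energy 2 B \<Omega> u G < \<infinity>"
    and approx: "\<forall>\<epsilon>>0. \<exists>v. locally_lipschitz \<Omega> v \<and> sobolev_energy 2 B \<Omega> (\<lambda>x. u x - v x) (\<lambda>x. G x - grad v x) < \<epsilon>"
    using assms unfolding sobolev_grad_def by auto
  have "sobolev_energy 2 B \<Omega> (\<lambda>x. max (u x - c) 0) (\<lambda>x. if u x > c then G x else 0)
      \<le> (\<integral>\<^sup>+x. 2 * ennreal ((u x)\<^sup>2 + (norm (B x *v G x))\<^sup>2) + ennreal (2 * c\<^sup>2) \<partial>M)"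
    unfolding energy_2
  proof (rule nn_integral_mono)
    fix x
    have "(max (u x - c) 0)\<^sup>2 \<le> (\<bar>u x\<bar> + \<bar>c\<bar>)\<^sup>2" by (intro power_mono) auto
    also have "\<dots> \<le> 2 * (u x)\<^sup>2 + 2 * c\<^sup>2"
      using sum_squares_bound[of "\<bar>u x\<bar>" "\<bar>c\<bar>"] by (simp add: power2_sum)
    finally have "(max (u x - c) 0)\<^sup>2 \<le> 2 * (u x)\<^sup>2 + 2 * c\<^sup>2" .
    moreover have "(norm (B x *v (if u x > c then G x else 0)))\<^sup>2 \<le> 2 * (norm (B x *v G x))\<^sup>2"
      by simp
    ultimately have "(max (u x - c) 0)\<^sup>2 + (norm (B x *v (if u x > c then G x else 0)))\<^sup>2
        \<le> 2 * ((u x)\<^sup>2 + (norm (B x *v G x))\<^sup>2) + 2 * c\<^sup>2"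
      by argo
    moreover have "2 * ennreal ((u x)\<^sup>2 + (norm (B x *v G x))\<^sup>2) + ennreal (2 * c\<^sup>2)
        = ennreal (2 * ((u x)\<^sup>2 + (norm (B x *v G x))\<^sup>2) + 2 * c\<^sup>2)"
      by (simp add: ennreal_plus[symmetric] ennreal_numeral[symmetric] ennreal_mult'[symmetric] del: ennreal_plus ennreal_numeral)
    ultimately show "ennreal ((max (u x - c) 0)\<^sup>2 + (norm (B x *v (if u x > c then G x else 0)))\<^sup>2)
        \<le> 2 * ennreal ((u x)\<^sup>2 + (norm (B x *v G x))\<^sup>2) + ennreal (2 * c\<^sup>2)"
      by (simp only: ennreal_leI)
  qed
  also have "\<dots> = 2 * sobolev_energy 2 B \<Omega> u G + ennreal (2 * c\<^sup>2) * emeasure M (space M)"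
    using B_measurable[OF m(2)] by (simp add: nn_integral_add nn_integral_cmult energy_2)
  also have "\<dots> < \<infinity>" using fin by (simp add: ennreal_mult_less_top emeasure_eq_measure)
  finally show ?thesis
    using approximable_truncate[OF _ locally_lipschitz_truncate m fin assms(2) approx]
    unfolding sobolev_grad_def by simp
qed

lemma sobolev_grad_0_truncate:
  assumes "sobolev_grad_0 2 B \<Omega> w H" and "AE x in M. w x \<noteq> c" and "0 \<le> c"
  shows "sobolev_grad_0 2 B \<Omega> (\<lambda>x. max (w x - c) 0) (\<lambda>x. if w x > c then H x else 0)"
proof -
  have w: "sobolev_grad 2 B \<Omega> w H"
    and approx: "\<forall>\<epsilon>>0. \<exists>v. lipschitz_compact_support \<Omega> v \<and> sobolev_energy 2 B \<Omega> (\<lambda>x. w x - v x) (\<lambda>x. H x - grad v x) < \<epsilon>"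
    using assms unfolding sobolev_grad_0_def by auto
  then have m: "w \<in> borel_measurable M" "H \<in> borel_measurable M" "sobolev_energy 2 B \<Omega> w H < \<infinity>"
    unfolding sobolev_grad_def by auto
  show ?thesis
    using sobolev_grad_truncate[OF w assms(2)]
      approximable_truncate[OF lipschitz_compact_support_imp_locally_lipschitz
        lipschitz_compact_support_truncate[OF _ assms(3)] m assms(2) approx]
    unfolding sobolev_grad_0_def by simp
qed

end

section \<open>Energy estimate on superlevel sets\<close>

text \<open>A null vector of the form minimises it, so moving from \<open>z\<close> against
  \<open>a *v z\<close> cannot make it negative. This is how mixed gradient fields can be exchanged
  when their difference lies in the kernel of \<open>B\<close>.\<close>

lemma psd_kernel:
  fixes a :: "real^'n^'n"
  assumes psd: "nonneg_semidefinite a" and z: "z \<bullet> (a *v z) = 0"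
  shows "a *v z = 0"
proof -
  have sym: "x \<bullet> (a *v y) = y \<bullet> (a *v x)" for x y
    using psd unfolding nonneg_semidefinite_def
    by (metis dot_lmul_matrix inner_commute transpose_matrix_vector)
  define p where "p = (a *v z) \<bullet> (a *v z)"
  define q where "q = (a *v z) \<bullet> (a *v (a *v z))"
  \<comment> \<open>The minimiser would be \<open>p / q\<close>, but \<open>q\<close> may vanish;
    with \<open>q + 1\<close> the form still becomes \<open>- (t^2 * (q + 2))\<close>.\<close>
  define t where "t = p / (q + 1)"
  have "0 \<le> q" using psd by (simp add: q_def nonneg_semidefinite_def)
  have "0 \<le> (z - t *\<^sub>R (a *v z)) \<bullet> (a *v (z - t *\<^sub>R (a *v z)))"
    using psd by (simp add: nonneg_semidefinite_def)
  also have "\<dots> = t\<^sup>2 * q - 2 * t * p"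
    using sym[of "a *v z" z] z
    by (simp add: matrix_vector_mult_diff_distrib matrix_vector_mult_scaleR inner_diff_left inner_diff_right
        p_def q_def power2_eq_square algebra_simps)
  also have "\<dots> = - (t\<^sup>2 * (q + 2))"
  proof -
    have "p = t * (q + 1)" using \<open>0 \<le> q\<close> by (simp add: t_def)
    then show ?thesis by (simp add: power2_eq_square algebra_simps)
  qed
  finally have "t\<^sup>2 * (q + 2) \<le> 0" by simp
  then have "t = 0" using \<open>0 \<le> q\<close> by (auto simp: mult_le_0_iff)
  then have "p = 0" using \<open>0 \<le> q\<close> by (simp add: t_def)
  then show ?thesis by (simp add: p_def)
qed

lemma inner_gram_matrix:
  fixes B :: "real^'n^'n"
  shows "\<xi> \<bullet> ((transpose B ** B) *v \<xi>) = (norm (B *v \<xi>))\<^sup>2"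
proof -
  have "\<xi> \<bullet> (transpose B *v (B *v \<xi>)) = (B *v \<xi>) \<bullet> (B *v \<xi>)"
    by (simp add: transpose_matrix_vector dot_lmul_matrix inner_commute[of \<xi>])
  then show ?thesis by (simp add: matrix_vector_mul_assoc[symmetric] power2_norm_eq_inner)
qed

text \<open>For \<open>b = 0\<close> a positive numerator would make the quotient infinite, which
  the finite bound \<open>x\<close> forbids.\<close>

lemma ennreal_le_mult_of_divide_le:
  fixes a b x :: ennreal
  assumes "a / b \<le> x" "x < \<infinity>" "b < \<infinity>"
  shows "a \<le> x * b"
proof (cases "b = 0")
  case True
  then have "a = 0" using assms(1,2) by (cases "a = 0") (auto simp: divide_ennreal_def ennreal_mult_top)
  then show ?thesis by simp
next
  case False
  then have "a = a * b / b" using assms(3) by (simp add: mult_divide_eq_ennreal)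
  also have "\<dots> = a / b * b" by (metis ennreal_times_divide mult.commute)
  also have "\<dots> \<le> x * b" using assms(1) by (rule mult_right_mono) simp
  finally show ?thesis .
qed

context degenerate_domain
begin

text \<open>Fatou's lemma carries the inequality from compactly supported Lipschitz functions to the
  closure. It is phrased through the modular at a strictly larger \<kappa>: the approximants
  eventually have norm below \<kappa>, and whether the infimum in the Luxemburg norm is attained
  never matters. \<open>max C\<^sub>0 0\<close> mirrors the truncation of negative reals in
  \<open>ennreal C\<^sub>0\<close>.\<close>

lemma orlicz_bump_sobolev_0:
  assumes bump: "orlicz_sobolev_bump \<Phi> B \<Omega> C\<^sub>0"
    and \<Phi>: "mono \<Phi>" "continuous_on UNIV \<Phi>"
    and w: "sobolev_grad_0 1 B \<Omega> w H"
    and \<kappa>: "max C\<^sub>0 0 * (\<integral>x. norm (B x *v H x) \<partial>M) < \<kappa>"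
  shows "(\<integral>\<^sup>+x. ennreal (\<Phi> (\<bar>w x\<bar> / \<kappa>)) \<partial>M) \<le> 1"
proof -
  define C where "C = max C\<^sub>0 0"
  define y where "y = (\<integral>x. norm (B x *v H x) \<partial>M)"
  have "0 \<le> C" "0 \<le> y" by (auto simp: C_def y_def)
  then have "0 \<le> C * y" by simp
  then have "0 < \<kappa>" using \<kappa> unfolding C_def y_def by linarith
  have m: "w \<in> borel_measurable M" "H \<in> borel_measurable M"
    and fin: "sobolev_energy 1 B \<Omega> w H < \<infinity>"
    and approx: "\<forall>\<epsilon>>0. \<exists>v. lipschitz_compact_support \<Omega> v \<and> sobolev_energy 1 B \<Omega> (\<lambda>x. w x - v x) (\<lambda>x. H x - grad v x) < \<epsilon>"
    using w unfolding sobolev_grad_0_def sobolev_grad_def by auto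
  obtain v where v: "\<forall>i. lipschitz_compact_support \<Omega> (v i)"
    "(\<lambda>i. sobolev_energy 1 B \<Omega> (\<lambda>x. w x - v i x) (\<lambda>x. H x - grad (v i) x)) \<longlonglongrightarrow> 0"
    "AE x in M. (\<lambda>i. v i x) \<longlonglongrightarrow> w x"
    by (rule approximating_sequence[OF lipschitz_compact_support_imp_locally_lipschitz _ m approx]) auto
  note lip = lipschitz_compact_support_imp_locally_lipschitz[OF v(1)[rule_format]]
  have v_m [measurable]: "v i \<in> borel_measurable M" and gv_m: "grad (v i) \<in> borel_measurable M" for i
    using locally_lipschitz_measurable[OF lip open_dom] grad_measurable[OF lip open_dom] by blast+
  have BH_m: "(\<lambda>x. B x *v H x) \<in> borel_measurable M" by (rule B_measurable) fact
  have y: "(\<integral>\<^sup>+x. ennreal (norm (B x *v H x)) \<partial>M) = ennreal y"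
  proof -
    have "(\<integral>\<^sup>+x. ennreal (norm (B x *v H x)) \<partial>M) < \<infinity>"
      using fin unfolding energy_1[OF m] by (simp add: less_top[symmetric])
    then have "integrable M (\<lambda>x. B x *v H x)" using BH_m by (intro integrableI_bounded)
    then show ?thesis unfolding y_def by (intro nn_integral_eq_integral) auto
  qed
  let ?e = "\<lambda>i. sobolev_energy 1 B \<Omega> (\<lambda>x. w x - v i x) (\<lambda>x. H x - grad (v i) x)"
  have grad_le: "(\<integral>\<^sup>+x. ennreal (norm (B x *v grad (v i) x)) \<partial>M) \<le> ennreal y + ?e i" for i
  proof -
    have [measurable]: "(\<lambda>x. B x *v (H x - grad (v i) x)) \<in> borel_measurable M"
      using m gv_m by (intro B_measurable borel_measurable_diff)
    note BH_m [measurable]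
    have "(\<integral>\<^sup>+x. ennreal (norm (B x *v grad (v i) x)) \<partial>M)
        \<le> (\<integral>\<^sup>+x. ennreal (norm (B x *v H x)) + ennreal (norm (B x *v (H x - grad (v i) x))) \<partial>M)"
    proof (rule nn_integral_mono)
      fix x
      have "norm (B x *v grad (v i) x) \<le> norm (B x *v H x) + norm (B x *v (H x - grad (v i) x))"
        using norm_triangle_ineq4[of "B x *v H x" "B x *v (H x - grad (v i) x)"]
        by (simp add: matrix_vector_mult_diff_distrib)
      then show "ennreal (norm (B x *v grad (v i) x))
          \<le> ennreal (norm (B x *v H x)) + ennreal (norm (B x *v (H x - grad (v i) x)))"
        by (simp add: ennreal_plus[symmetric] del: ennreal_plus)
    qed
    also have "\<dots> = ennreal y + (\<integral>\<^sup>+x. ennreal (norm (B x *v (H x - grad (v i) x))) \<partial>M)"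
      by (subst nn_integral_add) (auto simp: y)
    also have "\<dots> \<le> ennreal y + ?e i"
      using m gv_m v_m by (subst energy_1) (auto intro!: add_left_mono)
    finally show ?thesis .
  qed
  have "(\<lambda>i. ennreal C * (ennreal y + ?e i)) \<longlonglongrightarrow> ennreal C * (ennreal y + 0)"
    using v(2) by (intro ennreal_tendsto_cmult tendsto_add tendsto_const) auto
  moreover have "ennreal C * (ennreal y + 0) < ennreal \<kappa>"
    using \<kappa> \<open>0 \<le> C\<close> \<open>0 \<le> y\<close> by (simp add: ennreal_mult'[symmetric] C_def y_def ennreal_lessI \<open>0 < \<kappa>\<close>)
  ultimately have ev: "\<forall>\<^sub>F i in sequentially. ennreal C * (ennreal y + ?e i) < ennreal \<kappa>"
    by (rule order_tendstoD(2))
  have [measurable]: "\<Phi> \<in> borel_measurable borel" using \<Phi>(1) by (rule borel_measurable_mono)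
  have le1: "(\<integral>\<^sup>+x. ennreal (\<Phi> (\<bar>v i x\<bar> / \<kappa>)) \<partial>M) \<le> 1"
    if less: "ennreal C * (ennreal y + ?e i) < ennreal \<kappa>" for i
  proof -
    have "orlicz_norm \<Phi> \<Omega> (v i) \<le> ennreal C\<^sub>0 * (\<integral>\<^sup>+x. ennreal (norm (B x *v grad (v i) x)) \<partial>M)"
      using bump v(1) unfolding orlicz_sobolev_bump_def by blast
    also have "\<dots> \<le> ennreal C * (ennreal y + ?e i)"
      using grad_le by (intro mult_mono ennreal_leI) (auto simp: C_def)
    finally have "orlicz_norm \<Phi> \<Omega> (v i) < ennreal \<kappa>" using less by (rule le_less_trans)
    \<comment> \<open>Some admissible \<open>k\<close> below \<kappa> exists by the definition of
      the infimum; enlarging it to \<kappa> only decreases the modular.\<close>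
    then obtain k where k: "k > 0" "(\<integral>\<^sup>+x. ennreal (\<Phi> (\<bar>v i x\<bar> / k)) \<partial>M) \<le> 1" "ennreal k < ennreal \<kappa>"
      unfolding orlicz_norm_def Inf_less_iff by auto
    then have "k \<le> \<kappa>" by (simp add: ennreal_less_iff)
    have "(\<integral>\<^sup>+x. ennreal (\<Phi> (\<bar>v i x\<bar> / \<kappa>)) \<partial>M) \<le> (\<integral>\<^sup>+x. ennreal (\<Phi> (\<bar>v i x\<bar> / k)) \<partial>M)"
      using k(1) \<open>k \<le> \<kappa>\<close> by (intro nn_integral_mono ennreal_leI monoD[OF \<Phi>(1)] divide_left_mono) auto
    then show ?thesis using k(2) by (rule order_trans)
  qed
  have "(\<integral>\<^sup>+x. ennreal (\<Phi> (\<bar>w x\<bar> / \<kappa>)) \<partial>M) = (\<integral>\<^sup>+x. liminf (\<lambda>i. ennreal (\<Phi> (\<bar>v i x\<bar> / \<kappa>))) \<partial>M)"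
  proof (rule nn_integral_cong_AE)
    show "AE x in M. ennreal (\<Phi> (\<bar>w x\<bar> / \<kappa>)) = liminf (\<lambda>i. ennreal (\<Phi> (\<bar>v i x\<bar> / \<kappa>)))"
      using v(3)
    proof eventually_elim
      case (elim x)
      have "(\<lambda>i. \<bar>v i x\<bar> / \<kappa>) \<longlonglongrightarrow> \<bar>w x\<bar> / \<kappa>"
        using elim \<open>0 < \<kappa>\<close> by (intro tendsto_divide tendsto_rabs tendsto_const) auto
      then have "(\<lambda>i. \<Phi> (\<bar>v i x\<bar> / \<kappa>)) \<longlonglongrightarrow> \<Phi> (\<bar>w x\<bar> / \<kappa>)"
        using \<Phi>(2) by (intro isCont_tendsto_compose[of _ \<Phi>]) (auto simp: continuous_on_eq_continuous_at)
      then have "(\<lambda>i. ennreal (\<Phi> (\<bar>v i x\<bar> / \<kappa>))) \<longlonglongrightarrow> ennreal (\<Phi> (\<bar>w x\<bar> / \<kappa>))"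
        by (rule tendsto_ennrealI)
      then show ?case by (intro lim_imp_Liminf[symmetric]) auto
    qed
  qed
  also have "\<dots> \<le> liminf (\<lambda>i. \<integral>\<^sup>+x. ennreal (\<Phi> (\<bar>v i x\<bar> / \<kappa>)) \<partial>M)"
    by (rule nn_integral_liminf) measurable
  also have "\<dots> \<le> 1"
  proof (rule Liminf_le)
    show "\<forall>\<^sub>F i in sequentially. (\<integral>\<^sup>+x. ennreal (\<Phi> (\<bar>v i x\<bar> / \<kappa>)) \<partial>M) \<le> 1"
      using ev by eventually_elim (rule le1)
  qed simp
  finally show ?thesis .
qed

text \<open>The real number \<open>X\<close> only bounds the norm from above, so that a positive
  value is available even when the norm is 0.\<close>

lemma X_norm_bound:
  assumes adm: "A_admissible B \<Omega> \<phi>" and v: "sobolev_grad_0 1 B \<Omega> v G"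
    and X: "X_norm B \<Omega> \<phi> \<le> ennreal X" "0 \<le> X"
  shows "integrable M (\<lambda>x. \<phi> x * v x)"
    and "(\<integral>x. \<bar>\<phi> x * v x\<bar> \<partial>M) \<le> X * (\<integral>x. norm (B x *v G x) \<partial>M)"
proof -
  have m [measurable]: "v \<in> borel_measurable M" "G \<in> borel_measurable M" "\<phi> \<in> borel_measurable M"
    and fin: "sobolev_energy 1 B \<Omega> v G < \<infinity>"
    using v adm unfolding sobolev_grad_0_def sobolev_grad_def A_admissible_def by auto
  have BG_m [measurable]: "(\<lambda>x. B x *v G x) \<in> borel_measurable M" by (rule B_measurable) fact
  let ?a = "\<integral>\<^sup>+x. ennreal \<bar>v x * \<phi> x\<bar> \<partial>M" and ?b = "\<integral>\<^sup>+x. ennreal (norm (B x *v G x)) \<partial>M"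
  have b_fin: "?b < \<infinity>" using fin unfolding energy_1[OF m(1,2)] by (simp add: less_top[symmetric])
  then have "integrable M (\<lambda>x. B x *v G x)" using BG_m by (intro integrableI_bounded)
  then have b: "?b = ennreal (\<integral>x. norm (B x *v G x) \<partial>M)" by (intro nn_integral_eq_integral) auto
  have "?a / ?b \<le> X_norm B \<Omega> \<phi>"
    unfolding X_norm_def using v by (intro SUP_upper2[of "(v, G)"]) auto
  then have "?a / ?b \<le> ennreal X" using X(1) by (rule order_trans)
  then have "?a \<le> ennreal X * ?b" using b_fin by (intro ennreal_le_mult_of_divide_le) auto
  then have a: "?a \<le> ennreal (X * (\<integral>x. norm (B x *v G x) \<partial>M))"
    using X(2) by (simp add: b ennreal_mult')
  show i: "integrable M (\<lambda>x. \<phi> x * v x)"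
    using le_less_trans[OF a ennreal_less_top]
    by (intro integrableI_bounded) (auto simp: mult.commute)
  have "?a = ennreal (\<integral>x. \<bar>\<phi> x * v x\<bar> \<partial>M)"
    using i by (subst nn_integral_eq_integral[symmetric]) (auto simp: mult.commute)
  then show "(\<integral>x. \<bar>\<phi> x * v x\<bar> \<partial>M) \<le> X * (\<integral>x. norm (B x *v G x) \<partial>M)"
    using a X(2) by (simp add: ennreal_le_iff)
qed

text \<open>Testing with \<open>(u - m)\<^sup>+\<close>, whose A-gradient \<open>B H\<close> agrees with \<open>B G\<close> where \<open>u > m\<close>,
  and using the definition of the norm of \<open>\<phi>\<close> give \<open>k \<integral>|B H|\<^sup>2 \<le> X \<integral>|B H|\<close>; Young's inequality
  on \<open>{u > m}\<close> then yields the estimate.\<close>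

lemma superlevel_energy_bound:
  fixes \<A> :: "real^'n \<Rightarrow> real \<Rightarrow> real^'n^'n"
  assumes sub: "weak_subsolution B \<A> \<Omega> \<phi> u"
    and psd: "\<forall>x\<in>\<Omega>. \<forall>z. nonneg_semidefinite (\<A> x z)"
    and ell: "AE x in M. \<forall>z \<xi>. k * (norm (B x *v \<xi>))\<^sup>2 \<le> \<xi> \<bullet> (\<A> x z *v \<xi>) \<and>
        \<xi> \<bullet> (\<A> x z *v \<xi>) \<le> K * (norm (B x *v \<xi>))\<^sup>2"
    and \<A>_m: "(\<lambda>x. \<A> x (u x)) \<in> borel_measurable M"
    and adm: "A_admissible B \<Omega> \<phi>" and X: "X_norm B \<Omega> \<phi> \<le> ennreal X" "0 < X"
    and "k > 0"
    and w: "sobolev_grad_0 2 B \<Omega> (\<lambda>x. max (u x - l) 0) H"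
    and "l < m" and level: "AE x in M. u x \<noteq> m"
  shows "sobolev_grad_0 1 B \<Omega> (\<lambda>x. max (u x - m) 0) (\<lambda>x. if u x > m then H x else 0)"
    and "(\<integral>x. norm (B x *v (if u x > m then H x else 0)) \<partial>M) \<le> X / k * measure M {x \<in> space M. u x > m}"
proof -
  obtain G where uG: "sobolev_grad 2 B \<Omega> u G" using sub unfolding weak_subsolution_def sobolev_def by auto
  define w' where "w' x = max (u x - m) 0" for x
  define H' where "H' x = (if u x > m then H x else 0)" for x
  have wm: "sobolev_grad_0 2 B \<Omega> w' H'"
  proof -
    \<comment> \<open>Truncating \<open>(u - l)^+\<close> once more at the positive height
      \<open>m - l\<close> gives \<open>(u - m)^+\<close> together with its zero boundary values and
      the field \<open>H\<close>.\<close>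
    have "AE x in M. max (u x - l) 0 \<noteq> m - l"
      using level by eventually_elim (use \<open>l < m\<close> in auto)
    from sobolev_grad_0_truncate[OF w this] \<open>l < m\<close>
    have "sobolev_grad_0 2 B \<Omega> (\<lambda>x. max (max (u x - l) 0 - (m - l)) 0)
        (\<lambda>x. if max (u x - l) 0 > m - l then H x else 0)" by simp
    moreover have "max (max (u x - l) 0 - (m - l)) 0 = w' x" for x
      using \<open>l < m\<close> by (simp add: w'_def max_def)
    moreover have "max (u x - l) 0 > m - l \<longleftrightarrow> u x > m" for x
      using \<open>l < m\<close> by (auto simp: max_def)
    ultimately show ?thesis by (simp add: H'_def[abs_def])
  qed
  have wm1: "sobolev_grad_0 1 B \<Omega> w' H'" using wm by (rule sobolev_grad_0_2_imp_1)
  then show "sobolev_grad_0 1 B \<Omega> (\<lambda>x. max (u x - m) 0) (\<lambda>x. if u x > m then H x else 0)"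
    unfolding w'_def[abs_def] H'_def[abs_def] .
  have "sobolev_grad 2 B \<Omega> w' (\<lambda>x. if u x > m then G x else 0)"
    using sobolev_grad_truncate[OF uG level] unfolding w'_def[abs_def] .
  then have BG: "AE x in M. B x *v H' x = B x *v (if u x > m then G x else 0)"
    using A_gradient_unique[of w'] sobolev_grad_2_imp_1 wm1 unfolding sobolev_grad_0_def by blast
  have m: "u \<in> borel_measurable M" "G \<in> borel_measurable M" "H' \<in> borel_measurable M" "w' \<in> borel_measurable M"
    and fin: "sobolev_energy 2 B \<Omega> w' H' < \<infinity>"
    using uG wm unfolding sobolev_grad_0_def sobolev_grad_def by auto
  note m(1,3,4) [measurable]
  have BH_m [measurable]: "(\<lambda>x. B x *v H' x) \<in> borel_measurable M" by (rule B_measurable) fact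
  have BH2_i: "integrable M (\<lambda>x. (norm (B x *v H' x))\<^sup>2)"
  proof (rule integrableI_bounded)
    have "(\<integral>\<^sup>+x. ennreal (norm ((norm (B x *v H' x))\<^sup>2)) \<partial>M) \<le> sobolev_energy 2 B \<Omega> w' H'"
      unfolding energy_2 by (intro nn_integral_mono ennreal_leI) simp
    then show "(\<integral>\<^sup>+x. ennreal (norm ((norm (B x *v H' x))\<^sup>2)) \<partial>M) < \<infinity>" using fin by (rule le_less_trans)
  qed measurable
  define F where "F x = H' x \<bullet> (\<A> x (u x) *v G x)" for x
  have F_m: "F \<in> borel_measurable M"
  proof -
    have "(\<lambda>x. \<A> x (u x) \<bullet> axis i (axis j 1)) \<in> borel_measurable M" for i j
      using \<A>_m by measurable
    then have [measurable]: "(\<lambda>x. \<A> x (u x) $ i $ j) \<in> borel_measurable M" for i j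
      by (simp add: inner_axis)
    have [measurable]: "(\<lambda>x. H' x $ i) \<in> borel_measurable M" "(\<lambda>x. G x $ i) \<in> borel_measurable M" for i
      using m vector_measurable_iff by blast+
    show ?thesis unfolding F_def[abs_def] inner_vec_def matrix_vector_mult_def by simp
  qed
  \<comment> \<open>The weak inequality pairs \<open>H'\<close> with \<open>G\<close>. Where
    \<open>u > m\<close>, the difference \<open>G - H'\<close> lies in the kernel of
    \<open>B\<close>, hence in that of the coefficient matrix, so the ellipticity bounds apply to
    \<open>H'\<close> alone.\<close>
  have F_bounds: "AE x in M. k * (norm (B x *v H' x))\<^sup>2 \<le> F x \<and> F x \<le> K * (norm (B x *v H' x))\<^sup>2"
    using BG ell AE_space
  proof eventually_elim
    case (elim x)
    let ?a = "\<A> x (u x)"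
    have psd_x: "nonneg_semidefinite ?a" using psd elim by simp
    have "F x = H' x \<bullet> (?a *v H' x)"
    proof (cases "u x > m")
      case True
      define z where "z = G x - H' x"
      have "B x *v z = 0" using elim(1) True by (simp add: z_def matrix_vector_mult_diff_distrib)
      then have "z \<bullet> (?a *v z) \<le> 0" using elim(2) by (metis mult_zero_right norm_zero power_zero_numeral)
      moreover have "0 \<le> z \<bullet> (?a *v z)" using psd_x by (simp add: nonneg_semidefinite_def)
      ultimately have "?a *v z = 0" by (intro psd_kernel[OF psd_x]) simp
      then have "?a *v G x = ?a *v H' x" by (simp add: z_def matrix_vector_mult_diff_distrib)
      then show ?thesis by (simp add: F_def)
    qed (simp add: F_def H'_def)
    then show ?case using elim(2) by simp
  qed
  have F_i: "integrable M F"
  proof (rule Bochner_Integration.integrable_bound[OF integrable_mult_right[OF BH2_i, of K] F_m])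
    show "AE x in M. norm (F x) \<le> norm (K * (norm (B x *v H' x))\<^sup>2)"
      using F_bounds
    proof eventually_elim
      case (elim x)
      then have "0 \<le> F x" using \<open>k > 0\<close> by (meson mult_nonneg_nonneg less_imp_le order_trans zero_le_power2)
      then show ?case using elim by simp
    qed
  qed
  define y where "y = (\<integral>x. norm (B x *v H' x) \<partial>M)"
  have BH_i: "integrable M (\<lambda>x. norm (B x *v H' x))"
  proof (rule Bochner_Integration.integrable_bound[of _ "\<lambda>x. 1 + (norm (B x *v H' x))\<^sup>2"])
    have "t \<le> 1 + t\<^sup>2" for t :: real
    proof -
      have "2 * t \<le> t\<^sup>2 + 1" using sum_squares_bound[of t 1] by simp
      then show ?thesis using zero_le_power2[of t] by linarith
    qed
    then show "AE x in M. norm (norm (B x *v H' x)) \<le> norm (1 + (norm (B x *v H' x))\<^sup>2)" by simp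
  qed (use BH2_i in auto)
  have "k * (\<integral>x. (norm (B x *v H' x))\<^sup>2 \<partial>M) = (\<integral>x. k * (norm (B x *v H' x))\<^sup>2 \<partial>M)" by simp
  also have "\<dots> \<le> (\<integral>x. F x \<partial>M)"
    using BH2_i F_i F_bounds by (intro integral_mono_AE) (auto elim: eventually_mono)
  also have "\<dots> \<le> - (\<integral>x. \<phi> x * w' x \<partial>M)"
  proof -
    have "AE x in M. 0 \<le> w' x" by (simp add: w'_def)
    then have "- (\<integral>x. H' x \<bullet> (\<A> x (u x) *v G x) \<partial>M) \<ge> (\<integral>x. \<phi> x * w' x \<partial>M)"
      using sub uG wm unfolding weak_subsolution_def by blast
    then show ?thesis by (simp add: F_def[abs_def])
  qed
  also have "\<dots> \<le> (\<integral>x. \<bar>\<phi> x * w' x\<bar> \<partial>M)"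
    using integral_abs_bound[of M "\<lambda>x. \<phi> x * w' x"] by linarith
  also have "\<dots> \<le> X * y"
    unfolding y_def using X by (intro X_norm_bound[OF adm wm1]) auto
  finally have energy: "k * (\<integral>x. (norm (B x *v H' x))\<^sup>2 \<partial>M) \<le> X * y" .
  define s where "s = X / k"
  have "s > 0" using X \<open>k > 0\<close> by (simp add: s_def)
  have energy': "(\<integral>x. (norm (B x *v H' x))\<^sup>2 \<partial>M) \<le> s * y"
    using energy \<open>k > 0\<close> by (simp add: s_def field_simps)
  let ?U = "{x \<in> space M. u x > m}"
  have U: "?U \<in> sets M" by measurable
  have UI: "{x \<in> \<Omega>. m < u x} \<inter> \<Omega> = {x \<in> \<Omega>. m < u x}" by auto
  \<comment> \<open>Young's inequality with weight \<open>s\<close>, applied only on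
    \<open>?U\<close> since \<open>H'\<close> vanishes elsewhere. By \<open>energy'\<close> the
    quadratic term is at most \<open>y / 2\<close> and is absorbed on the left.\<close>
  have "y \<le> (\<integral>x. s / 2 * indicator ?U x + 1 / (2 * s) * (norm (B x *v H' x))\<^sup>2 \<partial>M)"
    unfolding y_def
  proof (rule integral_mono)
    show "integrable M (\<lambda>x. s / 2 * indicator ?U x + 1 / (2 * s) * (norm (B x *v H' x))\<^sup>2)"
      using BH2_i U by (intro Bochner_Integration.integrable_add integrable_mult_right integrable_real_indicator)
        (auto simp: emeasure_eq_measure)
    fix x assume x: "x \<in> space M"
    let ?t = "norm (B x *v H' x)"
    show "?t \<le> s / 2 * indicator ?U x + 1 / (2 * s) * ?t\<^sup>2"
    proof (cases "u x > m")
      case True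
      have "2 * s * ?t \<le> s\<^sup>2 + ?t\<^sup>2" using sum_squares_bound[of s ?t] by simp
      then have "?t \<le> s / 2 + 1 / (2 * s) * ?t\<^sup>2" using \<open>s > 0\<close> by (simp add: field_simps power2_eq_square)
      then show ?thesis using True x by simp
    qed (simp add: H'_def)
  qed (rule BH_i)
  also have "\<dots> = s / 2 * measure M ?U + 1 / (2 * s) * (\<integral>x. (norm (B x *v H' x))\<^sup>2 \<partial>M)"
    using BH2_i U by (subst Bochner_Integration.integral_add) (auto simp: emeasure_eq_measure UI intro!: integrable_real_indicator)
  also have "\<dots> \<le> s / 2 * measure M ?U + 1 / (2 * s) * (s * y)"
    using energy' \<open>s > 0\<close> by (intro add_left_mono mult_left_mono) auto
  also have "\<dots> = s / 2 * measure M ?U + y / 2" using \<open>s > 0\<close> by simp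
  finally have "y \<le> s * measure M ?U" by simp
  then show "(\<integral>x. norm (B x *v (if u x > m then H x else 0)) \<partial>M) \<le> X / k * measure M ?U"
    by (simp add: y_def H'_def s_def)
qed

end

section \<open>Level iteration\<close>

text \<open>A single formula for both branches, from which monotonicity and continuity across the
  threshold \<open>exp (2 * N)\<close> can be read off.\<close>

lemma orlicz_bump_eq: "orlicz_bump N t = t * ln (max t (exp (2 * N))) powr N"
  by (auto simp: orlicz_bump_def max_def)

lemma ln_max_exp_ge:
  fixes N t :: real
  shows "2 * N \<le> ln (max t (exp (2 * N)))"
proof -
  have "ln (exp (2 * N)) \<le> ln (max t (exp (2 * N)))"
    by (subst ln_le_cancel_iff) (auto simp: less_max_iff_disj)
  then show ?thesis by simp
qed

text \<open>Stated on the whole line, negative arguments included, since Borel measurability of the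
  bump function is derived from it.\<close>

lemma orlicz_bump_mono:
  assumes "N > 1"
  shows "mono (orlicz_bump N)"
proof (rule monoI)
  fix s t :: real assume "s \<le> t"
  have le: "ln (max s (exp (2 * N))) powr N \<le> ln (max t (exp (2 * N))) powr N"
  proof (rule powr_mono2)
    show "0 \<le> ln (max s (exp (2 * N)))" using ln_max_exp_ge[of N s] assms by linarith
    show "ln (max s (exp (2 * N))) \<le> ln (max t (exp (2 * N)))"
      using \<open>s \<le> t\<close> by (subst ln_le_cancel_iff) (auto simp: less_max_iff_disj)
  qed (use assms in simp)
  show "orlicz_bump N s \<le> orlicz_bump N t"
  proof (cases "0 \<le> s")
    case True
    then show ?thesis unfolding orlicz_bump_eq using \<open>s \<le> t\<close> le by (intro mult_mono) auto
  next
    case s: False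
    show ?thesis
    proof (cases "0 \<le> t")
      case True
      have "orlicz_bump N s \<le> 0" unfolding orlicz_bump_eq using s by (intro mult_nonpos_nonneg) auto
      also have "0 \<le> orlicz_bump N t" unfolding orlicz_bump_eq using True by simp
      finally show ?thesis .
    next
      case False
      then have "max s (exp (2 * N)) = exp (2 * N)" "max t (exp (2 * N)) = exp (2 * N)"
        using s exp_gt_zero[of "2 * N"] by (intro max.absorb2; linarith)+
      then show ?thesis unfolding orlicz_bump_eq using \<open>s \<le> t\<close> by (simp add: mult_right_mono)
    qed
  qed
qed

lemma orlicz_bump_continuous:
  assumes "N > 1"
  shows "continuous_on UNIV (orlicz_bump N)"
proof -
  have "ln (max t (exp (2 * N))) \<noteq> 0" for t using ln_max_exp_ge[of N t] assms by auto
  moreover have "max t (exp (2 * N)) \<noteq> 0" for t using exp_gt_zero[of "2 * N"] by (auto simp: max_def)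
  ultimately show ?thesis unfolding orlicz_bump_eq[abs_def]
    by (intro continuous_intros) auto
qed

text \<open>If \<open>{u > s}\<close> has measure at most \<open>exp (-L)\<close>, raising the level \<open>s\<close> by a multiple of
  \<open>level_step N L\<close> halves the measure of the superlevel set.\<close>

definition level_step :: "real \<Rightarrow> real \<Rightarrow> real" where
  "level_step N L = 2 / max (L / 2) 1 powr N + exp (- L / 2)"

lemma level_step_pos: "0 < level_step N L"
  unfolding level_step_def by (intro add_nonneg_pos) auto

lemma orlicz_bump_level_step:
  assumes "N > 1" "A > 0"
  shows "2 / A \<le> orlicz_bump N (level_step N (- ln A) / A)"
proof -
  let ?L = "- ln A" and ?t = "level_step N (- ln A) / A" and ?p = "max (- ln A / 2) 1"
  have A: "1 / A = exp ?L" using assms by (simp add: exp_minus inverse_eq_divide)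
  have t0: "0 < ?t" using level_step_pos assms by simp
  have "exp (?L / 2) = exp (- ?L / 2) * exp ?L" by (simp flip: exp_add)
  also have "\<dots> \<le> level_step N ?L * (1 / A)" unfolding A
    by (intro mult_right_mono) (auto simp: level_step_def)
  finally have "exp (?L / 2) \<le> ?t" by simp
  then have "?L / 2 \<le> ln ?t" using t0 by (simp add: ln_ge_iff)
  also have "ln ?t \<le> ln (max ?t (exp (2 * N)))" using t0 by (subst ln_le_cancel_iff) auto
  finally have "?p \<le> ln (max ?t (exp (2 * N)))"
    using ln_max_exp_ge[of N ?t] assms by simp
  then have p: "?p powr N \<le> ln (max ?t (exp (2 * N))) powr N"
    using assms by (intro powr_mono2) auto
  have "2 / A = (2 / ?p powr N / A) * ?p powr N" by (simp add: powr_eq_0_iff max_def)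
  also have "\<dots> \<le> ?t * ln (max ?t (exp (2 * N))) powr N"
    using assms p t0 by (intro mult_mono divide_right_mono) (auto simp: level_step_def)
  finally show ?thesis unfolding orlicz_bump_eq .
qed

text \<open>The exponential summand is geometric with ratio \<open>2^(-1/2)\<close>; the other is
  eventually comparable to \<open>j powr - N\<close>, which is where \<open>N > 1\<close>
  enters.\<close>

lemma summable_level_step:
  assumes "N > 1"
  shows "summable (\<lambda>j. level_step N (real j * ln 2 - b))"
  unfolding level_step_def
proof (rule summable_add)
  have "exp (- (real j * ln 2 - b) / 2) = exp (b / 2) * exp (- ln 2 / 2) ^ j" for j
    by (simp add: exp_of_nat_mult[symmetric] exp_add[symmetric] field_simps)
  moreover have "norm (exp (- ln 2 / 2 :: real)) < 1" by simp
  ultimately show "summable (\<lambda>j. exp (- (real j * ln 2 - b) / 2))"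
    by (simp add: summable_mult summable_geometric)
next
  define c where "c = 2 / (ln 2 / 4 :: real) powr N"
  \<comment> \<open>Beyond \<open>J\<close> the shift \<open>b\<close> uses up at most half of
    \<open>j * ln 2\<close>, whence the constant \<open>ln 2 / 4\<close> in
    \<open>c\<close>.\<close>
  obtain J :: nat where J: "2 * b / ln 2 < real J" using reals_Archimedean2 by blast
  show "summable (\<lambda>j. 2 / max ((real j * ln 2 - b) / 2) 1 powr N)"
  proof (rule summable_comparison_test)
    show "\<exists>N0. \<forall>j\<ge>N0. norm (2 / max ((real j * ln 2 - b) / 2) 1 powr N) \<le> c * real j powr - N"
    proof (intro exI[of _ "max J 1"] allI impI)
      fix j :: nat assume j: "max J 1 \<le> j"
      then have "2 * b / ln 2 \<le> real j" using J by auto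
      then have "2 * b \<le> real j * ln 2" by (simp add: field_simps)
      then have "real j * (ln 2 / 4) \<le> (real j * ln 2 - b) / 2" by simp
      then have "real j * (ln 2 / 4) \<le> max ((real j * ln 2 - b) / 2) 1" by linarith
      then have "(real j * (ln 2 / 4)) powr N \<le> max ((real j * ln 2 - b) / 2) 1 powr N"
        using assms by (intro powr_mono2) auto
      then have "2 / max ((real j * ln 2 - b) / 2) 1 powr N \<le> 2 / (real j * (ln 2 / 4)) powr N"
        using j by (intro divide_left_mono mult_pos_pos) auto
      also have "(real j * (ln 2 / 4)) powr N = real j powr N * (ln 2 / 4) powr N"
        by (rule powr_mult)
      also have "2 / (real j powr N * (ln 2 / 4) powr N) = c * real j powr - N"
      proof -
        have "2 / (p * q) = 2 / q * inverse p" for p q :: real by (simp add: divide_inverse mult.commute)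
        then show ?thesis unfolding c_def powr_minus by blast
      qed
      finally show "norm (2 / max ((real j * ln 2 - b) / 2) 1 powr N) \<le> c * real j powr - N" by simp
    qed
    show "summable (\<lambda>j. c * real j powr - N)"
      using assms by (intro summable_mult) (simp add: summable_real_powr_iff)
  qed
qed

section \<open>Halving of superlevel sets\<close>

context degenerate_domain
begin

text \<open>The parameter \<delta> plays two roles: it leaves an interval above \<open>l\<close>
  from which to pick an uncharged starting level, and it makes the constant passed to the bump
  inequality strictly large enough. The shift \<open>ln (measure lebesgue \<Omega>)\<close> in the
  sum comes from starting with the whole domain.\<close>

lemma AE_bound_above_level:
  fixes \<A> :: "real^'n \<Rightarrow> real \<Rightarrow> real^'n^'n"
  assumes dom: "\<Omega> \<noteq> {}" and "N > 1" and bump: "orlicz_sobolev_bump (orlicz_bump N) B \<Omega> C\<^sub>0"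
    and sub: "weak_subsolution B \<A> \<Omega> \<phi> u"
    and psd: "\<forall>x\<in>\<Omega>. \<forall>z. nonneg_semidefinite (\<A> x z)"
    and ell: "AE x in M. \<forall>z \<xi>. k * (norm (B x *v \<xi>))\<^sup>2 \<le> \<xi> \<bullet> (\<A> x z *v \<xi>) \<and>
        \<xi> \<bullet> (\<A> x z *v \<xi>) \<le> K * (norm (B x *v \<xi>))\<^sup>2"
    and \<A>_m: "(\<lambda>x. \<A> x (u x)) \<in> borel_measurable M"
    and adm: "A_admissible B \<Omega> \<phi>" and X: "X_norm B \<Omega> \<phi> \<le> ennreal X" "0 < X"
    and "k > 0" and l: "(\<lambda>x. max (u x - l) 0) \<in> sobolev_0 2 B \<Omega>" and "\<delta> > 0"
  shows "AE x in M. u x \<le> l + \<delta> + (max C\<^sub>0 0 * (X / k) + \<delta>) *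
      (\<Sum>j. level_step N (real j * ln 2 - ln (measure lebesgue \<Omega>)))"
proof -
  define a where "a = measure lebesgue \<Omega>"
  have "a > 0"
  proof -
    have "\<not> negligible \<Omega>" using dom open_dom open_not_negligible by blast
    then show ?thesis using dom_lmeasurable negligible_iff_measure unfolding a_def
      by (metis less_eq_real_def measure_nonneg)
  qed
  have u_m [measurable]: "u \<in> borel_measurable M"
    using sub unfolding weak_subsolution_def sobolev_def sobolev_grad_def by auto
  obtain H where H: "sobolev_grad_0 2 B \<Omega> (\<lambda>x. max (u x - l) 0) H"
    using l unfolding sobolev_0_def by blast
  define \<tau> where "\<tau> j = level_step N (real j * ln 2 - ln a)" for j
  have \<tau>0: "0 < \<tau> j" for j unfolding \<tau>_def by (rule level_step_pos)
  have \<tau>_sum: "summable \<tau>" unfolding \<tau>_def[abs_def] using \<open>N > 1\<close> by (rule summable_level_step)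
  define A where "A j = a / 2 ^ j" for j :: nat
  have A0: "0 < A j" for j using \<open>a > 0\<close> by (simp add: A_def)
  have \<tau>A: "\<tau> j = level_step N (- ln (A j))" for j
    using \<open>a > 0\<close> by (simp add: \<tau>_def A_def ln_div ln_realpow)
  define C where "C = max C\<^sub>0 0"
  have "0 \<le> C" by (simp add: C_def)
  \<comment> \<open>The factor by which every level step is scaled; it stays positive even if
    \<open>C = 0\<close>.\<close>
  define Q where "Q = C * (X / k) + \<delta>"
  have "Q > 0" using \<open>0 \<le> C\<close> X \<open>k > 0\<close> \<open>\<delta> > 0\<close> by (simp add: Q_def add_nonneg_pos)
  define s where "s j = Q * (\<Sum>i<j. \<tau> i)" for j
  have s0: "0 \<le> s j" for j unfolding s_def using \<open>Q > 0\<close> \<tau>0 by (intro mult_nonneg_nonneg sum_nonneg) (auto simp: less_imp_le)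
  \<comment> \<open>The increments \<open>s j\<close> are fixed in advance, so excluding countably
    many translates of \<open>Bad\<close> makes all levels \<open>m + s j\<close> uncharged at
    once.\<close>
  define Bad where "Bad = {c. \<not> (AE x in M. u x \<noteq> c)}"
  have "countable (\<Union>j. (\<lambda>c. c - s j) ` Bad)"
    using countable_charged_levels[OF u_m] by (simp add: Bad_def)
  then have "\<not> {l<..<l + \<delta>} \<subseteq> (\<Union>j. (\<lambda>c. c - s j) ` Bad)"
    using \<open>\<delta> > 0\<close> uncountable_open_interval[of l "l + \<delta>"] countable_subset by auto
  then obtain m where "m \<in> {l<..<l + \<delta>}" "m \<notin> (\<Union>j. (\<lambda>c. c - s j) ` Bad)" by blast
  then have m: "l < m" "m < l + \<delta>" "m \<notin> (\<Union>j. (\<lambda>c. c - s j) ` Bad)" by simp_all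
  have level: "AE x in M. u x \<noteq> m + s j" for j
  proof (rule ccontr)
    assume "\<not> ?thesis"
    then have "m + s j \<in> Bad" by (simp add: Bad_def)
    then have "m \<in> (\<lambda>c. c - s j) ` Bad" by (rule image_eqI[rotated]) simp
    then show False using m(3) by blast
  qed
  have halving: "measure M {x \<in> space M. u x > m + s j} \<le> A j" for j
  proof (induction j)
    case 0
    have "measure M {x \<in> space M. u x > m + s 0} \<le> measure M (space M)" by (intro finite_measure_mono) auto
    also have "\<dots> = a" by (simp add: a_def measure_restrict_space)
    finally show ?case by (simp add: A_def)
  next
    case (Suc j)
    let ?w = "\<lambda>x. max (u x - (m + s j)) 0" and ?H = "\<lambda>x. if u x > m + s j then H x else 0"
    let ?V = "{x \<in> space M. u x > m + s (Suc j)}"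
    have "l < m + s j" using m(1) s0[of j] by linarith
    note energy = superlevel_energy_bound[OF sub psd ell \<A>_m adm X \<open>k > 0\<close> H this level]
    have "(\<integral>x. norm (B x *v ?H x) \<partial>M) \<le> X / k * A j"
      using energy(2) mult_left_mono[OF Suc.IH, of "X / k"] X \<open>k > 0\<close> by (meson divide_nonneg_pos less_imp_le order_trans)
    then have "C * (\<integral>x. norm (B x *v ?H x) \<partial>M) \<le> C * (X / k * A j)"
      using \<open>0 \<le> C\<close> by (rule mult_left_mono)
    also have "\<dots> < Q * A j" using A0[of j] \<open>\<delta> > 0\<close> by (simp add: Q_def distrib_right mult.assoc)
    finally have bound: "(\<integral>\<^sup>+x. ennreal (orlicz_bump N (\<bar>?w x\<bar> / (Q * A j))) \<partial>M) \<le> 1"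
      unfolding C_def
      by (intro orlicz_bump_sobolev_0[OF bump _ _ energy(1)] orlicz_bump_mono orlicz_bump_continuous \<open>N > 1\<close>)
    have V: "?V \<in> sets M" by measurable
    \<comment> \<open>Chebyshev's inequality for the bump function: on \<open>?V\<close> the
      integrand is at least \<open>2 / A j\<close>, while its integral is at most 1.\<close>
    have "ennreal (2 / A j) * emeasure M ?V = (\<integral>\<^sup>+x. ennreal (2 / A j) * indicator ?V x \<partial>M)"
      using V by (rule nn_integral_cmult_indicator[symmetric])
    also have "\<dots> \<le> (\<integral>\<^sup>+x. ennreal (orlicz_bump N (\<bar>?w x\<bar> / (Q * A j))) \<partial>M)"
    proof (rule nn_integral_mono)
      fix x
      show "ennreal (2 / A j) * indicator ?V x \<le> ennreal (orlicz_bump N (\<bar>?w x\<bar> / (Q * A j)))"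
      proof (cases "x \<in> ?V")
        case True
        then have "m + s (Suc j) < u x" by simp
        then have "Q * \<tau> j < u x - (m + s j)" by (simp add: s_def distrib_left)
        then have "Q * \<tau> j \<le> \<bar>?w x\<bar>" by linarith
        then have "\<tau> j / A j \<le> \<bar>?w x\<bar> / (Q * A j)" using \<open>Q > 0\<close> A0[of j] by (simp add: field_simps)
        then have "orlicz_bump N (\<tau> j / A j) \<le> orlicz_bump N (\<bar>?w x\<bar> / (Q * A j))"
          by (rule monoD[OF orlicz_bump_mono[OF \<open>N > 1\<close>]])
        then have "2 / A j \<le> orlicz_bump N (\<bar>?w x\<bar> / (Q * A j))"
          using orlicz_bump_level_step[OF \<open>N > 1\<close> A0[of j]] unfolding \<tau>A by (rule order_trans[rotated])
        then show ?thesis using True by (simp add: ennreal_leI)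
      qed simp
    qed
    also have "\<dots> \<le> 1" by (rule bound)
    finally have "ennreal (2 / A j) * ennreal (measure M ?V) \<le> 1" by (simp only: emeasure_eq_measure)
    moreover have "ennreal (2 / A j) * ennreal (measure M ?V) = ennreal (2 / A j * measure M ?V)"
      using A0[of j] by (intro ennreal_mult[symmetric]) (auto simp: less_imp_le)
    ultimately have "2 / A j * measure M ?V \<le> 1" by (simp only: ennreal_le_1)
    then show ?case using A0[of j] by (simp add: A_def field_simps)
  qed
  have U: "{x \<in> space M. u x > c} \<in> sets M" for c by measurable
  \<comment> \<open>The finite limit of the increasing levels; the set above it lies in every
    earlier superlevel set.\<close>
  define m_top where "m_top = m + Q * suminf \<tau>"
  let ?V = "{x \<in> space M. u x > m_top}"
  have "measure M ?V \<le> A j" for j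
  proof -
    have "s j \<le> Q * suminf \<tau>"
      unfolding s_def using \<tau>_sum \<tau>0 \<open>Q > 0\<close> by (intro mult_left_mono sum_le_suminf) (auto simp: less_imp_le)
    then have "measure M ?V \<le> measure M {x \<in> space M. u x > m + s j}"
      by (intro finite_measure_mono U) (auto simp: m_top_def)
    then show ?thesis using halving[of j] by linarith
  qed
  moreover have "A \<longlonglongrightarrow> 0"
    unfolding A_def[abs_def] by (rule LIMSEQ_divide_realpow_zero) simp
  ultimately have "measure M ?V \<le> 0" by (intro LIMSEQ_le_const[of A]) blast+
  then have "emeasure M ?V = 0" by (simp only: emeasure_eq_measure measure_le_0_iff ennreal_0)
  then have "AE x in M. \<not> u x > m_top" 
    using U[of m_top] by (subst AE_iff_measurable[OF _ refl]) auto
  then show ?thesis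
  proof eventually_elim
    case (elim x)
    then have "u x \<le> m + Q * suminf \<tau>" by (simp add: m_top_def)
    then show ?case using m(2) unfolding \<tau>_def[abs_def] Q_def C_def a_def by linarith
  qed
qed

end

section \<open>Passage to the boundary supremum\<close>

theorem theorem12:
  fixes \<Omega> :: "(real^'n) set"
    and A B :: "real^'n \<Rightarrow> real^'n^'n"
    and k K N C\<^sub>0 :: real
  assumes "CARD('n) \<ge> 2"
    and "open \<Omega>" and "connected \<Omega>" and "\<Omega> \<noteq> {}" and "bounded \<Omega>"
    and "\<exists>L. L-lipschitz_on \<Omega> B"
    and "\<forall>x\<in>\<Omega>. A x = transpose (B x) ** B x"
    and "k > 0" and "K > 0" and "N > 1"
    and "orlicz_sobolev_bump (orlicz_bump N) B \<Omega> C\<^sub>0"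
  shows "\<exists>C\<ge>0. \<forall>(\<A> :: real^'n \<Rightarrow> real \<Rightarrow> real^'n^'n) \<phi> u.
           (\<forall>x\<in>\<Omega>. \<forall>z. nonneg_semidefinite (\<A> x z)) \<and>
           (AE x in lebesgue_on \<Omega>. \<forall>z \<xi>.
              k * (\<xi> \<bullet> (A x *v \<xi>)) \<le> \<xi> \<bullet> (\<A> x z *v \<xi>) \<and>
              \<xi> \<bullet> (\<A> x z *v \<xi>) \<le> K * (\<xi> \<bullet> (A x *v \<xi>))) \<and>
           (\<lambda>x. \<A> x (u x)) \<in> borel_measurable (lebesgue_on \<Omega>) \<and>
           A_admissible B \<Omega> \<phi> \<and>
           weak_subsolution B \<A> \<Omega> \<phi> u \<and>
           (AE x in lebesgue_on \<Omega>. 0 \<le> u x) \<longrightarrow>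
           esssup (lebesgue_on \<Omega>) (\<lambda>x. ereal (u x)) \<le>
             boundary_sup B \<Omega> u + ereal C * enn2ereal (X_norm B \<Omega> \<phi>)"
proof -
  interpret degenerate_domain \<Omega> B
    using assms by unfold_locales
  define S where "S = (\<Sum>j. level_step N (real j * ln 2 - ln (measure lebesgue \<Omega>)))"
  have "0 \<le> S" unfolding S_def
    by (intro suminf_nonneg summable_level_step less_imp_le[OF level_step_pos] \<open>N > 1\<close>)
  define D where "D = max C\<^sub>0 0 / k"
  have "0 \<le> D" using \<open>k > 0\<close> by (simp add: D_def)
  show ?thesis
  proof (intro exI[of _ "D * S"] conjI allI impI)
    show "0 \<le> D * S" using \<open>0 \<le> D\<close> \<open>0 \<le> S\<close> by simp
  next
    fix \<A> :: "real^'n \<Rightarrow> real \<Rightarrow> real^'n^'n" and \<phi> u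
    assume H: "(\<forall>x\<in>\<Omega>. \<forall>z. nonneg_semidefinite (\<A> x z)) \<and>
           (AE x in lebesgue_on \<Omega>. \<forall>z \<xi>.
              k * (\<xi> \<bullet> (A x *v \<xi>)) \<le> \<xi> \<bullet> (\<A> x z *v \<xi>) \<and>
              \<xi> \<bullet> (\<A> x z *v \<xi>) \<le> K * (\<xi> \<bullet> (A x *v \<xi>))) \<and>
           (\<lambda>x. \<A> x (u x)) \<in> borel_measurable (lebesgue_on \<Omega>) \<and>
           A_admissible B \<Omega> \<phi> \<and>
           weak_subsolution B \<A> \<Omega> \<phi> u \<and>
           (AE x in lebesgue_on \<Omega>. 0 \<le> u x)"
    then have psd: "\<forall>x\<in>\<Omega>. \<forall>z. nonneg_semidefinite (\<A> x z)"
      and \<A>_m: "(\<lambda>x. \<A> x (u x)) \<in> borel_measurable M" and adm: "A_admissible B \<Omega> \<phi>"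
      and sub: "weak_subsolution B \<A> \<Omega> \<phi> u" by blast+
    have "AE x in M. \<forall>z \<xi>. k * (\<xi> \<bullet> (A x *v \<xi>)) \<le> \<xi> \<bullet> (\<A> x z *v \<xi>) \<and>
        \<xi> \<bullet> (\<A> x z *v \<xi>) \<le> K * (\<xi> \<bullet> (A x *v \<xi>))" using H by blast
    then have ell: "AE x in M. \<forall>z \<xi>. k * (norm (B x *v \<xi>))\<^sup>2 \<le> \<xi> \<bullet> (\<A> x z *v \<xi>) \<and>
        \<xi> \<bullet> (\<A> x z *v \<xi>) \<le> K * (norm (B x *v \<xi>))\<^sup>2"
      using AE_space by eventually_elim (use assms(7) in \<open>simp add: inner_gram_matrix\<close>)
    have u_m: "u \<in> borel_measurable M"
      using sub unfolding weak_subsolution_def sobolev_def sobolev_grad_def by auto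
    obtain x where x: "X_norm B \<Omega> \<phi> = ennreal x" "0 \<le> x"
      using adm unfolding A_admissible_def by (cases "X_norm B \<Omega> \<phi>") auto
    have le: "esssup M (\<lambda>x. ereal (u x)) \<le> ereal l + ereal (D * S * x)"
      if l: "(\<lambda>x. max (u x - l) 0) \<in> sobolev_0 2 B \<Omega>" for l
    proof (rule ereal_le_epsilon2)
      fix e :: real assume "0 < e"
      \<comment> \<open>The slack enters through the starting level, through
        \<open>x + \<delta>\<close> in place of the possibly vanishing norm \<open>x\<close>, and
        through the strictness term; the total is \<open>\<delta> * (1 + D * S + S)\<close>.\<close>
      define \<delta> where "\<delta> = e / (1 + D * S + S)"
      have pos: "0 < 1 + D * S + S" using \<open>0 \<le> D\<close> \<open>0 \<le> S\<close> by (simp add: add_pos_nonneg)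
      then have "0 < \<delta>" using \<open>0 < e\<close> by (simp add: \<delta>_def)
      have "AE y in M. u y \<le> l + \<delta> + (max C\<^sub>0 0 * ((x + \<delta>) / k) + \<delta>) * S"
        unfolding S_def using x \<open>0 < \<delta>\<close>
        by (intro AE_bound_above_level[OF \<open>\<Omega> \<noteq> {}\<close> \<open>N > 1\<close> assms(11) sub psd ell \<A>_m adm _ _ \<open>k > 0\<close> l])
          (auto simp: ennreal_leI)
      also have "l + \<delta> + (max C\<^sub>0 0 * ((x + \<delta>) / k) + \<delta>) * S = l + D * S * x + \<delta> * (1 + D * S + S)"
        by (simp add: D_def field_simps add_divide_distrib)
      also have "\<delta> * (1 + D * S + S) = e" using pos by (simp add: \<delta>_def)
      finally have "AE y in M. ereal (u y) \<le> ereal (l + D * S * x + e)" by simp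
      then have "esssup M (\<lambda>x. ereal (u x)) \<le> ereal (l + D * S * x + e)"
        using u_m by (intro esssup_I) auto
      then show "esssup M (\<lambda>x. ereal (u x)) \<le> ereal l + ereal (D * S * x) + ereal e" by simp
    qed
    \<comment> \<open>The finite term is moved to the left so that the claim becomes a lower bound
      for an infimum; this also covers an empty set of boundary levels.\<close>
    have "esssup M (\<lambda>x. ereal (u x)) - ereal (D * S * x) \<le> boundary_sup B \<Omega> u"
      unfolding boundary_sup_def
    proof (rule Inf_greatest)
      fix y assume "y \<in> ereal ` {l. (\<lambda>x. max (u x - l) 0) \<in> sobolev_0 2 B \<Omega>}"
      then obtain l where "y = ereal l" "(\<lambda>x. max (u x - l) 0) \<in> sobolev_0 2 B \<Omega>" by blast
      then show "esssup M (\<lambda>x. ereal (u x)) - ereal (D * S * x) \<le> y"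
        using le by (subst ereal_minus_le) auto
    qed
    then have "esssup M (\<lambda>x. ereal (u x)) \<le> boundary_sup B \<Omega> u + ereal (D * S * x)"
      by (subst (asm) ereal_minus_le) auto
    then show "esssup M (\<lambda>x. ereal (u x)) \<le> boundary_sup B \<Omega> u + ereal (D * S) * enn2ereal (X_norm B \<Omega> \<phi>)"
      using x by simp
  qed
qed

end
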